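(* Let $\delta\in(0,1)$. Consider the online learning with experts problem with $n$ experts over $T$ days, where $T=n^{O(1)}$, in the memory-bounded query model against an oblivious adversary (described in the context). There exists a randomized algorithm that uses space $\tilde O(n^\delta)$ words and whose regret $$\sum_{t=1}^T \ell_t(i_t)-\min_{i\in[n]}\sum_{t=1}^T \ell_t(i)$$ is at most $\tilde O\!\left(n^2T^{\frac{1}{1+\delta}}\right)$ with probability at least $1-1/\mathrm{poly}(T)$.
   Context: Online experts problem: on each day $t\in[T]$ each of $n$ experts makes a prediction; the algorithm chooses an expert $i_t\in[n]$ to follow, then a loss vector $\ell_t\in[0,1]^n$ is revealed and the algorithm incurs loss $\ell_t(i_t)$. Oblivious adversary: the loss vectors $\ell_1,\dots,\ell_T$ are fixed in advance (possibly randomly, but independently of the algorithm's randomness). Query/memory model: before day $t$ the algorithm selects a set $E_t$ of experts whose predictions it observes, follows some $i_t\in E_t$, and afterwards observes the losses $\ell_t(e)$ only for $e\in E_t$. A word holds $O(\log(nT))$ bits; the algorithm's memory state at each time consists of $M_t$ words (including those naming $E_t$), and it has space complexity $M$ if $M_t\le M$ for all $t$. The algorithm has oracle access to random bits, whose storage is not counted. $\tilde O$ hides factors polylogarithmic in $n$ and $T$; $n$ and $T$ are polynomially related. *)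

theory Defs
  imports "HOL-Probability.Probability"
begin

text \<open>
  Experts are \<open>{..<n}\<close> and days are \<open>{..<T}\<close>. A memory state is a pair of lists of machine words:
  the first list names the experts that are observed on the current day, the second one is the rest
  of the memory. An algorithm has no access to the day number except through its memory.
\<close>

type_synonym memory = "nat list \<times> nat list"

definition observed :: "memory \<Rightarrow> nat set" where
  "observed m = set (fst m)"

definition memory_words :: "memory \<Rightarrow> nat list" where
  "memory_words m = fst m @ snd m"

text \<open>
  The random oracle is an infinite sequence of fair coin flips. It is read-only, is available in
  every step, and is not part of the memory.
\<close>

type_synonym oracle_bits = "nat \<Rightarrow> bool"

definition coins :: "oracle_bits measure" where
  "coins = (\<Pi>\<^sub>M j\<in>UNIV. measure_pmf (bernoulli_pmf (1 / 2)))"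

text \<open>
  \<open>start\<close> gives the memory before the first day (hence also the first query set), \<open>follow\<close> picks the
  expert from the memory and the observed predictions, and \<open>update\<close> computes the memory for the next
  day (hence also the next query set) from the memory, the observed predictions and the observed
  losses. Predictions and losses are passed only after restriction to the query set, see \<open>memory_at\<close>.
\<close>

record 'p expert_alg =
  start :: "oracle_bits \<Rightarrow> memory"
  follow :: "oracle_bits \<Rightarrow> memory \<Rightarrow> (nat \<Rightarrow> 'p) \<Rightarrow> nat"
  update :: "oracle_bits \<Rightarrow> memory \<Rightarrow> (nat \<Rightarrow> 'p) \<Rightarrow> (nat \<Rightarrow> real) \<Rightarrow> memory"

primrec memory_at ::
  "'p expert_alg \<Rightarrow> oracle_bits \<Rightarrow> (nat \<Rightarrow> nat \<Rightarrow> 'p) \<Rightarrow> (nat \<Rightarrow> nat \<Rightarrow> real) \<Rightarrow> nat \<Rightarrow> memory" where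
  "memory_at A \<omega> p l 0 = start A \<omega>"
| "memory_at A \<omega> p l (Suc t) =
     (let m = memory_at A \<omega> p l t
      in update A \<omega> m (restrict (p t) (observed m)) (restrict (l t) (observed m)))"

definition followed ::
  "'p expert_alg \<Rightarrow> oracle_bits \<Rightarrow> (nat \<Rightarrow> nat \<Rightarrow> 'p) \<Rightarrow> (nat \<Rightarrow> nat \<Rightarrow> real) \<Rightarrow> nat \<Rightarrow> nat" where
  "followed A \<omega> p l t =
     (let m = memory_at A \<omega> p l t in follow A \<omega> m (restrict (p t) (observed m)))"

definition regret ::
  "nat \<Rightarrow> nat \<Rightarrow> 'p expert_alg \<Rightarrow> oracle_bits \<Rightarrow> (nat \<Rightarrow> nat \<Rightarrow> 'p) \<Rightarrow> (nat \<Rightarrow> nat \<Rightarrow> real) \<Rightarrow> real" where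
  "regret n T A \<omega> p l =
     (\<Sum>t<T. l t (followed A \<omega> p l t)) - (MIN i\<in>{..<n}. \<Sum>t<T. l t i)"

text \<open>
  The single predictions live in an arbitrary measurable space \<open>P\<close>, the single losses in \<open>[0,1]\<close>.
  An oblivious adversary is a probability distribution on sequences of predictions and losses;
  its independence of the coins is expressed by the product measure with \<open>coins\<close>. Fixed sequences
  are the point masses.
\<close>

definition loss_space :: "real measure" where
  "loss_space = restrict_space borel {0..1}"

definition env_space ::
  "'p measure \<Rightarrow> nat \<Rightarrow> nat \<Rightarrow> ((nat \<Rightarrow> nat \<Rightarrow> 'p) \<times> (nat \<Rightarrow> nat \<Rightarrow> real)) measure" where
  "env_space P n T =
     (\<Pi>\<^sub>M t\<in>{..<T}. \<Pi>\<^sub>M i\<in>{..<n}. P) \<Otimes>\<^sub>M (\<Pi>\<^sub>M t\<in>{..<T}. \<Pi>\<^sub>M i\<in>{..<n}. loss_space)"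

definition oblivious_adversary ::
  "'p measure \<Rightarrow> nat \<Rightarrow> nat \<Rightarrow> ((nat \<Rightarrow> nat \<Rightarrow> 'p) \<times> (nat \<Rightarrow> nat \<Rightarrow> real)) measure \<Rightarrow> bool" where
  "oblivious_adversary P n T D \<longleftrightarrow> prob_space D \<and> sets D = sets (env_space P n T)"

definition measurable_alg :: "'p measure \<Rightarrow> 'p expert_alg \<Rightarrow> bool" where
  "measurable_alg P A \<longleftrightarrow>
     start A \<in> coins \<rightarrow>\<^sub>M count_space UNIV \<and>
     (\<forall>m. (\<lambda>(\<omega>, q). follow A \<omega> m q)
        \<in> coins \<Otimes>\<^sub>M (\<Pi>\<^sub>M i\<in>observed m. P) \<rightarrow>\<^sub>M count_space UNIV) \<and>
     (\<forall>m. (\<lambda>(\<omega>, q, r). update A \<omega> m q r)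
        \<in> coins \<Otimes>\<^sub>M (\<Pi>\<^sub>M i\<in>observed m. P) \<Otimes>\<^sub>M (\<Pi>\<^sub>M i\<in>observed m. loss_space)
          \<rightarrow>\<^sub>M count_space UNIV)"

text \<open>
  The logarithm in all hidden factors is \<open>log 2 (2 * n * T) = 1 + log 2 (n * T)\<close>, so that it does
  not vanish for \<open>n = T = 1\<close>.
\<close>

definition log_size :: "nat \<Rightarrow> nat \<Rightarrow> real" where
  "log_size n T = log 2 (2 * real n * real T)"

definition word_bits :: "nat \<Rightarrow> nat \<Rightarrow> nat \<Rightarrow> nat" where
  "word_bits b n T = b * nat \<lceil>log_size n T\<rceil>"

definition polylog :: "real \<Rightarrow> nat \<Rightarrow> nat \<Rightarrow> nat \<Rightarrow> real" where
  "polylog C k n T = C * log_size n T ^ k"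

text \<open>The constraints hold in the worst case over the oracle bits, the predictions and the losses.\<close>

definition obeys_query_model :: "'p measure \<Rightarrow> nat \<Rightarrow> nat \<Rightarrow> 'p expert_alg \<Rightarrow> bool" where
  "obeys_query_model P n T A \<longleftrightarrow>
     (\<forall>(p, l)\<in>space (env_space P n T). \<forall>\<omega>. \<forall>t<T.
        observed (memory_at A \<omega> p l t) \<subseteq> {..<n} \<and>
        followed A \<omega> p l t \<in> observed (memory_at A \<omega> p l t))"

definition has_space_complexity ::
  "'p measure \<Rightarrow> nat \<Rightarrow> nat \<Rightarrow> nat \<Rightarrow> 'p expert_alg \<Rightarrow> real \<Rightarrow> bool" where
  "has_space_complexity P n T b A M \<longleftrightarrow>
     (\<forall>(p, l)\<in>space (env_space P n T). \<forall>\<omega>. \<forall>t<T.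
        real (length (memory_words (memory_at A \<omega> p l t))) \<le> M \<and>
        (\<forall>w\<in>set (memory_words (memory_at A \<omega> p l t)). w < 2 ^ word_bits b n T))"

end

theory Submission
  imports Defs
begin

text \<open>
  Partition time into epochs, and run on each epoch an algorithm whose regret per epoch is at most
  \<open>V\<close> (at the lowest level this is the length of the epoch). The next level improves it: it keeps a
  small pool of experts and plays, in every epoch, Hedge on the pool and the given algorithm. At the
  start of each epoch a uniformly random expert joins the pool. It is evicted as soon as its gain over the older
  members of the pool and the given algorithm is at most \<open>V / (3 G)\<close> per epoch of its stay. As the
  total gain of the whole pool is at most \<open>V\<close> per epoch, a harmonic sum bounds the size of the pool
  by \<open>3 G\<close> up to a logarithm.

  Fix an expert \<open>i\<close>. Whether a copy of \<open>i\<close> that is drawn in an epoch would be evicted, and when, depends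
  only on the pool at the time of the draw. If it would be, then the older pool competes with \<open>i\<close> until
  then; if it would stay until the end of the block, then it is actually drawn with probability at
  least \<open>1 / (2 n)\<close>, so that with high probability there are only \<open>O(n log T)\<close> such epochs before one
  in which it is drawn. With \<open>K = G H\<close> epochs per block and \<open>H\<close> of order \<open>n log T\<close> the regret per
  block is at most \<open>H V\<close>: blocks are \<open>G H\<close> times longer than epochs, but the regret grows only by the
  factor \<open>H\<close>. Taking \<open>G\<close> of order \<open>n\<^sup>\<delta>\<close> and iterating until a block comprises all \<open>T\<close> days yields the exponent
  \<open>1 / (1 + \<delta>)\<close>; since \<open>T\<close> is polynomial in \<open>n\<close>, there are only constantly many levels.

  The pools do not depend on the random choices made for playing, hence the latter are independent
  once the pools are given, and the actual loss is concentrated around its mean.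
\<close>

section \<open>Averages over lists of independent uniform draws\<close>

text \<open>The constant 3 splits the budget \<open>H V\<close> of a block into thirds. In each
  epoch Hedge may lose \<open>V / (3 G)\<close>, and the older pool may trail an evicted copy of
  \<open>i\<close> by \<open>V / (3 G)\<close>; over \<open>G H\<close> epochs this is two thirds of
  \<open>H V\<close>. The last third pays for \<open>H / 3\<close> costly epochs. The harmonic sum
  appears because eviction compares rates while entries differ in age: an entry is charged only to
  gains made since its own start, and weighting an epoch by its inverse distance to the present
  makes every survivor weigh at least \<open>V / (3 G)\<close>. The regret bound \<open>V\<close> of
  the given algorithm enters twice: it caps the price of a costly epoch, and it ensures that
  clipping losses at \<open>V\<close> below that algorithm hides no gain of \<open>i\<close>. The
  factor \<open>n\<^sup>2\<close> has two sources. The last block may be longer than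
  \<open>T\<close> by a factor \<open>G H\<close>, which inflates the regret by up to
  \<open>H\<close>, of order \<open>n\<close> up to logarithms. Hedge needs lowest epochs of length
  about \<open>G\<^sup>2\<close>; at most the square root of this length survives in the bound,
  which gives at most another \<open>n\<close>.\<close>

primrec avg :: "nat \<Rightarrow> nat \<Rightarrow> (nat list \<Rightarrow> real) \<Rightarrow> real" where
  "avg Q 0 f = f []"
| "avg Q (Suc k) f = (\<Sum>x<Q. avg Q k (\<lambda>xs. f (x # xs))) / real Q"

lemma avg_altdef:
  "avg Q k f = (\<Sum>xs | set xs \<subseteq> {..<Q} \<and> length xs = k. f xs) / real Q ^ k"
proof (induction k arbitrary: f)
  case 0
  have "{xs :: nat list. set xs \<subseteq> {..<Q} \<and> length xs = 0} = {[]}" by auto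
  then show ?case by simp
next
  case (Suc k)
  let ?L = "{xs :: nat list. set xs \<subseteq> {..<Q} \<and> length xs = k}"
  have inj: "inj_on (\<lambda>(xs, n). n # xs) (?L \<times> {..<Q})"
    by (auto simp: inj_on_def)
  have "(\<Sum>xs | set xs \<subseteq> {..<Q} \<and> length xs = Suc k. f xs) = (\<Sum>(xs, n)\<in>?L \<times> {..<Q}. f (n # xs))"
    by (subst lists_length_Suc_eq, subst sum.reindex[OF inj]) (simp add: case_prod_unfold)
  also have "\<dots> = (\<Sum>n<Q. \<Sum>xs\<in>?L. f (n # xs))"
    by (subst sum.swap) (simp add: sum.cartesian_product)
  finally show ?case
    by (simp add: Suc sum_divide_distrib mult.commute)
qed

lemma avg_mono:
  assumes "\<And>xs. length xs = k \<Longrightarrow> set xs \<subseteq> {..<Q} \<Longrightarrow> f xs \<le> g xs"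
  shows "avg Q k f \<le> avg Q k g"
  unfolding avg_altdef by (intro divide_right_mono sum_mono assms) auto

lemma avg_cong:
  assumes "\<And>xs. length xs = k \<Longrightarrow> set xs \<subseteq> {..<Q} \<Longrightarrow> f xs = g xs"
  shows "avg Q k f = avg Q k g"
  unfolding avg_altdef using assms by (intro arg_cong2[where f = "(/)"] sum.cong) auto

lemma avg_const: "0 < Q \<Longrightarrow> avg Q k (\<lambda>_. c) = c"
  by (induction k) auto

lemma avg_append: "avg Q (j + k) f = avg Q j (\<lambda>xs. avg Q k (\<lambda>ys. f (xs @ ys)))"
  by (induction j arbitrary: f) auto

lemma avg_cmult: "avg Q k (\<lambda>xs. c * f xs) = c * avg Q k f"
  by (simp add: avg_altdef sum_distrib_left)

section \<open>Extracting independent uniform draws from the coins\<close>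

text \<open>Different pairs of a key and a bit position use different coins; this is what makes
  draws with different keys independent.\<close>

definition coin_index :: "nat \<times> nat \<Rightarrow> nat \<Rightarrow> nat" where
  "coin_index key i = prod_encode (prod_encode key, i)"

definition draw :: "nat \<Rightarrow> oracle_bits \<Rightarrow> nat \<Rightarrow> nat \<Rightarrow> nat" where
  "draw m \<omega> r t = horner_sum of_bool 2 (map (\<lambda>i. \<omega> (coin_index (r, t) i)) [0..<m])"

lemma coin_index_eq_iff: "coin_index k i = coin_index k' i' \<longleftrightarrow> k = k' \<and> i = i'"
  by (simp add: coin_index_def)

lemma bit_draw: "bit (draw m \<omega> r t) i \<longleftrightarrow> i < m \<and> \<omega> (coin_index (r, t) i)"
  by (auto simp: draw_def bit_horner_sum_bit_iff)

lemma draw_eq_iff: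
  assumes "v < 2 ^ m"
  shows "draw m \<omega> r t = v \<longleftrightarrow> (\<forall>i<m. \<omega> (coin_index (r, t) i) = bit v i)"
proof -
  have "take_bit m v = v" using assms by (simp add: take_bit_nat_eq_self)
  then have "\<not> bit v i" if "\<not> i < m" for i
    using that by (metis bit_take_bit_iff)
  then show ?thesis
    by (auto simp: bit_eq_iff bit_draw)
qed

lemma draw_less: "draw m \<omega> r t < 2 ^ m"
proof -
  have "take_bit m (draw m \<omega> r t) = draw m \<omega> r t"
    by (auto simp: bit_eq_iff bit_take_bit_iff bit_draw)
  then show ?thesis by (metis take_bit_nat_less_exp)
qed

lemma prob_space_coins: "prob_space coins"
  unfolding coins_def by (intro prob_space_PiM) (simp add: measure_pmf.prob_space_axioms)

lemma space_coins [simp]: "space coins = UNIV"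
  by (simp add: coins_def space_PiM)

lemma measurable_coin [measurable]: "(\<lambda>\<omega>. \<omega> j) \<in> coins \<rightarrow>\<^sub>M count_space UNIV"
proof -
  have "(\<lambda>\<omega>. \<omega> j) \<in> coins \<rightarrow>\<^sub>M measure_pmf (bernoulli_pmf (1/2))"
    unfolding coins_def by (rule measurable_component_singleton) simp
  then show ?thesis by simp
qed

lemma measurable_draw [measurable]: "(\<lambda>\<omega>. draw m \<omega> r t) \<in> coins \<rightarrow>\<^sub>M count_space UNIV"
proof -
  have "(\<lambda>\<omega>. map (\<lambda>i. \<omega> (coin_index (r, t) i)) is) \<in> coins \<rightarrow>\<^sub>M count_space UNIV" for "is"
  proof (induction "is")
    case (Cons i js)
    have "(\<lambda>p. fst p # snd p) \<circ> (\<lambda>\<omega>. (\<omega> (coin_index (r, t) i), map (\<lambda>i. \<omega> (coin_index (r, t) i)) js))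
       \<in> coins \<rightarrow>\<^sub>M count_space UNIV"
    proof (rule measurable_comp)
      show "(\<lambda>\<omega>. (\<omega> (coin_index (r, t) i), map (\<lambda>i. \<omega> (coin_index (r, t) i)) js))
        \<in> coins \<rightarrow>\<^sub>M count_space UNIV \<Otimes>\<^sub>M count_space UNIV"
        using Cons by measurable
    qed (simp add: pair_measure_countable)
    then show ?case by (simp add: comp_def)
  qed simp
  then show ?thesis
    unfolding draw_def by (rule measurable_compose) simp
qed

lemma prob_cylinder:
  assumes "finite J"
  shows "measure coins {\<omega>. \<forall>j\<in>J. \<omega> j = v j} = (1 / 2) ^ card J"
proof -
  interpret product_prob_space "\<lambda>_ :: nat. measure_pmf (bernoulli_pmf (1 / 2))" UNIV
    by unfold_locales
  have "{\<omega>. \<forall>j\<in>J. \<omega> j = v j} =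
      prod_emb UNIV (\<lambda>_. measure_pmf (bernoulli_pmf (1 / 2))) J (Pi\<^sub>E J (\<lambda>j. {v j}))"
    by (auto simp: prod_emb_def PiE_def extensional_def restrict_def Pi_def)
  then have "measure coins {\<omega>. \<forall>j\<in>J. \<omega> j = v j} = 
      (\<Prod>j\<in>J. measure (measure_pmf (bernoulli_pmf (1 / 2))) {v j})"
    unfolding coins_def using assms by (simp add: measure_PiM_emb)
  also have "\<dots> = (\<Prod>j\<in>J. 1 / 2)"
    by (intro prod.cong) (auto simp: measure_pmf_single pmf_bernoulli_half)
  finally show ?thesis by simp
qed

abbreviation draws :: "nat \<Rightarrow> oracle_bits \<Rightarrow> (nat \<times> nat) list \<Rightarrow> nat list" where
  "draws m \<omega> ks \<equiv> map (\<lambda>(r, t). draw m \<omega> r t) ks"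

lemma measurable_draws [measurable]: "(\<lambda>\<omega>. draws m \<omega> ks) \<in> coins \<rightarrow>\<^sub>M count_space UNIV"
proof (induction ks)
  case (Cons k ks)
  have "(\<lambda>p. fst p # snd p) \<circ> (\<lambda>\<omega>. (draw m \<omega> (fst k) (snd k), draws m \<omega> ks))
     \<in> coins \<rightarrow>\<^sub>M count_space UNIV"
  proof (rule measurable_comp)
    show "(\<lambda>\<omega>. (draw m \<omega> (fst k) (snd k), draws m \<omega> ks))
      \<in> coins \<rightarrow>\<^sub>M count_space UNIV \<Otimes>\<^sub>M count_space UNIV"
      using Cons by measurable
  qed (simp add: pair_measure_countable)
  then show ?case by (simp add: comp_def case_prod_unfold)
qed simp

lemma prob_draws_eq:
  assumes "distinct ks" "length vs = length ks" "set vs \<subseteq> {..<2 ^ m}"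
  shows "measure coins {\<omega>. draws m \<omega> ks = vs} = 1 / (2 ^ m) ^ length ks"
proof -
  define J where "J = (\<lambda>(k, i). coin_index k i) ` (set ks \<times> {..<m})"
  \<comment> \<open>Recovers the key and the bit position from the index of a coin, and with them
    the bit that this coin has to show.\<close>
  define v where "v j = (let (k, i) = prod_decode j
      in bit (the (map_of (zip ks vs) (prod_decode k))) i)" for j
  have inj: "inj_on (\<lambda>(k, i). coin_index k i) (set ks \<times> {..<m})"
    by (auto simp: inj_on_def coin_index_eq_iff)
  have v: "v (coin_index (ks ! j) i) = bit (vs ! j) i" if "j < length ks" for j i
    using that assms by (simp add: v_def coin_index_def map_of_zip_nth)
  have "draws m \<omega> ks = vs \<longleftrightarrow> (\<forall>j\<in>J. \<omega> j = v j)" for \<omega>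
  proof -
    have "draws m \<omega> ks = vs \<longleftrightarrow> (\<forall>j<length ks. (case ks ! j of (r, t) \<Rightarrow> draw m \<omega> r t) = vs ! j)"
      using assms(2) by (auto simp: list_eq_iff_nth_eq)
    also have "\<dots> \<longleftrightarrow> (\<forall>j<length ks. \<forall>i<m. \<omega> (coin_index (ks ! j) i) = bit (vs ! j) i)"
    proof (intro all_cong1 imp_cong refl)
      fix j assume "j < length ks"
      then have "vs ! j < 2 ^ m" using assms by (metis lessThan_iff nth_mem subsetD)
      then show "((case ks ! j of (r, t) \<Rightarrow> draw m \<omega> r t) = vs ! j) \<longleftrightarrow>
          (\<forall>i<m. \<omega> (coin_index (ks ! j) i) = bit (vs ! j) i)"
        by (cases "ks ! j") (simp add: draw_eq_iff)
    qed
    also have "\<dots> \<longleftrightarrow> (\<forall>j<length ks. \<forall>i<m. \<omega> (coin_index (ks ! j) i) = v (coin_index (ks ! j) i))"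
      by (simp add: v)
    also have "\<dots> \<longleftrightarrow> (\<forall>j\<in>J. \<omega> j = v j)"
      by (simp add: J_def all_set_conv_all_nth) (simp add: Ball_def)
    finally show ?thesis .
  qed
  then have "measure coins {\<omega>. draws m \<omega> ks = vs} = (1 / 2) ^ card J"
    using prob_cylinder[of J v] by (simp add: J_def)
  also have "card J = m * length ks"
    unfolding J_def by (subst card_image[OF inj]) (simp add: assms distinct_card mult.commute)
  finally show ?thesis by (simp add: power_mult power_divide)
qed

lemma prob_draws:
  assumes "distinct ks"
  shows "measure coins {\<omega>. G (draws m \<omega> ks)} = avg (2 ^ m) (length ks) (\<lambda>vs. of_bool (G vs))"
proof -
  interpret prob_space coins by (rule prob_space_coins)
  let ?L = "{vs :: nat list. set vs \<subseteq> {..<2 ^ m} \<and> length vs = length ks}"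
  have fin: "finite ?L" by (rule finite_lists_length_eq) simp
  have "{\<omega>. G (draws m \<omega> ks)} = (\<Union>vs\<in>{vs\<in>?L. G vs}. {\<omega>. draws m \<omega> ks = vs})"
    by (auto simp: draw_less)
  also have "measure coins \<dots> = (\<Sum>vs\<in>{vs\<in>?L. G vs}. measure coins {\<omega>. draws m \<omega> ks = vs})"
  proof (rule finite_measure_finite_Union)
    show "(\<lambda>vs. {\<omega>. draws m \<omega> ks = vs}) ` {vs\<in>?L. G vs} \<subseteq> events"
    proof safe
      fix vs
      have "(\<lambda>\<omega>. draws m \<omega> ks) -` {vs} \<inter> space coins \<in> events"
        by (rule measurable_sets[OF measurable_draws]) simp
      then show "{\<omega>. draws m \<omega> ks = vs} \<in> events" by (simp add: vimage_def)
    qed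
    show "finite {vs \<in> ?L. G vs}" using fin by (rule rev_finite_subset) auto
  qed (auto simp: disjoint_family_on_def)
  also have "\<dots> = (\<Sum>vs\<in>{vs\<in>?L. G vs}. 1 / (2 ^ m) ^ length ks)"
    by (intro sum.cong refl prob_draws_eq assms) auto
  also have "\<dots> = (\<Sum>vs\<in>?L. of_bool (G vs)) / (2 ^ m) ^ length ks"
    using fin by (simp add: of_bool_def sum.If_cases Int_def)
  finally show ?thesis by (simp add: avg_altdef)
qed

text \<open>Conditioning in elementary form: freeze the draws with keys in \<open>A\<close>, bound
  the probability over the independent draws \<open>ks\<close> for each frozen table, and average.
  All later uses of independence, for the pools and for playing, go through this lemma.\<close>

lemma prob_conditional_draws_le:
  assumes dist: "distinct ks" and fin: "finite A" and disj: "A \<inter> set ks = {}"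
    and dep: "\<And>x y vs. (\<And>r t. (r, t) \<in> A \<Longrightarrow> x r t = y r t) \<Longrightarrow> G x vs = G y vs"
    and bound: "\<And>x. avg (2 ^ m) (length ks) (\<lambda>vs. of_bool (G x vs)) \<le> \<epsilon>"
  shows "{\<omega>. G (draw m \<omega>) (draws m \<omega> ks)} \<in> sets coins"
    and "measure coins {\<omega>. G (draw m \<omega>) (draws m \<omega> ks)} \<le> \<epsilon>"
proof -
  obtain js where js: "set js = A" "distinct js"
    using finite_distinct_list[OF fin] by auto
  \<comment> \<open>Turns a list of values back into a table. The table is correct only on the keys
    in \<open>A\<close>, and by \<open>dep\<close> the event sees no other entries of it.\<close>
  define rebuild where "rebuild us r t = the (map_of (zip js us) (r, t))" for us :: "nat list" and r t
  have rebuild: "rebuild (draws m \<omega> js) r t = draw m \<omega> r t" if "(r, t) \<in> A" for \<omega> r t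
  proof -
    have "map_of (zip js (draws m \<omega> js)) (r, t) = Some (draw m \<omega> r t)"
      using that js by (simp add: map_of_zip_map)
    then show ?thesis by (simp add: rebuild_def)
  qed
  define G' where "G' vs = G (rebuild (take (length js) vs)) (drop (length js) vs)" for vs
  have eq: "G (draw m \<omega>) (draws m \<omega> ks) = G' (draws m \<omega> (js @ ks))" for \<omega>
    unfolding G'_def by (simp add: rebuild dep[of "draw m \<omega>" "rebuild (draws m \<omega> js)"])
  have "{\<omega>. G' (draws m \<omega> (js @ ks))} = (\<lambda>\<omega>. draws m \<omega> (js @ ks)) -` {vs. G' vs} \<inter> space coins"
    by auto
  also have "\<dots> \<in> sets coins"
    by (rule measurable_sets[OF measurable_draws]) simp
  finally show "{\<omega>. G (draw m \<omega>) (draws m \<omega> ks)} \<in> sets coins"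
    unfolding eq .
  have "measure coins {\<omega>. G' (draws m \<omega> (js @ ks))} = 
      avg (2 ^ m) (length js + length ks) (\<lambda>vs. of_bool (G' vs))"
    using prob_draws[of "js @ ks" G' m] js dist disj by auto
  also have "\<dots> = avg (2 ^ m) (length js) (\<lambda>us. avg (2 ^ m) (length ks) (\<lambda>vs. of_bool (G (rebuild us) vs)))"
    unfolding avg_append by (intro avg_cong) (simp add: G'_def)
  also have "\<dots> \<le> avg (2 ^ m) (length js) (\<lambda>us. \<epsilon>)"
    by (intro avg_mono bound)
  also have "\<dots> = \<epsilon>"
    by (rule avg_const) simp
  finally show "measure coins {\<omega>. G (draw m \<omega>) (draws m \<omega> ks)} \<le> \<epsilon>"
    unfolding eq .
qed

section \<open>Hedge\<close>

lemma exp_le_one_plus: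
  fixes y :: real
  assumes "\<bar>y\<bar> \<le> \<eta>" "\<eta> \<le> 1 / 2"
  shows "exp (y - 2 * \<eta>\<^sup>2) \<le> 1 + y"
proof -
  have "y\<^sup>2 \<le> \<eta>\<^sup>2" using assms by (simp add: abs_le_square_iff[symmetric])
  moreover have "\<bar>ln (1 + y) - y\<bar> \<le> 2 * y\<^sup>2"
    using assms by (intro abs_ln_one_plus_x_minus_x_bound) auto
  ultimately have "y - 2 * \<eta>\<^sup>2 \<le> ln (1 + y)" by linarith
  then have "exp (y - 2 * \<eta>\<^sup>2) \<le> exp (ln (1 + y))" by simp
  also have "\<dots> = 1 + y" using assms by simp
  finally show ?thesis .
qed

text \<open>Potential argument with weights normalised by the algorithm's own loss: the terms linear
  in \<eta> cancel or are negative by \<open>mix\<close>, so the sum of the weights never exceeds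
  its initial value \<open>card I\<close>. Since \<open>mix\<close> is an inequality, the
  algorithm's loss may be rounded down.\<close>

lemma hedge_regret:
  fixes f :: "'i \<Rightarrow> nat \<Rightarrow> real" and A :: "nat \<Rightarrow> real"
  assumes fin: "finite I" and j: "j \<in> I" and \<eta>: "0 < \<eta>" "\<eta> \<le> 1 / 2"
    and f: "\<And>i d. i \<in> I \<Longrightarrow> d < B \<Longrightarrow> f i d \<in> {0..1}" and A: "\<And>d. d < B \<Longrightarrow> A d \<in> {0..1}"
    and mix: "\<And>d. d < B \<Longrightarrow> A d * (\<Sum>i\<in>I. exp (- \<eta> * (\<Sum>d'<d. f i d')))
      \<le> (\<Sum>i\<in>I. exp (- \<eta> * (\<Sum>d'<d. f i d')) * f i d)"
  shows "(\<Sum>d<B. A d) \<le> (\<Sum>d<B. f j d) + ln (card I) / \<eta> + 2 * \<eta> * B"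
proof -
  \<comment> \<open>The deduction of \<open>2 * \<eta>\<^sup>2\<close> per day absorbs the
    second-order error of \<open>exp_le_one_plus\<close>.\<close>
  define u where "u i d = exp (\<eta> * ((\<Sum>d'<d. A d') - (\<Sum>d'<d. f i d')) - 2 * \<eta>\<^sup>2 * d)" for i d
  have "(\<Sum>i\<in>I. u i d) \<le> card I" if "d \<le> B" for d
    using that
  proof (induction d)
    case 0
    then show ?case by (simp add: u_def)
  next
    case (Suc d)
    have "u i (Suc d) \<le> u i d * (1 + \<eta> * (A d - f i d))" if "i \<in> I" for i
    proof -
      have "u i (Suc d) = u i d * exp (\<eta> * (A d - f i d) - 2 * \<eta>\<^sup>2)"
        by (simp add: u_def exp_add[symmetric] algebra_simps)
      moreover have "\<bar>A d - f i d\<bar> \<le> 1"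
        using f[OF that, of d] A[of d] Suc by auto
      then have "\<bar>\<eta> * (A d - f i d)\<bar> \<le> \<eta>"
        using \<eta> by (simp add: abs_mult mult_left_le)
      ultimately show ?thesis
        using exp_le_one_plus[OF _ \<eta>(2)] by (simp add: u_def)
    qed
    then have "(\<Sum>i\<in>I. u i (Suc d)) \<le> (\<Sum>i\<in>I. u i d * (1 + \<eta> * (A d - f i d)))"
      by (rule sum_mono)
    also have "\<dots> = (\<Sum>i\<in>I. u i d) + \<eta> * (\<Sum>i\<in>I. u i d * (A d - f i d))"
      by (simp add: distrib_left sum.distrib sum_distrib_left mult.left_commute)
    also have "(\<Sum>i\<in>I. u i d * (A d - f i d)) = exp (\<eta> * (\<Sum>d'<d. A d') - 2 * \<eta>\<^sup>2 * d) *
        (A d * (\<Sum>i\<in>I. exp (- \<eta> * (\<Sum>d'<d. f i d'))) - (\<Sum>i\<in>I. exp (- \<eta> * (\<Sum>d'<d. f i d')) * f i d))"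
    proof -
      have "u i d = exp (\<eta> * (\<Sum>d'<d. A d') - 2 * \<eta>\<^sup>2 * d) * exp (- \<eta> * (\<Sum>d'<d. f i d'))" for i
        by (simp add: u_def exp_add[symmetric] algebra_simps)
      moreover have "(\<Sum>i\<in>I. (E * w i) * (A d - f i d)) = E * (A d * sum w I - (\<Sum>i\<in>I. w i * f i d))"
        for E and w :: "'i \<Rightarrow> real"
        by (simp add: sum_distrib_left sum_subtractf algebra_simps)
      ultimately show ?thesis by simp
    qed
    also have "\<dots> \<le> 0"
      using mix[of d] Suc by (intro mult_nonneg_nonpos) auto
    finally show ?case
      using Suc \<eta> by (simp add: mult_nonneg_nonpos)
  qed
  from this[of B] have "u j B \<le> card I"
    using member_le_sum[OF j, of "\<lambda>i. u i B"] fin by (auto simp: u_def)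
  then have "ln (u j B) \<le> ln (card I)"
    by (intro ln_mono) (simp_all add: u_def)
  then have "\<eta> * ((\<Sum>d<B. A d) - (\<Sum>d<B. f j d)) \<le> ln (card I) + 2 * \<eta>\<^sup>2 * B"
    by (simp add: u_def)
  also have "\<dots> = \<eta> * (ln (card I) / \<eta> + 2 * \<eta> * B)"
    using \<eta> by (simp add: field_simps power2_eq_square)
  finally show ?thesis
    using \<eta> by (simp only: mult_le_cancel_left_pos)
qed

section \<open>A single level of the algorithm\<close>

text \<open>An entry \<open>(e, s, z, g)\<close> consists of an expert \<open>e\<close>, the epoch \<open>s\<close> in which it was drawn, its
  loss \<open>z\<close> so far in the current epoch, and its total gain \<open>g\<close> over the older part of the pool in the
  epochs since \<open>s\<close>. Pools are sorted by age, oldest entry first.\<close>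

type_synonym entry = "nat \<times> nat \<times> nat \<times> nat"
type_synonym level = "nat \<times> entry list"

text \<open>The comparison value that remains after the whole list. It is the start value for
  whatever stands behind the list, see \<open>sweep_append\<close>.\<close>

fun sweep_end :: "nat \<Rightarrow> nat \<Rightarrow> entry list \<Rightarrow> nat" where
  "sweep_end f b [] = b"
| "sweep_end f b ((e, s, z, g) # P) = sweep_end f (min b (max z f)) P"

text \<open>\<open>b\<close> is the smallest epoch loss among the subroutine and the older entries. Losses are clipped
  from below at \<open>f\<close>, so that the total gain of a pool in one epoch is bounded deterministically.
  The comparison is only with older entries, so the fate of an entry is not affected by later draws.\<close>

fun sweep :: "nat \<Rightarrow> nat \<Rightarrow> nat \<Rightarrow> nat \<Rightarrow> nat \<Rightarrow> entry list \<Rightarrow> entry list" where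
  "sweep G V \<tau> f b [] = []"
| "sweep G V \<tau> f b ((e, s, z, g) # P) =
     (let v = min b (max z f); g' = g + (b - v)
      in (if 3 * G * g' \<le> V * (Suc \<tau> - s) then [] else [(e, s, 0, g')]) @ sweep G V \<tau> f v P)"

text \<open>The formal content of comparing only with older entries: a prefix of the pool is swept
  as if nothing stood behind it.\<close>

lemma sweep_append:
  "sweep G V \<tau> f b (P @ P') = sweep G V \<tau> f b P @ sweep G V \<tau> f (sweep_end f b P) P'"
  by (induction G V \<tau> f b P rule: sweep.induct) (simp_all add: Let_def)

lemma sweep_end_ge:
  fixes x :: real
  assumes "x \<le> real b" "\<And>e s z g. (e, s, z, g) \<in> set P \<Longrightarrow> x \<le> real z"
  shows "x \<le> sweep_end f b P"
  using assms
proof (induction f b P rule: sweep_end.induct)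
  case (2 f b e s z g P)
  have "x \<le> real z" using 2(3) by auto
  then have "x \<le> real (min b (max z f))" using 2(2) by (simp add: min_def max_def)
  moreover have "x \<le> real z'" if "(e', s', z', g') \<in> set P" for e' s' z' g' using 2(3) that by auto
  ultimately show ?case using 2(1) by simp
qed auto

lemma sweep_mem:
  assumes "(e, s, z, g) \<in> set (sweep G V \<tau> f b P)"
  shows "z = 0" "V * (Suc \<tau> - s) < 3 * G * g" "\<exists>z' g'. (e, s, z', g') \<in> set P \<and> g \<le> g' + b"
proof -
  have "z = 0 \<and> V * (Suc \<tau> - s) < 3 * G * g \<and> (\<exists>z' g'. (e, s, z', g') \<in> set P \<and> g \<le> g' + b)"
    using assms
  proof (induction G V \<tau> f b P rule: sweep.induct)
    case (2 G V \<tau> f b e' s' z' g' P)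
    define v where "v = min b (max z' f)"
    have "v \<le> b" by (simp add: v_def)
    show ?case
    proof (cases "(e, s, z, g) \<in> set (sweep G V \<tau> f v P)")
      case True
      from 2(1)[OF v_def refl True] \<open>v \<le> b\<close> show ?thesis
        by (metis add_le_mono1 add.commute list.set_intros(2) order_trans)
    next
      case False
      then have "(e, s, z, g) = (e', s', 0, g' + (b - v))" "\<not> 3 * G * (g' + (b - v)) \<le> V * (Suc \<tau> - s')"
        using 2(2) by (auto simp: Let_def v_def split: if_splits)
      moreover have "g' + (b - v) \<le> g' + b" by simp
      ultimately show ?thesis by (metis (no_types, lifting) Pair_inject list.set_intros(1) not_le_imp_less)
    qed
  qed simp
  then show "z = 0" "V * (Suc \<tau> - s) < 3 * G * g" "\<exists>z' g'. (e, s, z', g') \<in> set P \<and> g \<le> g' + b"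
    by auto
qed

text \<open>The gains of one sweep telescope from \<open>b\<close> down to at least
  \<open>f\<close>, because the minimum is handed on even past an evicted entry, which did take part
  in the epoch. As \<open>h\<close> is monotone and no entry starts after \<tau>, all gains of epoch
  \<tau> can be charged at the rate \<open>h \<tau>\<close>.\<close>

lemma sum_list_sweep_le:
  fixes h :: "nat \<Rightarrow> real"
  assumes "f \<le> b" "mono h" "\<And>s. 0 \<le> h s" "\<And>e s z g. (e, s, z, g) \<in> set P \<Longrightarrow> s \<le> \<tau>"
  shows "(\<Sum>(e, s, z, g)\<leftarrow>sweep G V \<tau> f b P. real g * h s) \<le> (\<Sum>(e, s, z, g)\<leftarrow>P. real g * h s) + h \<tau> * (b - f)"
  using assms
proof (induction G V \<tau> f b P rule: sweep.induct)
  case (1 G V \<tau> f b)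
  then show ?case by simp
next
  case (2 G V \<tau> f b e s z g P)
  define v where "v = min b (max z f)"
  have v: "v \<le> b" "f \<le> v" using 2(2) by (auto simp: v_def)
  have IH: "(\<Sum>(e, s, z, g)\<leftarrow>sweep G V \<tau> f v P. real g * h s) \<le> (\<Sum>(e, s, z, g)\<leftarrow>P. real g * h s) + h \<tau> * (v - f)"
    using 2(1)[OF v_def refl v(2) 2(3,4)] 2(5) by auto
  have "s \<le> \<tau>" using 2(5)[of e s z g] by simp
  then have "h s \<le> h \<tau>" using 2(3) by (rule monoD[rotated])
  then have "real (b - v) * h s \<le> real (b - v) * h \<tau>"
    by (intro mult_left_mono) auto
  moreover have "real (b - v) * h \<tau> + h \<tau> * real (v - f) = h \<tau> * real (b - f)"
    using v by (simp add: of_nat_diff algebra_simps)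
  moreover have "0 \<le> real (g + (b - v)) * h s" using 2(4) by simp
  ultimately have "(if 3 * G * (g + (b - v)) \<le> V * (Suc \<tau> - s) then 0 else real (g + (b - v)) * h s) +
      h \<tau> * real (v - f) \<le> real g * h s + h \<tau> * real (b - f)"
    by (simp add: algebra_simps)
  with IH show ?case by (auto simp: Let_def v_def[symmetric])
qed

definition add_losses :: "(nat \<Rightarrow> nat) \<Rightarrow> entry list \<Rightarrow> entry list" where
  "add_losses l P = map (\<lambda>(e, s, z, g). (e, s, z + l e, g)) P"

definition hedge_mix :: "real \<Rightarrow> nat \<Rightarrow> (nat \<times> nat) list \<Rightarrow> real" where
  "hedge_mix \<eta> S ps =
     (\<Sum>(z, y)\<leftarrow>ps. exp (- \<eta> * (real z / real S)) * real y) / (\<Sum>(z, y)\<leftarrow>ps. exp (- \<eta> * (real z / real S)))"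

text \<open>\<open>a\<close> is the loss of the subroutine, i.e. of the next lower level, on the current day.\<close>

definition level_out :: "real \<Rightarrow> nat \<Rightarrow> (nat \<Rightarrow> nat) \<Rightarrow> nat \<Rightarrow> level \<Rightarrow> nat" where
  "level_out \<eta> S l a = (\<lambda>(c, P). nat \<lfloor>hedge_mix \<eta> S ((c, a) # map (\<lambda>(e, s, z, g). (z, l e)) P)\<rfloor>)"

text \<open>Day \<open>t\<close> is the day just played, so \<open>t div B\<close> is the epoch
  being closed and \<open>Suc t div B\<close> the start recorded for the new draw. Resetting the
  losses restarts Hedge; emptying the pool after \<open>K\<close> epochs keeps the harmonic sum at
  \<open>harm K\<close>.\<close>

definition level_step ::
  "nat \<Rightarrow> nat \<Rightarrow> nat \<Rightarrow> nat \<Rightarrow> nat \<Rightarrow> nat \<Rightarrow> (nat \<Rightarrow> nat) \<Rightarrow> nat \<Rightarrow> nat \<Rightarrow> level \<Rightarrow> level" where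
  "level_step n G V B K t l a x = (\<lambda>(c, P).
     if Suc t mod B = 0
     then (0, (if Suc t mod (B * K) = 0 then []
               else sweep G V (t div B) (c + a - V) (c + a) (add_losses l P)) @ [(x mod n, Suc t div B, 0, 0)])
     else (c + a, add_losses l P))"

lemma hedge_mix_bounds:
  assumes "ps \<noteq> []" "\<And>z y. (z, y) \<in> set ps \<Longrightarrow> y \<le> S"
  shows "0 \<le> hedge_mix \<eta> S' ps" "hedge_mix \<eta> S' ps \<le> S"
    and "0 < (\<Sum>(z, y)\<leftarrow>ps. exp (- \<eta> * (real z / real S')))"
proof -
  have nonneg: "0 \<le> (\<Sum>(z, y)\<leftarrow>qs. exp (- \<eta> * (real z / real S')))" for qs :: "(nat \<times> nat) list"
    by (intro sum_list_nonneg) auto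
  show pos: "0 < (\<Sum>(z, y)\<leftarrow>ps. exp (- \<eta> * (real z / real S')))"
    using assms(1) nonneg[of "tl ps"] by (cases ps) (auto simp: add_pos_nonneg)
  have "0 \<le> (\<Sum>(z, y)\<leftarrow>ps. exp (- \<eta> * (real z / real S')) * real y)"
    by (intro sum_list_nonneg) auto
  then show "0 \<le> hedge_mix \<eta> S' ps"
    unfolding hedge_mix_def using pos by (intro divide_nonneg_pos)
  have "(\<Sum>(z, y)\<leftarrow>ps. exp (- \<eta> * (real z / real S')) * real y) \<le> (\<Sum>(z, y)\<leftarrow>ps. S * exp (- \<eta> * (real z / real S')))"
    using assms(2) by (intro sum_list_mono) (auto simp: mult.commute)
  also have "\<dots> = S * (\<Sum>(z, y)\<leftarrow>ps. exp (- \<eta> * (real z / real S')))"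
    by (simp add: sum_list_const_mult case_prod_unfold)
  finally show "hedge_mix \<eta> S' ps \<le> S"
    unfolding hedge_mix_def using pos by (simp add: divide_le_eq)
qed

lemma level_out_le:
  assumes "a \<le> S" "\<And>e s z g. (e, s, z, g) \<in> set P \<Longrightarrow> l e \<le> S"
  shows "level_out \<eta> S' l a (c, P) \<le> S"
proof -
  have "hedge_mix \<eta> S' ((c, a) # map (\<lambda>(e, s, z, g). (z, l e)) P) \<le> S"
    using assms by (intro hedge_mix_bounds(2)) auto
  then show ?thesis
    unfolding level_out_def by (simp add: floor_le_iff) linarith
qed

lemma harm_le_ln: "0 < n \<Longrightarrow> harm n \<le> 1 + ln (real n)"
proof -
  assume "0 < n"
  then obtain k where n: "n = Suc k" by (cases n) auto
  have "harm (Suc k) - ln (real (Suc k)) \<le> harm (Suc 0) - ln (real (Suc 0))"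
    using decseq_harm_diff_ln unfolding decseq_def by blast
  then show ?thesis by (simp add: n harm_expand)
qed

section \<open>One level over an arbitrary subroutine\<close>

text \<open>Here \<open>M\<close> bounds the pool, and Hedge has \<open>M + 1\<close> actions
  because the subroutine is one of them. The last assumption makes Hedge's regret in an epoch equal
  to the eviction rate \<open>V / (3 G)\<close> at most.\<close>

locale pool_level =
  fixes n S G V B K M :: nat and \<eta> :: real and a :: "nat \<Rightarrow> nat" and l :: "nat \<Rightarrow> nat \<Rightarrow> nat"
  assumes n: "0 < n" and S: "0 < S" and G: "0 < G" and V: "0 < V" and B: "0 < B" and K: "0 < K"
    and \<eta>: "0 < \<eta>" "\<eta> \<le> 1 / 2"
    and a_le: "\<And>t. a t \<le> S" and l_le: "\<And>t e. l t e \<le> S"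
    and M: "3 * G * harm K + 1 \<le> real M"
    and hedge: "S * (ln (M + 1) / \<eta> + 2 * \<eta> * B) \<le> V / (3 * G)"
begin

definition cum :: "nat \<Rightarrow> nat \<Rightarrow> nat" where
  "cum \<tau> d = (\<Sum>d'<d. a (\<tau> * B + d'))"

definition lcum :: "nat \<Rightarrow> nat \<Rightarrow> nat \<Rightarrow> nat" where
  "lcum \<tau> d e = (\<Sum>d'<d. l (\<tau> * B + d') e)"

definition at_day :: "nat \<Rightarrow> nat \<Rightarrow> entry list \<Rightarrow> entry list" where
  "at_day \<tau> d P = map (\<lambda>(e, s, z, g). (e, s, lcum \<tau> d e, g)) P"

definition epoch_out :: "nat \<Rightarrow> entry list \<Rightarrow> nat" where
  "epoch_out \<tau> P = (\<Sum>d<B. level_out \<eta> S (l (\<tau> * B + d)) (a (\<tau> * B + d)) (cum \<tau> d, at_day \<tau> d P))"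

definition epoch_step :: "nat \<Rightarrow> entry list \<Rightarrow> entry list" where
  "epoch_step \<tau> P = sweep G V \<tau> (cum \<tau> B - V) (cum \<tau> B) (at_day \<tau> B P)"

definition fresh :: "nat \<Rightarrow> nat \<Rightarrow> entry" where
  "fresh \<tau> x = (x mod n, \<tau>, 0, 0)"

text \<open>Hedge on one epoch, in units of \<open>S\<close>. Entries evicted at the end of the
  epoch are covered as well, since they were in the pool on all its days.\<close>

lemma epoch_out_le:
  assumes P: "length P \<le> M"
  shows "epoch_out \<tau> P \<le> cum \<tau> B + V / (3 * G)"
    and "(e, s, z, g) \<in> set P \<Longrightarrow> epoch_out \<tau> P \<le> lcum \<tau> B e + V / (3 * G)"
proof -
  \<comment> \<open>Action 0 is the subroutine; action \<open>i > 0\<close> is the pool entry at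
    position \<open>i - 1\<close>.\<close>
  define f where "f i d = (if i = 0 then a (\<tau> * B + d) else l (\<tau> * B + d) (fst (P ! (i - 1)))) / real S" for i d
  define A where "A d = level_out \<eta> S (l (\<tau> * B + d)) (a (\<tau> * B + d)) (cum \<tau> d, at_day \<tau> d P) / real S" for d
  have f_sum: "(\<Sum>d'<d. f i d') = (if i = 0 then cum \<tau> d else lcum \<tau> d (fst (P ! (i - 1)))) / real S" for i d
    by (simp add: f_def cum_def lcum_def sum_divide_distrib)
  have f01: "f i d \<in> {0..1}" for i d
    using a_le l_le S by (simp add: f_def)
  have A01: "A d \<in> {0..1}" for d
    using level_out_le[of "a (\<tau> * B + d)" S "at_day \<tau> d P" "l (\<tau> * B + d)"] a_le l_le S
    by (auto simp: A_def)
  \<comment> \<open>Only an inequality, since the output of a level is the Hedge mixture rounded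
    down to an integer.\<close>
  have mix: "A d * (\<Sum>i\<in>{..length P}. exp (- \<eta> * (\<Sum>d'<d. f i d')))
      \<le> (\<Sum>i\<in>{..length P}. exp (- \<eta> * (\<Sum>d'<d. f i d')) * f i d)" for d
  proof -
    define ps where "ps = (cum \<tau> d, a (\<tau> * B + d)) #
      map (\<lambda>(e, s, z, g). (z, l (\<tau> * B + d) e)) (at_day \<tau> d P)"
    have len: "length ps = Suc (length P)" by (simp add: ps_def at_day_def)
    have nth: "ps ! i = ((if i = 0 then cum \<tau> d else lcum \<tau> d (fst (P ! (i - 1)))), 
        (if i = 0 then a (\<tau> * B + d) else l (\<tau> * B + d) (fst (P ! (i - 1)))))" if "i < length ps" for i
      using that len by (cases i) (auto simp: ps_def at_day_def case_prod_unfold)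
    have den: "(\<Sum>(z, y)\<leftarrow>ps. exp (- \<eta> * (real z / real S))) = (\<Sum>i\<in>{..length P}. exp (- \<eta> * (\<Sum>d'<d. f i d')))"
      unfolding f_sum by (subst sum_list_sum_nth)
        (rule sum.cong, use len in auto, simp_all add: nth)
    have num: "(\<Sum>(z, y)\<leftarrow>ps. exp (- \<eta> * (real z / real S)) * real y) =
        S * (\<Sum>i\<in>{..length P}. exp (- \<eta> * (\<Sum>d'<d. f i d')) * f i d)"
      unfolding f_sum sum_distrib_left using S by (subst sum_list_sum_nth)
        (rule sum.cong, use len in auto, simp_all add: nth f_def)
    have bounds: "0 \<le> hedge_mix \<eta> S ps" "0 < (\<Sum>(z, y)\<leftarrow>ps. exp (- \<eta> * (real z / real S)))"
    proof -
      have "ps \<noteq> []" "y \<le> S" if "(z, y) \<in> set ps" for z y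
        using that a_le l_le by (auto simp: ps_def)
      moreover have "ps \<noteq> []" by (simp add: ps_def)
      ultimately show "0 \<le> hedge_mix \<eta> S ps" "0 < (\<Sum>(z, y)\<leftarrow>ps. exp (- \<eta> * (real z / real S)))"
        using hedge_mix_bounds[of ps S] by blast+
    qed
    have "S * A d \<le> hedge_mix \<eta> S ps"
      unfolding A_def level_out_def using S bounds(1) by (simp add: ps_def)
    then have "S * A d * (\<Sum>(z, y)\<leftarrow>ps. exp (- \<eta> * (real z / real S))) \<le>
        (\<Sum>(z, y)\<leftarrow>ps. exp (- \<eta> * (real z / real S)) * real y)"
      using bounds(2) by (simp add: hedge_mix_def le_divide_eq)
    then show ?thesis
      unfolding den num using S by (simp add: mult.assoc)
  qed
  have regret: "epoch_out \<tau> P \<le> S * (\<Sum>d<B. f j d) + V / (3 * G)" if "j \<le> length P" for j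
  proof -
    have "(\<Sum>d<B. A d) \<le> (\<Sum>d<B. f j d) + ln (real (card {..length P})) / \<eta> + 2 * \<eta> * B"
      using that by (intro hedge_regret \<eta> f01 A01 mix) auto
    also have "\<dots> \<le> (\<Sum>d<B. f j d) + (ln (M + 1) / \<eta> + 2 * \<eta> * B)"
      using P \<eta> by (simp add: divide_right_mono)
    finally have "S * (\<Sum>d<B. A d) \<le> S * ((\<Sum>d<B. f j d) + (ln (M + 1) / \<eta> + 2 * \<eta> * B))"
      by (intro mult_left_mono) auto
    moreover have "S * (\<Sum>d<B. A d) = epoch_out \<tau> P"
      unfolding A_def epoch_out_def using S by (simp add: sum_distrib_left)
    ultimately show ?thesis using hedge by (simp add: distrib_left)
  qed
  show "epoch_out \<tau> P \<le> cum \<tau> B + V / (3 * G)"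
    using regret[of 0] S by (simp add: f_sum)
  assume "(e, s, z, g) \<in> set P"
  then obtain i where "i < length P" "P ! i = (e, s, z, g)" by (auto simp: in_set_conv_nth)
  then show "epoch_out \<tau> P \<le> lcum \<tau> B e + V / (3 * G)"
    using regret[of "Suc i"] S by (simp add: f_sum)
qed

text \<open>The last condition says that the gains are covered by a budget of \<open>V\<close> per epoch, where an
  entry draws only on the budgets of the epochs since its own start.\<close>

definition pool_inv :: "nat \<Rightarrow> nat \<Rightarrow> entry list \<Rightarrow> bool" where
  "pool_inv \<tau>\<^sub>0 \<tau> P \<longleftrightarrow>
     (\<forall>(e, s, z, g)\<in>set P. s < \<tau> \<and> V * (\<tau> - s) < 3 * G * g) \<and>
     (\<forall>h :: nat \<Rightarrow> real. mono h \<longrightarrow> (\<forall>s. 0 \<le> h s) \<longrightarrow>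
        (\<Sum>(e, s, z, g)\<leftarrow>P. real g * h s) \<le> V * (\<Sum>\<sigma>\<in>{\<tau>\<^sub>0..<\<tau>}. h \<sigma>))"

lemma pool_inv_Nil: "pool_inv \<tau>\<^sub>0 \<tau>\<^sub>0 []"
  by (simp add: pool_inv_def)

text \<open>The fresh entry has gain 0 and leaves the weighted sum unchanged. The sweep then adds at
  most \<open>h \<tau> * V\<close>, because clipping leaves a range of at most \<open>V\<close> for
  the losses in an epoch.\<close>

lemma pool_inv_step:
  assumes inv: "pool_inv \<tau>\<^sub>0 \<tau> P" and le: "\<tau>\<^sub>0 \<le> \<tau>"
  shows "pool_inv \<tau>\<^sub>0 (Suc \<tau>) (epoch_step \<tau> (P @ [fresh \<tau> x]))"
proof -
  let ?Q = "P @ [fresh \<tau> x]"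
  have old: "s \<le> \<tau>" if "(e, s, z, g) \<in> set (at_day \<tau> B ?Q)" for e s z g
    using that inv by (fastforce simp: at_day_def pool_inv_def fresh_def)
  have "s < Suc \<tau> \<and> V * (Suc \<tau> - s) < 3 * G * g" if "(e, s, z, g) \<in> set (epoch_step \<tau> ?Q)" for e s z g
    using sweep_mem(2,3)[OF that[unfolded epoch_step_def]] old by (auto simp: less_Suc_eq_le)
  moreover have "(\<Sum>(e, s, z, g)\<leftarrow>epoch_step \<tau> ?Q. real g * h s) \<le> V * (\<Sum>\<sigma>\<in>{\<tau>\<^sub>0..<Suc \<tau>}. h \<sigma>)"
    if h: "mono h" "\<forall>s. 0 \<le> h s" for h :: "nat \<Rightarrow> real"
  proof -
    have "(\<Sum>(e, s, z, g)\<leftarrow>epoch_step \<tau> ?Q. real g * h s) \<le>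
        (\<Sum>(e, s, z, g)\<leftarrow>at_day \<tau> B ?Q. real g * h s) + h \<tau> * (cum \<tau> B - (cum \<tau> B - V))"
      unfolding epoch_step_def using h old by (intro sum_list_sweep_le) auto
    also have "(\<Sum>(e, s, z, g)\<leftarrow>at_day \<tau> B ?Q. real g * h s) = (\<Sum>(e, s, z, g)\<leftarrow>P. real g * h s)"
      by (simp add: at_day_def comp_def case_prod_unfold fresh_def)
    also have "\<dots> \<le> V * (\<Sum>\<sigma>\<in>{\<tau>\<^sub>0..<\<tau>}. h \<sigma>)"
      using inv h unfolding pool_inv_def by blast
    also have "h \<tau> * (cum \<tau> B - (cum \<tau> B - V)) \<le> h \<tau> * V"
      using h by (intro mult_left_mono) auto
    finally show ?thesis using le by (simp add: algebra_simps)
  qed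
  ultimately show ?thesis unfolding pool_inv_def by blast
qed

text \<open>An entry of age \<open>\<tau> - s\<close> has gained more than
  \<open>V * (\<tau> - s) / (3 * G)\<close>. Dividing by the age gives each entry a weight of at
  least \<open>V / (3 * G)\<close>, while the budget becomes \<open>V\<close> times a harmonic
  number. The additional 1 is room for the next draw.\<close>

lemma pool_inv_length:
  assumes inv: "pool_inv \<tau>\<^sub>0 \<tau> P" and \<tau>: "\<tau>\<^sub>0 \<le> \<tau>" "\<tau> \<le> \<tau>\<^sub>0 + K"
  shows "Suc (length P) \<le> M"
proof -
  \<comment> \<open>The inverse age. Beyond \<tau> it is continued by 1, which keeps it
    monotone.\<close>
  define h where "h \<sigma> = (if \<sigma> < \<tau> then 1 / real (\<tau> - \<sigma>) else 1)" for \<sigma>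
  have "mono h"
    by (auto simp: mono_def h_def frac_le)
  then have upper: "(\<Sum>(e, s, z, g)\<leftarrow>P. real g * h s) \<le> V * (\<Sum>\<sigma>\<in>{\<tau>\<^sub>0..<\<tau>}. h \<sigma>)"
    using inv unfolding pool_inv_def by (auto simp: h_def)
  have "(\<Sum>\<sigma>\<in>{\<tau>\<^sub>0..<\<tau>}. h \<sigma>) = (\<Sum>k\<in>{1..\<tau> - \<tau>\<^sub>0}. inverse (real k))"
    by (rule sum.reindex_bij_witness[of _ "\<lambda>k. \<tau> - k" "\<lambda>\<sigma>. \<tau> - \<sigma>"])
      (auto simp: h_def inverse_eq_divide)
  also have "\<dots> = harm (\<tau> - \<tau>\<^sub>0)" by (simp add: harm_def)
  also have "\<dots> \<le> harm K" using \<tau> by (intro harm_mono) auto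
  finally have upper': "(\<Sum>(e, s, z, g)\<leftarrow>P. real g * h s) \<le> V * harm K"
    using upper by (smt (verit) mult_left_mono of_nat_0_le_iff)
  have "(\<Sum>(e, s, z, g)\<leftarrow>P. real V / (3 * G)) \<le> (\<Sum>(e, s, z, g)\<leftarrow>P. real g * h s)"
  proof (rule sum_list_mono, clarify)
    fix e s z g assume "(e, s, z, g) \<in> set P"
    then have s: "s < \<tau>" "V * (\<tau> - s) < 3 * G * g" using inv unfolding pool_inv_def by auto
    then have "real V * real (\<tau> - s) \<le> 3 * G * g"
      by (metis less_imp_le of_nat_le_iff of_nat_mult of_nat_numeral)
    then show "real V / (3 * G) \<le> real g * h s"
      using s G by (simp add: h_def field_simps)
  qed
  also have "(\<Sum>(e, s, z, g)\<leftarrow>P. real V / (3 * G)) = real (length P) * (real V / (3 * G))"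
    by (simp add: case_prod_unfold sum_list_triv)
  finally have "real (length P) * (real V / (3 * G)) \<le> V * harm K" using upper' by simp
  then have "real (length P) \<le> 3 * G * harm K"
    using V G by (simp add: field_simps)
  then show ?thesis using M by linarith
qed

text \<open>Epochs \<open>\<tau>, \<tau> + 1, \<dots>\<close> with the draws \<open>xs\<close>; \<open>P\<close> is the pool before the draw of epoch \<open>\<tau>\<close> is added.\<close>

primrec pool_after :: "nat \<Rightarrow> entry list \<Rightarrow> nat list \<Rightarrow> entry list" where
  "pool_after \<tau> P [] = P"
| "pool_after \<tau> P (x # xs) = pool_after (Suc \<tau>) (epoch_step \<tau> (P @ [fresh \<tau> x])) xs"

primrec pool_regret :: "nat \<Rightarrow> nat \<Rightarrow> entry list \<Rightarrow> nat list \<Rightarrow> real" where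
  "pool_regret i \<tau> P [] = 0"
| "pool_regret i \<tau> P (x # xs) = real (epoch_out \<tau> (P @ [fresh \<tau> x])) - real (lcum \<tau> B i) +
     pool_regret i (Suc \<tau>) (epoch_step \<tau> (P @ [fresh \<tau> x])) xs"

lemma pool_after_append: "pool_after \<tau> P (xs @ ys) = pool_after (\<tau> + length xs) (pool_after \<tau> P xs) ys"
  by (induction xs arbitrary: \<tau> P) auto

lemma pool_regret_append:
  "pool_regret i \<tau> P (xs @ ys) = pool_regret i \<tau> P xs + pool_regret i (\<tau> + length xs) (pool_after \<tau> P xs) ys"
  by (induction xs arbitrary: \<tau> P) auto

lemma pool_inv_pool_after:
  assumes "pool_inv \<tau>\<^sub>0 \<tau> P" "\<tau>\<^sub>0 \<le> \<tau>"
  shows "pool_inv \<tau>\<^sub>0 (\<tau> + length xs) (pool_after \<tau> P xs)"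
  using assms
proof (induction xs arbitrary: \<tau> P)
  case (Cons x xs)
  show ?case
    using Cons.IH[OF pool_inv_step[OF Cons.prems]] Cons.prems by simp
qed simp

text \<open>The pool that results from \<open>P\<close> without new draws: it is the older part of the actual pool.\<close>

primrec older :: "nat \<Rightarrow> entry list \<Rightarrow> nat \<Rightarrow> entry list" where
  "older \<tau> P 0 = P"
| "older \<tau> P (Suc j) = epoch_step (\<tau> + j) (older \<tau> P j)"

text \<open>The value against which a copy drawn in epoch \<tau> is measured \<open>j\<close> epochs
  later. Later draws cannot influence it.\<close>

definition bench :: "nat \<Rightarrow> entry list \<Rightarrow> nat \<Rightarrow> nat" where
  "bench \<tau> P j = sweep_end (cum (\<tau> + j) B - V) (cum (\<tau> + j) B) (at_day (\<tau> + j) B (older \<tau> P j))"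

text \<open>The gain that a copy of \<open>i\<close> drawn in epoch \<open>\<tau>\<close> collects, if it is not evicted before.\<close>

definition virtual_gain :: "nat \<Rightarrow> nat \<Rightarrow> entry list \<Rightarrow> nat \<Rightarrow> nat" where
  "virtual_gain i \<tau> P j = (\<Sum>j'<j. bench \<tau> P j' - 
     min (bench \<tau> P j') (max (lcum (\<tau> + j') B i) (cum (\<tau> + j') B - V)))"

lemma at_day_append: "at_day \<tau> d (P @ P') = at_day \<tau> d P @ at_day \<tau> d P'"
  by (simp add: at_day_def)

lemma epoch_step_older_append: "\<exists>Y'. epoch_step (\<tau> + j) (older \<tau> P j @ Y) = older \<tau> P (Suc j) @ Y'"
  by (auto simp: epoch_step_def at_day_append sweep_append)

text \<open>Draws are appended behind the existing entries and do not affect how those are swept, so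
  the undisturbed pool stays a prefix of the actual one.\<close>

lemma pool_after_older: "\<exists>Y. pool_after \<tau> P xs = older \<tau> P (length xs) @ Y"
proof (induction xs rule: rev_induct)
  case (snoc x xs)
  then obtain Y where "pool_after \<tau> P xs = older \<tau> P (length xs) @ Y" by blast
  then show ?case
    using epoch_step_older_append[of \<tau> "length xs" P] by (auto simp: pool_after_append)
qed simp

text \<open>Links the hypothetical copy with a real one: directly behind the older entries, a copy
  of \<open>i\<close> meets exactly the comparisons that define \<open>virtual_gain\<close>.
  Surviving them on paper therefore means surviving in the pool.\<close>

lemma pool_after_virtual:
  assumes x: "x mod n = i" and surv: "\<And>j. j < Suc (length xs) \<Longrightarrow> V * Suc j < 3 * G * virtual_gain i \<tau> P (Suc j)"
  shows "\<exists>Y. pool_after \<tau> P (x # xs) =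
    older \<tau> P (Suc (length xs)) @ (i, \<tau>, 0, virtual_gain i \<tau> P (Suc (length xs))) # Y"
proof -
  have step: "\<exists>Y'. epoch_step (\<tau> + j) (older \<tau> P j @ (i, \<tau>, 0, virtual_gain i \<tau> P j) # Y) =
      older \<tau> P (Suc j) @ (i, \<tau>, 0, virtual_gain i \<tau> P (Suc j)) # Y'"
    if "V * Suc j < 3 * G * virtual_gain i \<tau> P (Suc j)" for j Y
  proof -
    have "virtual_gain i \<tau> P (Suc j) = virtual_gain i \<tau> P j +
       (bench \<tau> P j - min (bench \<tau> P j) (max (lcum (\<tau> + j) B i) (cum (\<tau> + j) B - V)))"
      by (simp add: virtual_gain_def)
    moreover have "Suc (\<tau> + j) - \<tau> = Suc j" by simp
    ultimately show ?thesis
      using that by (simp add: epoch_step_def at_day_append sweep_append Let_def bench_def[symmetric])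
        (simp add: at_day_def Let_def not_le[symmetric])
  qed
  show ?thesis
    using surv
  proof (induction xs rule: rev_induct)
    case Nil
    have "fresh \<tau> x = (i, \<tau>, 0, virtual_gain i \<tau> P 0)"
      using x by (simp add: fresh_def virtual_gain_def)
    then show ?case using step[of 0 "[]"] Nil by auto
  next
    case (snoc y ys)
    then obtain Y where "pool_after \<tau> P (x # ys) =
        older \<tau> P (Suc (length ys)) @ (i, \<tau>, 0, virtual_gain i \<tau> P (Suc (length ys))) # Y"
      by auto
    then have "pool_after \<tau> P (x # ys @ [y]) = epoch_step (\<tau> + Suc (length ys)) (older \<tau> P (Suc (length ys)) @
        (i, \<tau>, 0, virtual_gain i \<tau> P (Suc (length ys))) # Y @ [fresh (\<tau> + Suc (length ys)) y])"
      using pool_after_append[of \<tau> P "x # ys" "[y]"] by simp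
    then show ?case
      using step[of "Suc (length ys)"] snoc.prems[of "Suc (length ys)"] by simp
  qed
qed

lemma pool_regret_altdef:
  "pool_regret i \<tau> P xs = (\<Sum>j<length xs.
     real (epoch_out (\<tau> + j) (pool_after \<tau> P (take j xs) @ [fresh (\<tau> + j) (xs ! j)])) - real (lcum (\<tau> + j) B i))"
proof (induction xs rule: rev_induct)
  case (snoc x xs)
  then show ?case
    by (simp add: pool_regret_append nth_append)
qed simp

text \<open>The actual pool contains the older one, so Hedge comes within \<open>V / (3 * G)\<close>
  of \<open>bench\<close> in each epoch. The excess of \<open>bench\<close> over \<open>i\<close>
  adds up to at most the virtual gain, and eviction says that this gain is at most
  \<open>V / (3 * G)\<close> per epoch. The bound holds whatever is drawn meanwhile.\<close>

lemma pool_regret_covered: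
  assumes P: "pool_inv \<tau>\<^sub>0 \<tau> P" "\<tau>\<^sub>0 \<le> \<tau>" "\<tau> + k \<le> \<tau>\<^sub>0 + K"
    and sub: "\<And>\<sigma>. \<tau> \<le> \<sigma> \<Longrightarrow> \<sigma> < \<tau> + k \<Longrightarrow> cum \<sigma> B \<le> lcum \<sigma> B i + V"
    and len: "length xs = Suc j" "j < k"
    and evicted: "3 * G * virtual_gain i \<tau> P (Suc j) \<le> V * Suc j"
  shows "pool_regret i \<tau> P xs \<le> Suc j * (2 * (V / (3 * G)))"
proof -
  let ?\<kappa> = "V / (3 * G) :: real"
  define \<gamma> where "\<gamma> j' = bench \<tau> P j' - 
     min (bench \<tau> P j') (max (lcum (\<tau> + j') B i) (cum (\<tau> + j') B - V))" for j'
  have "real (epoch_out (\<tau> + j') (pool_after \<tau> P (take j' xs) @ [fresh (\<tau> + j') (xs ! j')])) -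
      real (lcum (\<tau> + j') B i) \<le> \<gamma> j' + ?\<kappa>" if "j' < length xs" for j'
  proof -
    let ?Q = "pool_after \<tau> P (take j' xs) @ [fresh (\<tau> + j') (xs ! j')]"
    have j': "j' < k" "length (take j' xs) = j'" using that len by auto
    have "pool_inv \<tau>\<^sub>0 (\<tau> + j') (pool_after \<tau> P (take j' xs))"
      using pool_inv_pool_after[OF P(1,2), of "take j' xs"] j' by simp
    then have Q: "length ?Q \<le> M"
      using pool_inv_length[of \<tau>\<^sub>0 "\<tau> + j'"] P j' by simp
    obtain Y where Y: "pool_after \<tau> P (take j' xs) = older \<tau> P j' @ Y"
      using pool_after_older[of \<tau> P "take j' xs"] j' by auto
    have "real (epoch_out (\<tau> + j') ?Q) - ?\<kappa> \<le> bench \<tau> P j'"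
      unfolding bench_def
    proof (rule sweep_end_ge)
      show "real (epoch_out (\<tau> + j') ?Q) - ?\<kappa> \<le> cum (\<tau> + j') B"
        using epoch_out_le(1)[OF Q, of "\<tau> + j'"] by simp
      fix e s z g assume "(e, s, z, g) \<in> set (at_day (\<tau> + j') B (older \<tau> P j'))"
      then obtain z' where "(e, s, z', g) \<in> set ?Q" "z = lcum (\<tau> + j') B e"
        by (auto simp: at_day_def Y)
      then show "real (epoch_out (\<tau> + j') ?Q) - ?\<kappa> \<le> real z"
        using epoch_out_le(2)[OF Q, of e s z' g "\<tau> + j'"] by simp
    qed
    \<comment> \<open>The subroutine trails \<open>i\<close> by at most \<open>V\<close>, so the
      loss of \<open>i\<close> is not raised by clipping.\<close>
    moreover have "cum (\<tau> + j') B - V \<le> lcum (\<tau> + j') B i"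
      using sub[of "\<tau> + j'"] j' by simp
    then have "real (bench \<tau> P j') - real (lcum (\<tau> + j') B i) \<le> \<gamma> j'"
      unfolding \<gamma>_def by (cases "bench \<tau> P j' \<le> lcum (\<tau> + j') B i") auto
    ultimately show ?thesis by simp
  qed
  then have "pool_regret i \<tau> P xs \<le> (\<Sum>j'<length xs. \<gamma> j' + ?\<kappa>)"
    unfolding pool_regret_altdef by (intro sum_mono) blast
  also have "\<dots> = (\<Sum>j'<Suc j. \<gamma> j' + ?\<kappa>)"
    by (simp only: len(1))
  also have "\<dots> = virtual_gain i \<tau> P (Suc j) + Suc j * ?\<kappa>"
    by (simp only: sum.distrib sum_constant card_lessThan virtual_gain_def \<gamma>_def of_nat_sum)
  also have "real (virtual_gain i \<tau> P (Suc j)) \<le> Suc j * ?\<kappa>"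
  proof -
    have "real (3 * G * virtual_gain i \<tau> P (Suc j)) \<le> real (V * Suc j)"
      using evicted by (simp only: of_nat_le_iff)
    then show ?thesis using G by (simp add: field_simps)
  qed
  finally show ?thesis by (simp only: mult_2 distrib_left add_mono)
qed

text \<open>A caught copy that is never evicted is available to Hedge in each of the epochs, so only
  Hedge's own regret remains.\<close>

lemma pool_regret_virtual:
  assumes P: "pool_inv \<tau>\<^sub>0 \<tau> P" "\<tau>\<^sub>0 \<le> \<tau>" "\<tau> + Suc (length xs) \<le> \<tau>\<^sub>0 + K"
    and x: "x mod n = i"
    and surv: "\<And>j. j < Suc (length xs) \<Longrightarrow> V * Suc j < 3 * G * virtual_gain i \<tau> P (Suc j)"
  shows "pool_regret i \<tau> P (x # xs) \<le> Suc (length xs) * (V / (3 * G))"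
proof -
  have "real (epoch_out (\<tau> + j) (pool_after \<tau> P (take j (x # xs)) @ [fresh (\<tau> + j) ((x # xs) ! j)])) -
      real (lcum (\<tau> + j) B i) \<le> V / (3 * G)" if "j < Suc (length xs)" for j
  proof -
    let ?Q = "pool_after \<tau> P (take j (x # xs)) @ [fresh (\<tau> + j) ((x # xs) ! j)]"
    have len: "length (take j (x # xs)) = j" using that by simp
    have "pool_inv \<tau>\<^sub>0 (\<tau> + j) (pool_after \<tau> P (take j (x # xs)))"
      using pool_inv_pool_after[OF P(1,2), of "take j (x # xs)"] unfolding len .
    then have Q: "length ?Q \<le> M"
      using pool_inv_length[of \<tau>\<^sub>0 "\<tau> + j"] P that by simp
    have "\<exists>s z g. (i, s, z, g) \<in> set ?Q"
    proof (cases j)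
      case 0
      then show ?thesis using x by (auto simp: fresh_def)
    next
      case (Suc j')
      have "\<exists>Y. pool_after \<tau> P (x # take j' xs) = older \<tau> P (Suc (length (take j' xs))) @
          (i, \<tau>, 0, virtual_gain i \<tau> P (Suc (length (take j' xs)))) # Y"
        using that Suc by (intro pool_after_virtual x surv) auto
      then have "\<exists>g. (i, \<tau>, 0, g) \<in> set (pool_after \<tau> P (x # take j' xs))" by auto
      then show ?thesis using Suc by auto
    qed
    then obtain s z g where "(i, s, z, g) \<in> set ?Q" by blast
    then show ?thesis using epoch_out_le(2)[OF Q, of i s z g "\<tau> + j"] by linarith
  qed
  then have "pool_regret i \<tau> P (x # xs) \<le> (\<Sum>j<length (x # xs). V / (3 * G))"
    unfolding pool_regret_altdef by (intro sum_mono) (simp only: lessThan_iff list.size add_Suc_right add_0_right)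
  then show ?thesis by simp
qed

text \<open>Only epochs in which a copy of \<open>i\<close>, if drawn, would stay until the end of the block are costly.
  Each of them catches \<open>i\<close> with probability at least \<open>q\<close>, hence rarely there are more than \<open>N\<close>.\<close>

theorem avg_pool_regret:
  fixes q :: real
  assumes Q: "0 < Q" and q: "q \<le> 1" "q * Q \<le> card {x. x < Q \<and> x mod n = i}"
    and "pool_inv \<tau>\<^sub>0 \<tau> P" "\<tau>\<^sub>0 \<le> \<tau>" "\<tau> + k \<le> \<tau>\<^sub>0 + K"
    and "\<And>\<sigma>. \<tau> \<le> \<sigma> \<Longrightarrow> \<sigma> < \<tau> + k \<Longrightarrow> cum \<sigma> B \<le> lcum \<sigma> B i + V"
  shows "avg Q k (\<lambda>xs. of_bool (k * (2 * (V / (3 * G))) + N * V < pool_regret i \<tau> P xs)) \<le> (1 - q) ^ N"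
  using assms(4-)
proof (induction k arbitrary: \<tau> P N rule: less_induct)
  case (less k)
  let ?\<kappa> = "V / (3 * G) :: real"
  note inv = less.prems(1-3) and sub = less.prems(4)
  \<comment> \<open>Which case applies is settled by \<open>P\<close> and the losses before any draw
    of \<open>xs\<close> is made. In the second case the next \<open>Suc j\<close> epochs are
    harmless for every outcome, and the induction resumes after them.\<close>
  consider "k = 0" | j where "j < k" "3 * G * virtual_gain i \<tau> P (Suc j) \<le> V * Suc j"
    | "0 < k" "\<And>j. j < k \<Longrightarrow> V * Suc j < 3 * G * virtual_gain i \<tau> P (Suc j)"
    by (metis not_le neq0_conv)
  then show ?case
  proof cases
    case 1
    moreover have "\<not> N * V < (0 :: real)" by (simp add: not_less)
    ultimately show ?thesis using q by simp
  next
    case (2 j)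
    define k' where "k' = k - Suc j"
    have k: "k = Suc j + k'" using 2 by (simp add: k'_def)
    have "avg Q k (\<lambda>xs. of_bool (k * (2 * ?\<kappa>) + N * V < pool_regret i \<tau> P xs)) =
        avg Q (Suc j) (\<lambda>xs. avg Q k' (\<lambda>ys. of_bool (k * (2 * ?\<kappa>) + N * V < pool_regret i \<tau> P (xs @ ys))))"
      unfolding k by (rule avg_append)
    also have "\<dots> \<le> avg Q (Suc j) (\<lambda>xs. (1 - q) ^ N)"
    proof (rule avg_mono)
      fix xs :: "nat list" assume len: "length xs = Suc j"
      have "pool_regret i \<tau> P xs \<le> Suc j * (2 * ?\<kappa>)"
        using sub by (intro pool_regret_covered[OF inv _ len 2]) auto
      moreover have "k * (2 * ?\<kappa>) = Suc j * (2 * ?\<kappa>) + k' * (2 * ?\<kappa>)"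
        by (simp only: k of_nat_add distrib_right)
      ultimately have imp: "k' * (2 * ?\<kappa>) + N * V < pool_regret i (\<tau> + Suc j) (pool_after \<tau> P xs) ys"
        if "k * (2 * ?\<kappa>) + N * V < pool_regret i \<tau> P (xs @ ys)" for ys
        using that len by (simp only: pool_regret_append)
      have "avg Q k' (\<lambda>ys. of_bool (k * (2 * ?\<kappa>) + N * V < pool_regret i \<tau> P (xs @ ys))) \<le>
        avg Q k' (\<lambda>ys. of_bool (k' * (2 * ?\<kappa>) + N * V < pool_regret i (\<tau> + Suc j) (pool_after \<tau> P xs) ys))"
        using imp by (intro avg_mono) (simp only: of_bool_eq_iff of_bool_def split: if_splits, auto)
      also have "\<dots> \<le> (1 - q) ^ N"
        using pool_inv_pool_after[OF inv(1,2), of xs] len inv k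
        by (intro less.IH sub) auto
      finally show "avg Q k' (\<lambda>ys. of_bool (k * (2 * ?\<kappa>) + N * V < pool_regret i \<tau> P (xs @ ys))) \<le> (1 - q) ^ N" .
    qed
    also have "\<dots> = (1 - q) ^ N" by (rule avg_const[OF Q])
    finally show ?thesis .
  next
    case 3
    then obtain k' where k: "k = Suc k'" by (cases k) auto
    show ?thesis
    proof (cases N)
      case 0
      have "avg Q k (\<lambda>xs. of_bool (k * (2 * ?\<kappa>) + N * V < pool_regret i \<tau> P xs)) \<le> avg Q k (\<lambda>xs. 1)"
        by (intro avg_mono) auto
      then show ?thesis using 0 avg_const[OF Q] by simp
    next
      case (Suc N')
      let ?bad = "\<lambda>x xs. k * (2 * ?\<kappa>) + N * V < pool_regret i \<tau> P (x # xs)"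
      \<comment> \<open>With a copy of \<open>i\<close> in the pool for all \<open>k\<close> epochs,
        half of the term \<open>k * (2 * V / (3 * G))\<close> already suffices.\<close>
      have hit: "avg Q k' (\<lambda>xs. of_bool (?bad x xs)) = 0" if "x mod n = i" for x
      proof -
        have "\<not> ?bad x xs" if "length xs = k'" for xs
        proof -
          have "pool_regret i \<tau> P (x # xs) \<le> Suc (length xs) * ?\<kappa>"
            using 3(2) k that inv by (intro pool_regret_virtual[OF inv(1,2) _ \<open>x mod n = i\<close>]) auto
          also have "\<dots> \<le> k * (2 * ?\<kappa>)" using that k by (simp add: divide_right_mono)
          finally show ?thesis by (smt (verit) mult_nonneg_nonneg of_nat_0_le_iff)
        qed
        then have "avg Q k' (\<lambda>xs. of_bool (?bad x xs)) = avg Q k' (\<lambda>xs. 0)"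
          by (intro avg_cong) auto
        then show ?thesis using avg_const[OF Q] by simp
      qed
      \<comment> \<open>For any draw, the level trails the subroutine by at most
        \<open>V / (3 * G)\<close>, and the subroutine trails \<open>i\<close> by at most
        \<open>V\<close>. One of the \<open>N\<close> units pays for this, and the induction
        continues with \<open>N'\<close>.\<close>
      have miss: "avg Q k' (\<lambda>xs. of_bool (?bad x xs)) \<le> (1 - q) ^ N'" for x
      proof -
        let ?P' = "epoch_step \<tau> (P @ [fresh \<tau> x])"
        have "Suc (length P) \<le> M" using inv by (intro pool_inv_length[OF inv(1)]) auto
        then have "epoch_out \<tau> (P @ [fresh \<tau> x]) \<le> cum \<tau> B + ?\<kappa>"
          by (intro epoch_out_le(1)) simp
        moreover have "cum \<tau> B \<le> lcum \<tau> B i + V" using sub[of \<tau>] k by simp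
        then have "real (cum \<tau> B) \<le> lcum \<tau> B i + V" by (metis of_nat_add of_nat_le_iff)
        ultimately have "epoch_out \<tau> (P @ [fresh \<tau> x]) - real (lcum \<tau> B i) \<le> V + ?\<kappa>" by simp
        moreover have "0 \<le> ?\<kappa>" by simp
        moreover have "k * (2 * ?\<kappa>) + N * V = k' * (2 * ?\<kappa>) + N' * V + (V + 2 * ?\<kappa>)"
          by (simp add: k Suc distrib_right add_divide_distrib)
        ultimately have imp: "k' * (2 * ?\<kappa>) + N' * V < pool_regret i (Suc \<tau>) ?P' xs" if "?bad x xs" for xs
          using that unfolding pool_regret.simps by argo
        have "avg Q k' (\<lambda>xs. of_bool (?bad x xs)) \<le>
            avg Q k' (\<lambda>xs. of_bool (k' * (2 * ?\<kappa>) + N' * V < pool_regret i (Suc \<tau>) ?P' xs))"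
          using imp by (intro avg_mono) (simp only: of_bool_eq_iff of_bool_def split: if_splits, auto)
        also have "\<dots> \<le> (1 - q) ^ N'"
          using inv k by (intro less.IH sub pool_inv_step[OF inv(1,2)]) auto
        finally show ?thesis .
      qed
      have "avg Q k (\<lambda>xs. of_bool (k * (2 * ?\<kappa>) + N * V < pool_regret i \<tau> P xs)) =
          (\<Sum>x<Q. avg Q k' (\<lambda>xs. of_bool (?bad x xs))) / Q"
        by (simp only: k avg.simps)
      also have "\<dots> \<le> (\<Sum>x<Q. if x mod n = i then 0 else (1 - q) ^ N') / Q"
        using hit miss by (intro divide_right_mono sum_mono) auto
      also have "(\<Sum>x<Q. if x mod n = i then 0 else (1 - q) ^ N') = 
          (Q - card {x. x < Q \<and> x mod n = i}) * (1 - q) ^ N'"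
      proof -
        have "{..<Q} \<inter> - {x. x mod n = i} = {..<Q} - {x. x < Q \<and> x mod n = i}" by auto
        then have "card ({..<Q} \<inter> - {x. x mod n = i}) = Q - card {x. x < Q \<and> x mod n = i}"
          by (simp add: card_Diff_subset subset_eq)
        then show ?thesis by (simp add: sum.If_cases)
      qed
      \<comment> \<open>A share of at least \<open>q\<close> of the values \<open>x\<close> catches
        \<open>i\<close> and contributes nothing, which supplies one factor
        \<open>1 - q\<close>.\<close>
      also have "\<dots> \<le> ((1 - q) * Q) * (1 - q) ^ N'"
      proof (intro mult_right_mono)
        have "card {x. x < Q \<and> x mod n = i} \<le> card {..<Q}" by (intro card_mono) auto
        then show "real (Q - card {x. x < Q \<and> x mod n = i}) \<le> (1 - q) * Q"
          using q(2) by (simp add: of_nat_diff algebra_simps)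
      qed (use q in auto)
      also have "\<dots> / Q = (1 - q) ^ N" using Q Suc by simp
      finally show ?thesis using Q by (simp add: divide_right_mono)
    qed
  qed
qed

end

section \<open>The hierarchy of levels\<close>

lemma sum_blocks: "(\<Sum>t<k * b. f t) = (\<Sum>j<k. \<Sum>d<b. f (j * b + d))" for f :: "nat \<Rightarrow> real" and k b :: nat
proof -
  have "sum f {j * b..<j * b + b} = (\<Sum>d<b. f (j * b + d))" for j
    using sum.shift_bounds_nat_ivl[of f 0 "j * b" b] by (simp add: lessThan_atLeast0 add.commute)
  then show ?thesis using sum.nat_group[of f b k] by simp
qed

text \<open>Reducing a uniform number below \<open>Q\<close> modulo \<open>n\<close> is not exactly
  uniform, but each residue occurs at least \<open>Q div n\<close> times, and \<open>Q div n\<close>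
  is at least half of \<open>Q / n\<close> because \<open>Q\<close> is at least
  \<open>n\<close>.\<close>

lemma card_residue_ge:
  fixes n i Q :: nat
  assumes "i < n" "n \<le> Q"
  shows "1 / (2 * n) * Q \<le> card {x. x < Q \<and> x mod n = i}"
proof -
  have n: "0 < n" using assms(1) by simp
  have "(\<lambda>k. i + n * k) ` {..<Q div n} \<subseteq> {x. x < Q \<and> x mod n = i}"
  proof safe
    fix k assume "k < Q div n"
    then have "n * Suc k \<le> n * (Q div n)" by (intro mult_le_mono2) simp
    also have "\<dots> \<le> Q" by simp
    finally show "i + n * k < Q" using assms by simp
  qed (use assms in simp)
  then have "card ((\<lambda>k. i + n * k) ` {..<Q div n}) \<le> card {x. x < Q \<and> x mod n = i}"
    by (intro card_mono) auto
  moreover have "inj_on (\<lambda>k. i + n * k) {..<Q div n}" using n by (auto simp: inj_on_def)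
  ultimately have card: "Q div n \<le> card {x. x < Q \<and> x mod n = i}" by (simp add: card_image)
  have "1 \<le> Q div n" using assms n by (simp add: div_greater_zero_iff Suc_le_eq)
  then have "n * 1 \<le> n * (Q div n)" by (intro mult_le_mono2)
  moreover have "Q = n * (Q div n) + Q mod n" by simp
  moreover have "Q mod n < n" using n by simp
  ultimately have "Q \<le> 2 * n * (Q div n)" by linarith
  also have "\<dots> \<le> 2 * n * card {x. x < Q \<and> x mod n = i}" using card by (intro mult_le_mono2)
  finally have "real Q \<le> 2 * n * card {x. x < Q \<and> x mod n = i}" by (metis of_nat_le_iff)
  then show ?thesis using n by (simp add: field_simps)
qed

section \<open>Parameters and states of the levels\<close>

locale pool_params =
  fixes n S G H B\<^sub>0 R m :: nat
begin

text \<open>Blocks of level \<open>r\<close> are the epochs of level \<open>Suc r\<close>. One step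
  up multiplies the length by \<open>G * H\<close> but the target regret \<open>width\<close> only
  by \<open>H\<close>.\<close>

definition blen :: "nat \<Rightarrow> nat" where "blen r = B\<^sub>0 * (G * H) ^ r"
definition width :: "nat \<Rightarrow> nat" where "width r = S * B\<^sub>0 * H ^ r"
text \<open>Chosen so that \<open>2 * rate r * blen r\<close> is exactly
  \<open>B\<^sub>0 * H ^ r / (6 * G)\<close>, half of what Hedge may lose in an epoch after scaling
  by \<open>S\<close>.\<close>

definition rate :: "nat \<Rightarrow> real" where "rate r = 1 / (12 * real G ^ Suc r)"

text \<open>At the bottom stands the trivial algorithm that always follows expert 0. Its epochs are
  so short that any algorithm meets the bound \<open>width 0\<close>.\<close>

primrec outs :: "(nat \<Rightarrow> level) \<Rightarrow> (nat \<Rightarrow> nat) \<Rightarrow> nat \<Rightarrow> nat" where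
  "outs lv l 0 = l 0"
| "outs lv l (Suc r) = level_out (rate r) S l (outs lv l r) (lv r)"

definition next_level :: "nat \<Rightarrow> (nat \<Rightarrow> nat) \<Rightarrow> (nat \<Rightarrow> nat) \<Rightarrow> (nat \<Rightarrow> level) \<Rightarrow> nat \<Rightarrow> level" where
  "next_level t l x lv r = level_step n G (width r) (blen r) (G * H) t l (outs lv l r) (x r) (lv r)"

primrec lev :: "(nat \<Rightarrow> nat \<Rightarrow> nat) \<Rightarrow> (nat \<Rightarrow> nat \<Rightarrow> nat) \<Rightarrow> nat \<Rightarrow> nat \<Rightarrow> level" where
  "lev x l 0 = (\<lambda>r. (0, [(x r 0 mod n, 0, 0, 0)]))"
| "lev x l (Suc t) = next_level t (l t) (\<lambda>r. x r (Suc t)) (lev x l t)"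

definition out :: "(nat \<Rightarrow> nat \<Rightarrow> nat) \<Rightarrow> (nat \<Rightarrow> nat \<Rightarrow> nat) \<Rightarrow> nat \<Rightarrow> nat \<Rightarrow> nat" where
  "out x l r t = outs (lev x l t) (l t) r"

text \<open>A level reads losses only of expert 0 and of experts in the pools. This lets the real
  algorithm, which sees nothing else, be replaced by one with full information.\<close>

lemma outs_cong:
  assumes "\<And>r'. r' < r \<Longrightarrow> lv r' = lv' r'" "l 0 = l' 0"
    and "\<And>r' e s z g. r' < r \<Longrightarrow> (e, s, z, g) \<in> set (snd (lv r')) \<Longrightarrow> l e = l' e"
  shows "outs lv l r = outs lv' l' r"
  using assms
proof (induction r)
  case (Suc r)
  have IH: "outs lv l r = outs lv' l' r"
    by (rule Suc.IH) (meson Suc.prems less_SucI)+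
  obtain c P where lv: "lv r = (c, P)" by (cases "lv r")
  have "map (\<lambda>(e, s, z, g). (z, l e)) P = map (\<lambda>(e, s, z, g). (z, l' e)) P"
    using Suc.prems(3)[of r] lv by auto
  moreover have "lv' r = (c, P)" using Suc.prems(1)[of r] lv by simp
  ultimately show ?case
    using lv by (simp only: outs.simps IH level_out_def prod.case)
qed simp

lemma next_level_cong:
  assumes lv: "\<And>r'. r' \<le> r \<Longrightarrow> lv r' = lv' r'" and l: "l 0 = l' 0" and x: "x r = x' r"
    and le: "\<And>r' e s z g. r' \<le> r \<Longrightarrow> (e, s, z, g) \<in> set (snd (lv r')) \<Longrightarrow> l e = l' e"
  shows "next_level t l x lv r = next_level t l' x' lv' r"
proof -
  have "outs lv l r = outs lv' l' r"
    by (rule outs_cong) (meson lv l le less_imp_le)+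
  moreover obtain c P where P: "lv r = (c, P)" by (cases "lv r")
  moreover have "add_losses l P = add_losses l' P"
    using le[of r] P by (auto simp: add_losses_def)
  ultimately show ?thesis
    using lv[of r] x by (simp add: next_level_def level_step_def)
qed

lemma lev_dep:
  assumes "\<And>r' t'. r' \<le> r \<Longrightarrow> t' \<le> t \<Longrightarrow> x r' t' = y r' t'"
  shows "lev x l t r = lev y l t r"
  using assms
proof (induction t arbitrary: r)
  case (Suc t)
  show ?case
    unfolding lev.simps by (intro next_level_cong Suc) (use Suc.prems in auto)
qed auto

text \<open>The inequality \<open>r' < r\<close> is strict: \<open>out x l r\<close> is the
  subroutine below level \<open>r\<close>, so the draws made by level \<open>r\<close> are still
  fresh once it is known.\<close>

lemma out_dep:
  assumes "\<And>r' t'. r' < r \<Longrightarrow> t' \<le> t \<Longrightarrow> x r' t' = y r' t'"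
  shows "out x l r t = out y l r t"
  unfolding out_def by (intro outs_cong lev_dep assms) auto

lemma out_zero: "(\<And>e. l t e = 0) \<Longrightarrow> out x l r t = 0"
  unfolding out_def
proof (induction r)
  case (Suc r)
  have IH: "outs (lev x l t) (l t) r = 0" by (rule Suc.IH) (rule Suc.prems)
  obtain c P where lv: "lev x l t r = (c, P)" by (cases "lev x l t r")
  have "level_out (rate r) S (l t) 0 (c, P) \<le> 0"
    by (rule level_out_le) (simp_all add: Suc.prems)
  then show ?case by (simp only: outs.simps IH lv le_zero_eq)
qed simp

end

section \<open>Each level is an instance of the one-level analysis\<close>

locale pool_hierarchy = pool_params +
  fixes M N :: nat
  assumes n: "0 < n" and S: "0 < S" and G: "0 < G" and GH: "G \<le> H" and B\<^sub>0: "0 < B\<^sub>0"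
    and M: "3 * G * harm (G * H) + 1 \<le> real M"
    and B\<^sub>0_ge: "72 * real G ^ 2 * ln (M + 1) \<le> B\<^sub>0"
    and N: "3 * N \<le> H"
begin

lemma H: "0 < H" using G GH by simp

lemma blen_pos: "0 < blen r" using B\<^sub>0 G H by (simp add: blen_def)

lemma blen_Suc: "blen (Suc r) = G * H * blen r"
  by (simp add: blen_def)

lemma width_Suc: "width (Suc r) = H * width r"
  by (simp add: width_def)

lemma width_pos: "0 < width r" using S B\<^sub>0 H by (simp add: width_def)

text \<open>Each of the two Hedge terms takes one half of the budget. For the logarithmic one this
  needs \<open>72 * G ^ (r + 2) * ln (M + 1)\<close> to be at most \<open>B\<^sub>0 * H ^ r\<close>,
  which follows from the size of \<open>B\<^sub>0\<close> and from \<open>G \<le> H\<close>.\<close>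

lemma rate_hedge: "S * (ln (M + 1) / rate r + 2 * rate r * blen r) \<le> width r / (3 * G)"
proof -
  have "2 * rate r * blen r = real B\<^sub>0 * H ^ r / (6 * G)"
    using G by (simp add: rate_def blen_def power_mult_distrib field_simps)
  moreover have "ln (M + 1) / rate r \<le> real B\<^sub>0 * H ^ r / (6 * G)"
  proof -
    have "real G ^ r \<le> real H ^ r" using GH by (intro power_mono) auto
    then have *: "(72 * real G ^ 2 * ln (M + 1)) * real G ^ r \<le> B\<^sub>0 * real H ^ r"
      using B\<^sub>0_ge by (intro mult_mono) auto
    have "ln (M + 1) / rate r = ((72 * real G ^ 2 * ln (M + 1)) * real G ^ r) / (6 * G)"
      using G by (simp add: rate_def field_simps power2_eq_square)
    also have "\<dots> \<le> (B\<^sub>0 * real H ^ r) / (6 * G)"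
      using * by (intro divide_right_mono) auto
    finally show ?thesis by simp
  qed
  ultimately have "ln (M + 1) / rate r + 2 * rate r * blen r \<le> real B\<^sub>0 * H ^ r / (3 * G)"
    by (simp add: field_simps)
  then have "S * (ln (M + 1) / rate r + 2 * rate r * blen r) \<le> S * (real B\<^sub>0 * H ^ r / (3 * G))"
    by (intro mult_left_mono) auto
  then show ?thesis by (simp add: width_def)
qed

lemma out_le: "(\<And>e. l t e \<le> S) \<Longrightarrow> out x l r t \<le> S"
  unfolding out_def
proof (induction r)
  case (Suc r)
  then show ?case
    using level_out_le[of "outs (lev x l t) (l t) r" S "snd (lev x l t r)" "l t" "rate r" S "fst (lev x l t r)"]
    by simp
qed simp

lemma pool_level_instance:
  assumes "\<And>t e. l t e \<le> S"
  shows "pool_level n S G (width r) (blen r) (G * H) M (rate r) (out x l r) l"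
proof
  have "1 \<le> real G ^ Suc r" using G by (intro one_le_power) simp
  then show "rate r \<le> 1 / 2" by (simp add: rate_def divide_le_eq)
  show "0 < rate r" using G by (simp add: rate_def)
qed (use n S G H width_pos blen_pos M rate_hedge assms out_le in auto)

context
  fixes x l :: "nat \<Rightarrow> nat \<Rightarrow> nat" and r :: nat
  assumes l_le: "\<And>t e. l t e \<le> S"
begin

interpretation L: pool_level n S G "width r" "blen r" "G * H" M "rate r" "out x l r" l
  by (rule pool_level_instance[OF l_le])

lemma at_day_Suc: "add_losses (l (\<tau> * blen r + d)) (L.at_day \<tau> d Q) = L.at_day \<tau> (Suc d) Q"
  by (auto simp: add_losses_def L.at_day_def L.lcum_def)

lemma lev_in_epoch:
  assumes "lev x l (\<tau> * blen r) r = (0, Q)" "\<And>e s z g. (e, s, z, g) \<in> set Q \<Longrightarrow> z = 0" "d < blen r"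
  shows "lev x l (\<tau> * blen r + d) r = (L.cum \<tau> d, L.at_day \<tau> d Q)"
  using assms(3)
proof (induction d)
  case 0
  have "L.at_day \<tau> 0 Q = Q"
    unfolding L.at_day_def L.lcum_def using assms(2) by (intro map_idI) auto
  then show ?case using assms(1) by (simp add: L.cum_def)
next
  case (Suc d)
  have "Suc (\<tau> * blen r + d) mod blen r = Suc d"
    using Suc.prems mod_mult_self3[of \<tau> "blen r" "Suc d"] by simp
  then show ?case
    using Suc by (simp add: at_day_Suc next_level_def level_step_def L.cum_def out_def[symmetric])
qed

lemma lev_epoch_end:
  assumes "lev x l (\<tau> * blen r) r = (0, Q)" "\<And>e s z g. (e, s, z, g) \<in> set Q \<Longrightarrow> z = 0"
  shows "lev x l (Suc \<tau> * blen r) r =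
    (0, (if Suc \<tau> mod (G * H) = 0 then [] else L.epoch_step \<tau> Q) @ [L.fresh (Suc \<tau>) (x r (Suc \<tau> * blen r))])"
proof -
  obtain d where d: "blen r = Suc d" using blen_pos[of r] by (cases "blen r") auto
  define t where "t = \<tau> * blen r + d"
  have t: "Suc t = Suc \<tau> * blen r" by (simp add: t_def d)
  have "d < blen r" by (simp add: d)
  then have div: "t div blen r = \<tau>" unfolding t_def by simp
  have lev: "lev x l t r = (L.cum \<tau> d, L.at_day \<tau> d Q)"
    unfolding t_def by (rule lev_in_epoch[OF assms]) (simp_all add: d)
  have "add_losses (l t) (L.at_day \<tau> d Q) = L.at_day \<tau> (blen r) Q" 
    unfolding t_def at_day_Suc by (simp only: d)
  moreover have "L.cum \<tau> d + out x l r t = L.cum \<tau> (blen r)"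
    using L.cum_def[of \<tau> d] L.cum_def[of \<tau> "Suc d"] unfolding t_def by (simp only: d sum.lessThan_Suc)
  moreover have "Suc t mod (blen r * (G * H)) = 0 \<longleftrightarrow> Suc \<tau> mod (G * H) = 0"
    unfolding t mult.commute[of "Suc \<tau>"] mod_mult_mult1 using blen_pos[of r] by simp
  moreover have "Suc t mod blen r = 0" "Suc t div blen r = Suc \<tau>"
    unfolding t using blen_pos[of r] by (simp_all del: mult_Suc)
  ultimately show ?thesis
    unfolding t[symmetric] lev.simps next_level_def level_step_def lev
    by (simp add: out_def[symmetric] div L.epoch_step_def L.fresh_def)
qed

lemma lev_epoch_start_zero: "\<exists>Q. lev x l (\<tau> * blen r) r = (0, Q) \<and> (\<forall>(e, s, z, g)\<in>set Q. z = 0)"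
proof (induction \<tau>)
  case (Suc \<tau>)
  then obtain Q where Q: "lev x l (\<tau> * blen r) r = (0, Q)" "\<And>e s z g. (e, s, z, g) \<in> set Q \<Longrightarrow> z = 0"
    by blast
  then show ?case
    using lev_epoch_end[OF Q] sweep_mem(1) by (fastforce simp: L.fresh_def L.epoch_step_def)
qed simp

abbreviation block_draws :: "nat \<Rightarrow> nat \<Rightarrow> nat list" where
  "block_draws \<beta> k \<equiv> map (\<lambda>j. x r ((\<beta> * (G * H) + j) * blen r)) [0..<k]"

text \<open>Identifies the state reached day by day with the recursion \<open>pool_after\<close>,
  which starts from an empty pool in every block.\<close>

lemma lev_block:
  assumes "j < G * H"
  shows "lev x l ((\<beta> * (G * H) + j) * blen r) r =
    (0, L.pool_after (\<beta> * (G * H)) [] (block_draws \<beta> j) @ 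
        [L.fresh (\<beta> * (G * H) + j) (x r ((\<beta> * (G * H) + j) * blen r))])"
  using assms
proof (induction j)
  case 0
  show ?case
  proof (cases "\<beta> * (G * H)")
    case 0
    then show ?thesis using G H by (simp add: L.fresh_def)
  next
    case (Suc \<tau>)
    obtain Q where Q: "lev x l (\<tau> * blen r) r = (0, Q)" "\<And>e s z g. (e, s, z, g) \<in> set Q \<Longrightarrow> z = 0"
      using lev_epoch_start_zero[of \<tau>] by blast
    have "Suc \<tau> mod (G * H) = 0" unfolding Suc[symmetric] by simp
    then show ?thesis using lev_epoch_end[OF Q] by (simp add: Suc)
  qed
next
  case (Suc j)
  let ?\<tau> = "\<beta> * (G * H) + j"
  obtain Q where Q: "lev x l (?\<tau> * blen r) r = (0, Q)" "\<And>e s z g. (e, s, z, g) \<in> set Q \<Longrightarrow> z = 0"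
    using lev_epoch_start_zero[of ?\<tau>] by blast
  have "Suc ?\<tau> mod (G * H) = Suc j"
    using Suc.prems mod_mult_self3[of \<beta> "G * H" "Suc j"] by simp
  then show ?case
    using lev_epoch_end[OF Q] Q(1) Suc by (simp add: L.pool_after_append)
qed

lemma lev_length: "length (snd (lev x l t r)) \<le> M"
proof -
  define \<tau> where "\<tau> = t div blen r"
  define \<beta> where "\<beta> = \<tau> div (G * H)"
  define j where "j = \<tau> mod (G * H)"
  have j: "j < G * H" using G H by (simp add: j_def)
  have \<tau>: "\<tau> = \<beta> * (G * H) + j" unfolding \<beta>_def j_def by (rule div_mult_mod_eq[symmetric])
  obtain Q where Q: "lev x l (\<tau> * blen r) r = (0, Q)" "\<And>e s z g. (e, s, z, g) \<in> set Q \<Longrightarrow> z = 0"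
    using lev_epoch_start_zero[of \<tau>] by blast
  have "L.pool_inv (\<beta> * (G * H)) \<tau> (L.pool_after (\<beta> * (G * H)) [] (block_draws \<beta> j))"
    using L.pool_inv_pool_after[OF L.pool_inv_Nil, of "\<beta> * (G * H)" "block_draws \<beta> j"] by (simp add: \<tau>)
  then have "length Q \<le> M"
    using L.pool_inv_length[of "\<beta> * (G * H)" \<tau>] lev_block[OF j, of \<beta>] Q(1) j by (auto simp: \<tau>)
  moreover have "lev x l t r = (L.cum \<tau> (t mod blen r), L.at_day \<tau> (t mod blen r) Q)"
    using lev_in_epoch[OF Q, where d = "t mod blen r"] blen_pos[of r] by (simp add: \<tau>_def)
  ultimately show ?thesis by (simp add: L.at_day_def)
qed

lemma block_regret:
  "(\<Sum>t<blen (Suc r). real (out x l (Suc r) (\<beta> * blen (Suc r) + t)) - real (l (\<beta> * blen (Suc r) + t) i)) =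
    L.pool_regret i (\<beta> * (G * H)) [] (block_draws \<beta> (G * H))"
proof -
  have epoch: "(\<Sum>d<blen r. real (out x l (Suc r) ((\<beta> * (G * H) + j) * blen r + d)) -
      real (l ((\<beta> * (G * H) + j) * blen r + d) i)) =
    real (L.epoch_out (\<beta> * (G * H) + j) (L.pool_after (\<beta> * (G * H)) [] (take j (block_draws \<beta> (G * H))) @
      [L.fresh (\<beta> * (G * H) + j) (block_draws \<beta> (G * H) ! j)])) - real (L.lcum (\<beta> * (G * H) + j) (blen r) i)"
    if "j < G * H" for j
  proof -
    let ?\<tau> = "\<beta> * (G * H) + j"
    obtain Q where Q: "lev x l (?\<tau> * blen r) r = (0, Q)" "\<And>e s z g. (e, s, z, g) \<in> set Q \<Longrightarrow> z = 0"
      using lev_epoch_start_zero[of ?\<tau>] by blast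
    have "(\<Sum>d<blen r. out x l (Suc r) (?\<tau> * blen r + d)) = L.epoch_out ?\<tau> Q"
      unfolding L.epoch_out_def
      using lev_in_epoch[OF Q] by (intro sum.cong refl) (simp add: out_def)
    moreover have "take j (block_draws \<beta> (G * H)) = block_draws \<beta> j"
      using that by (simp add: take_map)
    ultimately show ?thesis
      using lev_block[OF that, of \<beta>] Q(1) that by (simp add: sum_subtractf L.lcum_def of_nat_sum[symmetric] del: of_nat_sum)
  qed
  have "(\<Sum>t<blen (Suc r). real (out x l (Suc r) (\<beta> * blen (Suc r) + t)) - real (l (\<beta> * blen (Suc r) + t) i)) =
    (\<Sum>j<G * H. \<Sum>d<blen r. real (out x l (Suc r) ((\<beta> * (G * H) + j) * blen r + d)) -
      real (l ((\<beta> * (G * H) + j) * blen r + d) i))"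
    unfolding blen_Suc sum_blocks by (intro sum.cong refl) (simp add: algebra_simps)
  also have "\<dots> = L.pool_regret i (\<beta> * (G * H)) [] (block_draws \<beta> (G * H))"
    unfolding L.pool_regret_altdef by (intro sum.cong) (simp_all add: epoch)
  finally show ?thesis .
qed

end

section \<open>Failure probabilities, from the bottom level upwards\<close>

definition block_ok :: "nat \<Rightarrow> (nat \<Rightarrow> nat \<Rightarrow> nat) \<Rightarrow> nat \<Rightarrow> (nat \<Rightarrow> nat \<Rightarrow> nat) \<Rightarrow> nat \<Rightarrow> nat \<Rightarrow> bool" where
  "block_ok i l r x \<beta> d \<longleftrightarrow>
     (\<Sum>t<blen r. out x l r (\<beta> * blen r + t)) \<le> (\<Sum>t<blen r. l (\<beta> * blen r + t) i) + d"

lemma block_ok_dep: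
  assumes "\<And>r' t'. r' < r \<Longrightarrow> t' < Suc \<beta> * blen r \<Longrightarrow> x r' t' = y r' t'"
  shows "block_ok i l r x \<beta> d = block_ok i l r y \<beta> d"
  unfolding block_ok_def
  by (intro arg_cong2[where f = "(\<le>)"] sum.cong refl out_dep assms) auto

text \<open>Isolates the failure of a single level: all epochs of the block satisfy the regret
  bound, yet the block does not. Given the lower levels, this depends only on the draws of level
  \<open>r\<close> within the block.\<close>

lemma prob_block_fails:
  fixes r \<beta> :: nat
  assumes l_le: "\<And>t e. l t e \<le> S" and i: "i < n" and m: "n \<le> 2 ^ m"
  defines "E \<equiv> {\<omega>. (\<forall>j<G * H. block_ok i l r (draw m \<omega>) (\<beta> * (G * H) + j) (width r)) \<and>
    \<not> block_ok i l (Suc r) (draw m \<omega>) \<beta> (width (Suc r))}"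
  shows "E \<in> sets coins" "measure coins E \<le> (1 - 1 / (2 * n)) ^ N"
proof -
  define key where "key j = (r, (\<beta> * (G * H) + j) * blen r)" for j
  define ks where "ks = map key [0..<G * H]"
  \<comment> \<open>The keys to condition on: everything up to the end of the block on levels up to
    \<open>r\<close>, except the draws of this block on level \<open>r\<close>.\<close>
  define A where "A = {..r} \<times> {..<Suc \<beta> * blen (Suc r)} - set ks"
  \<comment> \<open>Replaces the block's own draws in the table \<open>x\<close> by
    \<open>xs\<close>. The first part of \<open>F\<close> can stay on \<open>x\<close>, as the lower
    levels do not see these draws.\<close>
  define ov where "ov x xs r' t = (if (r', t) \<in> set ks then the (map_of (zip ks xs) (r', t)) else x r' t)"
    for x :: "nat \<Rightarrow> nat \<Rightarrow> nat" and xs r' t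
  define F where "F x xs \<longleftrightarrow> (\<forall>j<G * H. block_ok i l r x (\<beta> * (G * H) + j) (width r)) \<and>
    \<not> block_ok i l (Suc r) (ov x xs) \<beta> (width (Suc r))" for x xs
  have dist: "distinct ks"
    using blen_pos[of r] by (auto simp: ks_def distinct_map inj_on_def key_def)
  have F_dep: "F x xs = F y xs" if xy: "\<And>r' t. (r', t) \<in> A \<Longrightarrow> x r' t = y r' t" for x y xs
  proof -
    have "block_ok i l r x (\<beta> * (G * H) + j) (width r) = block_ok i l r y (\<beta> * (G * H) + j) (width r)"
      if "j < G * H" for j
    proof (rule block_ok_dep)
      fix r' t assume "r' < r" "t < Suc (\<beta> * (G * H) + j) * blen r"
      moreover have "Suc (\<beta> * (G * H) + j) * blen r \<le> Suc \<beta> * blen (Suc r)"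
        using that mult_le_mono1[of "Suc (\<beta> * (G * H) + j)" "Suc \<beta> * (G * H)" "blen r"]
        by (simp only: blen_Suc mult.assoc) simp
      ultimately show "x r' t = y r' t"
        by (intro xy) (auto simp: A_def ks_def key_def)
    qed
    moreover have "block_ok i l (Suc r) (ov x xs) \<beta> (width (Suc r)) = block_ok i l (Suc r) (ov y xs) \<beta> (width (Suc r))"
      by (rule block_ok_dep) (auto simp: ov_def intro!: xy simp: A_def)
    ultimately show ?thesis by (simp add: F_def)
  qed
  have bound: "avg (2 ^ m) (length ks) (\<lambda>xs. of_bool (F x xs)) \<le> (1 - 1 / (2 * n)) ^ N" for x
  proof (cases "\<forall>j<G * H. block_ok i l r x (\<beta> * (G * H) + j) (width r)")
    case False
    then have "F x xs = False" for xs by (simp add: F_def)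
    then show ?thesis using n by (simp add: avg_const)
  next
    case True
    interpret L: pool_level n S G "width r" "blen r" "G * H" M "rate r" "out x l r" l
      by (rule pool_level_instance[OF l_le])
    let ?bound = "real (G * H) * (2 * (width r / (3 * G))) + N * width r"
    \<comment> \<open>Two thirds of \<open>H * width r\<close> for the harmless epochs, and
      \<open>N \<le> H / 3\<close> costly ones for the rest.\<close>
    have le: "?bound \<le> H * width r"
    proof -
      have "?bound = (2 * H + 3 * N) * width r / 3" using G by (simp add: field_simps)
      also have "\<dots> \<le> (3 * H) * width r / 3"
        using N by (intro divide_right_mono, simp_all only: of_nat_le_iff of_nat_mult[symmetric]) (intro mult_le_mono1, simp_all)
      finally show ?thesis by simp
    qed
    have "?bound < L.pool_regret i (\<beta> * (G * H)) [] xs" if len: "length xs = length ks" and F: "F x xs" for xs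
    proof -
      have out: "out (ov x xs) l r = out x l r"
        by (intro ext out_dep) (auto simp: ov_def ks_def key_def)
      have "map_of (zip ks xs) (ks ! j) = Some (xs ! j)" if "j < G * H" for j
        using that len dist by (intro map_of_zip_nth) (auto simp: ks_def)
      then have "ov x xs r ((\<beta> * (G * H) + j) * blen r) = xs ! j" if "j < G * H" for j
        using that by (auto simp: ov_def ks_def key_def)
      then have draws: "map (\<lambda>j. ov x xs r ((\<beta> * (G * H) + j) * blen r)) [0..<G * H] = xs"
        using len by (intro nth_equalityI) (auto simp: ks_def)
      have "\<not> block_ok i l (Suc r) (ov x xs) \<beta> (width (Suc r))" using F by (simp add: F_def)
      then have "real ((\<Sum>t<blen (Suc r). l (\<beta> * blen (Suc r) + t) i) + width (Suc r)) <
          real (\<Sum>t<blen (Suc r). out (ov x xs) l (Suc r) (\<beta> * blen (Suc r) + t))"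
        unfolding block_ok_def of_nat_less_iff by simp
      then have "width (Suc r) < (\<Sum>t<blen (Suc r). real (out (ov x xs) l (Suc r) (\<beta> * blen (Suc r) + t)) -
          real (l (\<beta> * blen (Suc r) + t) i))"
        by (simp add: sum_subtractf)
      also have "\<dots> = L.pool_regret i (\<beta> * (G * H)) [] xs"
        using block_regret[of l "ov x xs" r \<beta> i, OF l_le] by (simp only: out draws)
      finally show ?thesis using le unfolding width_Suc of_nat_mult by (rule le_less_trans[rotated])
    qed
    then have "avg (2 ^ m) (length ks) (\<lambda>xs. of_bool (F x xs)) \<le>
        avg (2 ^ m) (length ks) (\<lambda>xs. of_bool (?bound < L.pool_regret i (\<beta> * (G * H)) [] xs))"
      by (intro avg_mono) simp
    also have "\<dots> = avg (2 ^ m) (G * H) (\<lambda>xs. of_bool (?bound < L.pool_regret i (\<beta> * (G * H)) [] xs))"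
      by (simp add: ks_def)
    also have "\<dots> \<le> (1 - 1 / (2 * n)) ^ N"
    proof (rule L.avg_pool_regret[OF _ _ _ L.pool_inv_Nil])
      show "1 / (2 * n) * real (2 ^ m) \<le> card {x. x < 2 ^ m \<and> x mod n = i}"
        using card_residue_ge[OF i m] by simp
      show "1 / (2 * n) \<le> (1 :: real)" using n by simp
      fix \<sigma> assume \<sigma>: "\<beta> * (G * H) \<le> \<sigma>" "\<sigma> < \<beta> * (G * H) + G * H"
      then have "\<sigma> - \<beta> * (G * H) < G * H" by linarith
      then have "block_ok i l r x (\<beta> * (G * H) + (\<sigma> - \<beta> * (G * H))) (width r)"
        using True by blast
      then show "L.cum \<sigma> (blen r) \<le> L.lcum \<sigma> (blen r) i + width r"
        using \<sigma> by (simp add: block_ok_def L.cum_def L.lcum_def)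
    qed auto
    finally show ?thesis .
  qed
  have "ov (draw m \<omega>) (draws m \<omega> ks) = draw m \<omega>" for \<omega>
    by (intro ext) (auto simp: ov_def map_of_zip_map)
  then have E: "E = {\<omega>. F (draw m \<omega>) (draws m \<omega> ks)}"
    unfolding E_def F_def by simp
  have "finite A" "A \<inter> set ks = {}" by (auto simp: A_def)
  note cond = prob_conditional_draws_le[where G = F, OF dist this]
  show "E \<in> sets coins" unfolding E by (rule cond(1)[OF F_dep bound])
  show "measure coins E \<le> (1 - 1 / (2 * n)) ^ N" unfolding E by (rule cond(2)[OF F_dep bound])
qed

text \<open>If no level fails on its own, the bound propagates from the bottom level to level
  \<open>R\<close>. A union bound over levels and blocks gives the probability.\<close>

theorem prob_block_ok:
  assumes l_le: "\<And>t e. l t e \<le> S" and i: "i < n" and m: "n \<le> 2 ^ m"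
    and zero: "\<And>t e. T \<le> t \<Longrightarrow> l t e = 0"
  obtains U where "U \<in> sets coins" "measure coins U \<le> R * T * (1 - 1 / (2 * n)) ^ N"
    and "\<And>\<omega>. \<omega> \<notin> U \<Longrightarrow> block_ok i l R (draw m \<omega>) 0 (width R)"
proof -
  interpret prob_space coins by (rule prob_space_coins)
  define E where "E r \<beta> = {\<omega>. (\<forall>j<G * H. block_ok i l r (draw m \<omega>) (\<beta> * (G * H) + j) (width r)) \<and>
    \<not> block_ok i l (Suc r) (draw m \<omega>) \<beta> (width (Suc r))}" for r \<beta>
  note E = prob_block_fails[of l i _ _, OF l_le i m, folded E_def]
  \<comment> \<open>Block numbers below \<open>T\<close> suffice, since every block has at least one
    day.\<close>
  define U where "U = (\<Union>r<R. \<Union>\<beta><T. E r \<beta>)"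
  have ok: "block_ok i l r (draw m \<omega>) \<beta> (width r)" if "\<omega> \<notin> U" "r \<le> R" for r \<beta> \<omega>
    using that(2)
  proof (induction r arbitrary: \<beta>)
    case 0
    have "(\<Sum>t<blen 0. out (draw m \<omega>) l 0 (\<beta> * blen 0 + t)) \<le> (\<Sum>t<blen 0. S)"
      by (intro sum_mono out_le l_le)
    then show ?case by (simp add: block_ok_def width_def blen_def mult.commute trans_le_add2)
  next
    case (Suc r)
    show ?case
    proof (cases "\<beta> < T")
      case True
      then have "\<omega> \<notin> E r \<beta>" using that(1) Suc.prems by (auto simp: U_def)
      then show ?thesis using Suc by (auto simp: E_def)
    next
      \<comment> \<open>The block lies behind the horizon, where all losses and hence all outputs
        are 0.\<close>
      case False
      have "T \<le> \<beta> * blen (Suc r) + t" for t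
        using False blen_pos[of "Suc r"] by (metis mult_le_mono not_less Suc_leI One_nat_def mult.right_neutral trans_le_add1)
      then show ?thesis by (simp add: block_ok_def out_zero zero)
    qed
  qed
  have U: "U \<in> events" unfolding U_def using E(1) by auto
  have "measure coins U \<le> (\<Sum>r<R. measure coins (\<Union>\<beta><T. E r \<beta>))"
    unfolding U_def using E(1) by (intro finite_measure_subadditive_finite) auto
  also have "\<dots> \<le> (\<Sum>r<R. \<Sum>\<beta><T. measure coins (E r \<beta>))"
    using E(1) by (intro sum_mono finite_measure_subadditive_finite) auto
  also have "\<dots> \<le> (\<Sum>r<R. \<Sum>\<beta><T. (1 - 1 / (2 * n)) ^ N)"
    by (intro sum_mono E(2))
  also have "\<dots> = R * T * (1 - 1 / (2 * n)) ^ N" by simp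
  finally show ?thesis using that[OF U] ok by blast
qed

end

section \<open>Playing an expert\<close>

lemma exp_le_quadratic:
  fixes y :: real
  assumes "\<bar>y\<bar> \<le> 1"
  shows "exp y \<le> 1 + y + y\<^sup>2"
proof (cases "0 \<le> y")
  case True
  then show ?thesis using assms by (intro exp_bound) auto
next
  case False
  define x where "x = - y"
  have x: "0 \<le> x" using False by (simp add: x_def)
  have "0 \<le> (x - 1 / 2)\<^sup>2" by simp
  then have pos: "0 < 1 - x + x\<^sup>2" by (simp add: power2_eq_square algebra_simps)
  have "(1 + x + x\<^sup>2 / 2) * (1 - x + x\<^sup>2) = 1 + (x ^ 2 + x ^ 3 + x ^ 4) / 2"
    by (simp add: field_simps power2_eq_square power3_eq_cube power4_eq_xxxx)
  then have "1 \<le> (1 + x + x\<^sup>2 / 2) * (1 - x + x\<^sup>2)"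
    using x by simp
  also have "\<dots> \<le> exp x * (1 - x + x\<^sup>2)"
    using exp_lower_Taylor_quadratic[OF x] pos by (intro mult_right_mono) auto
  finally have "exp (- x) \<le> 1 - x + x\<^sup>2"
    by (simp add: exp_minus field_simps)
  then show ?thesis by (simp add: x_def)
qed

lemma exp_moment_le:
  fixes f :: "nat \<Rightarrow> real"
  assumes Q: "0 < Q" and \<theta>: "0 \<le> \<theta>" "\<theta> \<le> 1" and f: "\<And>x. f x \<in> {0..1}" and \<mu>: "(\<Sum>x<Q. f x) / Q \<le> \<mu>"
  shows "(\<Sum>x<Q. exp (\<theta> * (f x - \<mu>))) / Q \<le> exp (\<theta>\<^sup>2)"
proof -
  define \<nu> where "\<nu> = (\<Sum>x<Q. f x) / Q"
  have "0 \<le> \<nu>" using f by (auto simp: \<nu>_def intro!: divide_nonneg_nonneg sum_nonneg)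
  moreover have "(\<Sum>x<Q. f x) \<le> (\<Sum>x<Q. 1)" using f by (intro sum_mono) auto
  then have "\<nu> \<le> 1" using Q by (simp add: \<nu>_def divide_le_eq)
  ultimately have abs: "\<bar>f x - \<nu>\<bar> \<le> 1" for x using f[of x] by auto
  have "exp (\<theta> * (f x - \<mu>)) \<le> 1 + \<theta> * (f x - \<nu>) + \<theta>\<^sup>2" for x
  proof -
    have "exp (\<theta> * (f x - \<mu>)) \<le> exp (\<theta> * (f x - \<nu>))"
      using \<mu> \<theta> by (auto intro!: mult_left_mono simp: \<nu>_def)
    also have "\<dots> \<le> 1 + \<theta> * (f x - \<nu>) + (\<theta> * (f x - \<nu>))\<^sup>2"
      using abs[of x] \<theta> by (intro exp_le_quadratic) (simp add: abs_mult mult_le_one)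
    also have "(\<theta> * (f x - \<nu>))\<^sup>2 \<le> \<theta>\<^sup>2 * 1"
      unfolding power_mult_distrib using abs[of x] by (intro mult_left_mono) (auto simp: abs_square_le_1)
    finally show ?thesis by simp
  qed
  then have "(\<Sum>x<Q. exp (\<theta> * (f x - \<mu>))) \<le> (\<Sum>x<Q. 1 + \<theta> * (f x - \<nu>) + \<theta>\<^sup>2)"
    by (rule sum_mono)
  also have "\<dots> = Q * (1 + \<theta>\<^sup>2)"
    using Q by (simp add: sum.distrib sum_distrib_left[symmetric] sum_subtractf \<nu>_def algebra_simps)
  finally have "(\<Sum>x<Q. exp (\<theta> * (f x - \<mu>))) / Q \<le> 1 + \<theta>\<^sup>2"
    using Q by (simp add: divide_le_eq mult.commute)
  also have "\<dots> \<le> exp (\<theta>\<^sup>2)" by (rule exp_ge_add_one_self)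
  finally show ?thesis .
qed

lemma avg_concentration:
  fixes f :: "nat \<Rightarrow> nat \<Rightarrow> real"
  assumes Q: "0 < Q" and \<theta>: "0 \<le> \<theta>" "\<theta> \<le> 1" and f: "\<And>t x. f t x \<in> {0..1}"
    and \<mu>: "\<And>t. (\<Sum>x<Q. f t x) / Q \<le> \<mu> t"
  shows "avg Q k (\<lambda>xs. of_bool (\<Delta> < (\<Sum>t<k. f t (xs ! t) - \<mu> t))) \<le> exp (\<theta>\<^sup>2 * k - \<theta> * \<Delta>)"
proof -
  have "avg Q k (\<lambda>xs. exp (\<theta> * (\<Sum>t<k. f t (xs ! t) - \<mu> t))) \<le> exp (\<theta>\<^sup>2 * k)"
    using f \<mu>
  proof (induction k arbitrary: f \<mu>)
    case (Suc k)
    have IH: "avg Q k (\<lambda>xs. exp (\<theta> * (\<Sum>t<k. f (Suc t) (xs ! t) - \<mu> (Suc t)))) \<le> exp (\<theta>\<^sup>2 * k)"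
      using Suc.prems by (intro Suc.IH)
    have "avg Q (Suc k) (\<lambda>xs. exp (\<theta> * (\<Sum>t<Suc k. f t (xs ! t) - \<mu> t))) =
      (\<Sum>x<Q. exp (\<theta> * (f 0 x - \<mu> 0)) * avg Q k (\<lambda>xs. exp (\<theta> * (\<Sum>t<k. f (Suc t) (xs ! t) - \<mu> (Suc t))))) / Q"
      by (simp add: sum.lessThan_Suc_shift distrib_left exp_add avg_cmult del: sum.lessThan_Suc)
    also have "\<dots> \<le> (\<Sum>x<Q. exp (\<theta> * (f 0 x - \<mu> 0)) * exp (\<theta>\<^sup>2 * k)) / Q"
      by (intro divide_right_mono sum_mono mult_left_mono IH) auto
    also have "\<dots> = (\<Sum>x<Q. exp (\<theta> * (f 0 x - \<mu> 0))) / Q * exp (\<theta>\<^sup>2 * k)"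
      by (simp add: sum_distrib_right)
    also have "\<dots> \<le> exp (\<theta>\<^sup>2) * exp (\<theta>\<^sup>2 * k)"
      using Suc.prems by (intro mult_right_mono exp_moment_le Q \<theta>) auto
    finally show ?case by (simp add: exp_add[symmetric] algebra_simps)
  qed simp
  moreover have "avg Q k (\<lambda>xs. of_bool (\<Delta> < (\<Sum>t<k. f t (xs ! t) - \<mu> t))) \<le>
      avg Q k (\<lambda>xs. exp (- \<theta> * \<Delta>) * exp (\<theta> * (\<Sum>t<k. f t (xs ! t) - \<mu> t)))"
  proof (rule avg_mono)
    fix xs
    show "of_bool (\<Delta> < (\<Sum>t<k. f t (xs ! t) - \<mu> t)) \<le> exp (- \<theta> * \<Delta>) * exp (\<theta> * (\<Sum>t<k. f t (xs ! t) - \<mu> t))"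
    proof (cases "\<Delta> < (\<Sum>t<k. f t (xs ! t) - \<mu> t)")
      case True
      then have "\<theta> * \<Delta> \<le> \<theta> * (\<Sum>t<k. f t (xs ! t) - \<mu> t)" using \<theta> by (intro mult_left_mono) auto
      then show ?thesis by (simp add: exp_add[symmetric])
    qed simp
  qed
  moreover have "avg Q k (\<lambda>xs. exp (- \<theta> * \<Delta>) * exp (\<theta> * (\<Sum>t<k. f t (xs ! t) - \<mu> t))) =
      exp (- \<theta> * \<Delta>) * avg Q k (\<lambda>xs. exp (\<theta> * (\<Sum>t<k. f t (xs ! t) - \<mu> t)))"
    by (rule avg_cmult)
  ultimately have "avg Q k (\<lambda>xs. of_bool (\<Delta> < (\<Sum>t<k. f t (xs ! t) - \<mu> t))) \<le> exp (- \<theta> * \<Delta>) * exp (\<theta>\<^sup>2 * k)"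
    by (smt (verit) mult_left_mono exp_ge_zero)
  then show ?thesis by (simp add: exp_add[symmetric] algebra_simps)
qed

text \<open>Rounds a distribution to multiples of \<open>1 / Q\<close>, in order to sample from it by a uniform \<open>x < Q\<close>.\<close>

definition pick :: "nat \<Rightarrow> (nat \<times> real) list \<Rightarrow> nat \<Rightarrow> nat" where
  "pick Q ps x = (let es = concat (map (\<lambda>(e, p). replicate (nat \<lfloor>Q * p\<rfloor>) e) ps)
     in if x < length es then es ! x else 0)"

lemma pick_mem: "pick Q ps x \<in> insert 0 (fst ` set ps)"
proof -
  let ?es = "concat (map (\<lambda>(e, p). replicate (nat \<lfloor>Q * p\<rfloor>) e) ps)"
  have "set ?es \<subseteq> fst ` set ps" by force
  then show ?thesis using nth_mem[of x ?es] unfolding pick_def Let_def by auto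
qed

text \<open>Rounding down loses less than one of the \<open>Q\<close> outcomes per list element.
  These outcomes fall to expert 0, each at a loss of at most \<open>S\<close>.\<close>

lemma sum_pick_le:
  fixes ps :: "(nat \<times> real) list"
  assumes p: "\<And>e p. (e, p) \<in> set ps \<Longrightarrow> 0 \<le> p" "(\<Sum>(e, p)\<leftarrow>ps. p) = 1" and l: "\<And>e. l e \<le> S"
  shows "(\<Sum>x<Q. real (l (pick Q ps x))) \<le> Q * (\<Sum>(e, p)\<leftarrow>ps. p * l e) + length ps * S"
proof -
  define es where "es = concat (map (\<lambda>(e, p). replicate (nat \<lfloor>Q * p\<rfloor>) e) ps)"
  have len: "real (length es) \<le> Q" "real Q \<le> length es + length ps"
    and sum: "(\<Sum>e\<leftarrow>es. real (l e)) \<le> Q * (\<Sum>(e, p)\<leftarrow>ps. p * l e)"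
  proof -
    have "real (length es) \<le> Q * (\<Sum>(e, p)\<leftarrow>ps. p) \<and> Q * (\<Sum>(e, p)\<leftarrow>ps. p) \<le> length es + length ps \<and>
      (\<Sum>e\<leftarrow>es. real (l e)) \<le> Q * (\<Sum>(e, p)\<leftarrow>ps. p * l e)"
      unfolding es_def using p(1)
    proof (induction ps)
      case (Cons a ps)
      obtain e p where a: "a = (e, p)" by (cases a)
      define k where "k = nat \<lfloor>Q * p\<rfloor>"
      have "0 \<le> p" using Cons.prems a by auto
      then have "0 \<le> Q * p" by simp
      then have f: "real k \<le> Q * p" "Q * p \<le> real k + 1"
        unfolding k_def by linarith+
      then have "real k * l e \<le> Q * p * l e" by (intro mult_right_mono) auto
      moreover have IH: "real (length (concat (map (\<lambda>(e, p). replicate (nat \<lfloor>Q * p\<rfloor>) e) ps))) \<le> Q * (\<Sum>(e, p)\<leftarrow>ps. p) \<and>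
          Q * (\<Sum>(e, p)\<leftarrow>ps. p) \<le> length (concat (map (\<lambda>(e, p). replicate (nat \<lfloor>Q * p\<rfloor>) e) ps)) + length ps \<and>
          (\<Sum>e\<leftarrow>concat (map (\<lambda>(e, p). replicate (nat \<lfloor>Q * p\<rfloor>) e) ps). real (l e)) \<le> Q * (\<Sum>(e, p)\<leftarrow>ps. p * l e)"
        using Cons.prems by (intro Cons.IH) auto
      ultimately show ?case
        using f by (auto simp: a k_def[symmetric] sum_list_replicate distrib_left mult.assoc)
    qed simp
    then show "real (length es) \<le> Q" "real Q \<le> length es + length ps"
      "(\<Sum>e\<leftarrow>es. real (l e)) \<le> Q * (\<Sum>(e, p)\<leftarrow>ps. p * l e)"
      by (simp_all add: p(2))
  qed
  have "(\<Sum>x<Q. real (l (pick Q ps x))) = (\<Sum>x<length es. real (l (pick Q ps x))) + (\<Sum>x=length es..<Q. real (l (pick Q ps x)))"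
    using len(1) sum.atLeastLessThan_concat[of 0 "length es" Q "\<lambda>x. real (l (pick Q ps x))"]
    by (simp add: lessThan_atLeast0)
  also have "(\<Sum>x<length es. real (l (pick Q ps x))) = (\<Sum>e\<leftarrow>es. real (l e))"
    by (simp add: pick_def es_def[symmetric] sum_list_sum_nth lessThan_atLeast0)
  also have "(\<Sum>x=length es..<Q. real (l (pick Q ps x))) \<le> (\<Sum>x=length es..<Q. real S)"
    using l by (intro sum_mono) auto
  also have "\<dots> \<le> length ps * S"
    using len by (simp add: of_nat_diff mult_right_mono)
  finally show ?thesis using sum by simp
qed

section \<open>Flattening the hierarchy into one distribution over experts\<close>

context pool_params
begin

definition weight :: "nat \<Rightarrow> nat \<Rightarrow> real" where
  "weight r z = exp (- rate r * (real z / real S))"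

definition total_weight :: "nat \<Rightarrow> level \<Rightarrow> real" where
  "total_weight r = (\<lambda>(c, P). weight r c + (\<Sum>(e, s, z, g)\<leftarrow>P. weight r z))"

text \<open>The levels work with mean losses only, so nobody is followed inside the hierarchy.
  Unfolding the nested mixtures yields the distribution over experts that realises the mean of the
  top level.\<close>

primrec plays :: "(nat \<Rightarrow> level) \<Rightarrow> nat \<Rightarrow> (nat \<times> real) list" where
  "plays lv 0 = [(0, 1)]"
| "plays lv (Suc r) =
     map (\<lambda>(e, p). (e, weight r (fst (lv r)) / total_weight r (lv r) * p)) (plays lv r) @
     map (\<lambda>(e, s, z, g). (e, weight r z / total_weight r (lv r))) (snd (lv r))"

definition played :: "(nat \<Rightarrow> nat \<Rightarrow> nat) \<Rightarrow> (nat \<Rightarrow> nat \<Rightarrow> nat) \<Rightarrow> nat \<Rightarrow> nat" where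
  "played x l t = pick (2 ^ m) (plays (lev x l t) R) (x R t)"

lemma total_weight_pos: "0 < total_weight r lv"
proof -
  have "0 \<le> (\<Sum>(e, s, z, g)\<leftarrow>P. weight r z)" for P :: "entry list"
    by (intro sum_list_nonneg) (auto simp: weight_def)
  then show ?thesis by (cases lv) (auto simp: total_weight_def weight_def intro: add_pos_nonneg)
qed

lemma plays_cong: "(\<And>r'. r' < r \<Longrightarrow> lv r' = lv' r') \<Longrightarrow> plays lv r = plays lv' r"
  by (induction r) auto

lemma plays_experts: "fst ` set (plays lv r) = insert 0 (\<Union>r'<r. fst ` set (snd (lv r')))"
proof (induction r)
  case (Suc r)
  have "fst ` set (plays lv (Suc r)) = fst ` set (plays lv r) \<union> fst ` set (snd (lv r))"
    by (auto simp: image_Un image_image case_prod_unfold)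
  then show ?case using Suc by (auto simp: lessThan_Suc)
qed simp

lemma length_plays: "(\<And>r'. r' < r \<Longrightarrow> length (snd (lv r')) \<le> k) \<Longrightarrow> length (plays lv r) \<le> 1 + r * k"
proof (induction r)
  case (Suc r)
  then have "length (plays lv r) \<le> 1 + r * k" "length (snd (lv r)) \<le> k" by auto
  then show ?case by simp
qed simp

lemma plays_nonneg: "(e, p) \<in> set (plays lv r) \<Longrightarrow> 0 \<le> p"
proof (induction r arbitrary: p)
  case (Suc r)
  then show ?case
    using less_imp_le[OF total_weight_pos[of r "lv r"]] by (auto simp: weight_def)
qed simp

lemma plays_Suc_sum:
  fixes f :: "nat \<Rightarrow> real"
  assumes "lv r = (c, P)"
  shows "(\<Sum>(e, p)\<leftarrow>plays lv (Suc r). p * f e) =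
    weight r c / total_weight r (c, P) * (\<Sum>(e, p)\<leftarrow>plays lv r. p * f e) +
    (\<Sum>(e, s, z, g)\<leftarrow>P. weight r z * f e) / total_weight r (c, P)"
proof -
  have "(\<Sum>(e, p)\<leftarrow>map (\<lambda>(e, p). (e, k * p)) ps. p * f e) = k * (\<Sum>(e, p)\<leftarrow>ps. p * f e)" for k ps
    by (induction ps) (auto simp: distrib_left)
  moreover have "(\<Sum>(e, p)\<leftarrow>map (\<lambda>(e, s, z, g). (e, weight r z / W)) Q. p * f e) =
      (\<Sum>(e, s, z, g)\<leftarrow>Q. weight r z * f e) / W" for W and Q :: "entry list"
    by (induction Q) (auto simp: add_divide_distrib)
  ultimately show ?thesis
    by (simp only: plays.simps assms fst_conv snd_conv map_append sum_list_append)
qed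

lemma plays_sum: "(\<Sum>(e, p)\<leftarrow>plays lv r. p) = 1"
proof (induction r)
  case (Suc r)
  obtain c P where lv: "lv r = (c, P)" by (cases "lv r")
  have "(\<Sum>(e, p)\<leftarrow>plays lv (Suc r). p) =
      weight r c / total_weight r (c, P) * (\<Sum>(e, p)\<leftarrow>plays lv r. p) +
      (\<Sum>(e, s, z, g)\<leftarrow>P. weight r z) / total_weight r (c, P)"
    using plays_Suc_sum[of lv r, OF lv, of "\<lambda>_. 1"] by simp
  also have "\<dots> = total_weight r (c, P) / total_weight r (c, P)"
    by (simp only: Suc mult_1_right total_weight_def add_divide_distrib prod.case)
  finally show ?case using total_weight_pos[of r "(c, P)"] by simp
qed simp

text \<open>The two sides differ only by the rounding in \<open>level_out\<close>, at most 1 for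
  each of the \<open>r\<close> levels.\<close>

lemma plays_loss: "(\<Sum>(e, p)\<leftarrow>plays lv r. p * l e) \<le> real (outs lv l r) + r"
proof (induction r)
  case (Suc r)
  obtain c P where lv: "lv r = (c, P)" by (cases "lv r")
  let ?W = "total_weight r (c, P)"
  let ?mix = "hedge_mix (rate r) S ((c, outs lv l r) # map (\<lambda>(e, s, z, g). (z, l e)) P)"
  have W: "0 < ?W" by (rule total_weight_pos)
  have P_nonneg: "0 \<le> (\<Sum>(e, s, z, g)\<leftarrow>P. weight r z)"
    by (intro sum_list_nonneg) (auto simp: weight_def)
  have "(\<Sum>(e, p)\<leftarrow>plays lv (Suc r). p * l e) =
      weight r c / ?W * (\<Sum>(e, p)\<leftarrow>plays lv r. p * l e) + (\<Sum>(e, s, z, g)\<leftarrow>P. weight r z * l e) / ?W"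
    by (rule plays_Suc_sum[of lv r, OF lv])
  also have "\<dots> \<le> weight r c / ?W * (real (outs lv l r) + r) + (\<Sum>(e, s, z, g)\<leftarrow>P. weight r z * l e) / ?W"
    using Suc W by (intro add_right_mono mult_left_mono) (auto simp: weight_def)
  also have "\<dots> = ?mix + weight r c / ?W * r"
    by (simp add: hedge_mix_def total_weight_def weight_def comp_def case_prod_unfold add_divide_distrib distrib_left)
  also have "weight r c / ?W * r \<le> 1 * real r"
    using W P_nonneg by (intro mult_right_mono) (auto simp: total_weight_def)
  also have "?mix \<le> real (outs lv l (Suc r)) + 1"
    by (simp add: lv level_out_def) linarith
  finally show ?case by simp
qed simp

end

section \<open>Concentration of the actual loss\<close>

context pool_hierarchy
begin

text \<open>The keys \<open>(R, t)\<close> are used by no pool below \<open>R\<close>. Conditioned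
  on the pools, the experts played are therefore independent over the days, with mean losses bounded
  by the subtracted terms.\<close>

lemma prob_played_deviation:
  fixes T :: nat and \<Delta> \<theta> :: real
  assumes l_le: "\<And>t e. l t e \<le> S" and \<theta>: "0 \<le> \<theta>" "\<theta> \<le> 1"
  defines "E \<equiv> {\<omega>. \<Delta> < (\<Sum>t<T. real (l t (played (draw m \<omega>) l t)) / S -
      ((out (draw m \<omega>) l R t + real R) / S + (1 + real R * M) / 2 ^ m))}"
  shows "E \<in> sets coins" "measure coins E \<le> exp (\<theta>\<^sup>2 * T - \<theta> * \<Delta>)"
proof -
  define ks where "ks = map (\<lambda>t. (R, t)) [0..<T]"
  define A where "A = {..<R} \<times> {..<T}"
  define f where "f x t v = real (l t (pick (2 ^ m) (plays (lev x l t) R) v)) / S" for x t v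
  define \<mu> where "\<mu> x t = (out x l R t + real R) / S + (1 + real R * M) / 2 ^ m" for x t
  define F where "F x xs \<longleftrightarrow> \<Delta> < (\<Sum>t<T. f x t (xs ! t) - \<mu> x t)" for x xs
  have dist: "distinct ks" by (simp add: ks_def distinct_map inj_on_def)
  have A: "finite A" "A \<inter> set ks = {}" by (auto simp: A_def ks_def)
  have F_dep: "F x xs = F y xs" if xy: "\<And>r t. (r, t) \<in> A \<Longrightarrow> x r t = y r t" for x y xs
  proof -
    have "f x t v - \<mu> x t = f y t v - \<mu> y t" if "t < T" for t v
    proof -
      have "plays (lev x l t) R = plays (lev y l t) R"
        using that by (intro plays_cong lev_dep xy) (auto simp: A_def)
      moreover have "out x l R t = out y l R t"
        using that by (intro out_dep xy) (auto simp: A_def)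
      ultimately show ?thesis by (simp add: f_def \<mu>_def)
    qed
    then show ?thesis by (simp add: F_def)
  qed
  have bound: "avg (2 ^ m) (length ks) (\<lambda>xs. of_bool (F x xs)) \<le> exp (\<theta>\<^sup>2 * T - \<theta> * \<Delta>)" for x
  proof -
    have "(\<Sum>v<2 ^ m. f x t v) / real (2 ^ m) \<le> \<mu> x t" for t
    proof -
      let ?ps = "plays (lev x l t) R"
      have "(\<Sum>v<2 ^ m. real (l t (pick (2 ^ m) ?ps v))) \<le> real (2 ^ m) * (\<Sum>(e, p)\<leftarrow>?ps. p * l t e) + length ?ps * S"
        by (intro sum_pick_le plays_sum l_le) (rule plays_nonneg)
      also have "\<dots> \<le> real (2 ^ m) * (real (out x l R t) + R) + (1 + real R * M) * S"
      proof -
        have "length ?ps \<le> 1 + R * M" by (rule length_plays) (rule lev_length[OF l_le])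
        then have "real (length ?ps) \<le> real (1 + R * M)" by (simp only: of_nat_le_iff)
        then have "real (length ?ps * S) \<le> (1 + real R * M) * S"
          unfolding of_nat_mult by (intro mult_right_mono) simp_all
        moreover have "real (2 ^ m) * (\<Sum>(e, p)\<leftarrow>?ps. p * l t e) \<le> real (2 ^ m) * (real (out x l R t) + R)"
          unfolding out_def by (intro mult_left_mono plays_loss) simp
        ultimately show ?thesis by linarith
      qed
      finally have "(\<Sum>v<2 ^ m. real (l t (pick (2 ^ m) ?ps v))) / S / 2 ^ m \<le>
          (2 ^ m * (real (out x l R t) + R) + (1 + real R * M) * S) / S / 2 ^ m"
        by (intro divide_right_mono) auto
      also have "\<dots> = \<mu> x t" using S by (simp add: \<mu>_def field_simps)
      finally show ?thesis by (simp add: f_def sum_divide_distrib[symmetric])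
    qed
    moreover have "f x t v \<in> {0..1}" for t v using l_le S by (simp add: f_def)
    ultimately show ?thesis
      using avg_concentration[of "2 ^ m" \<theta> "f x" "\<mu> x" T \<Delta>, OF _ \<theta>] by (simp only: ks_def F_def) simp
  qed
  have "(\<Sum>t<T. f x t (draws m \<omega> ks ! t) - \<mu> x t) = (\<Sum>t<T. f x t (draw m \<omega> R t) - \<mu> x t)" for x \<omega>
    by (intro sum.cong) (auto simp: ks_def)
  then have E: "E = {\<omega>. F (draw m \<omega>) (draws m \<omega> ks)}"
    unfolding E_def F_def by (simp add: f_def \<mu>_def played_def)
  note cond = prob_conditional_draws_le[where G = F, OF dist A]
  show "E \<in> sets coins" unfolding E by (rule cond(1)[OF F_dep bound])
  show "measure coins E \<le> exp (\<theta>\<^sup>2 * T - \<theta> * \<Delta>)" unfolding E by (rule cond(2)[OF F_dep bound])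
qed

text \<open>As the losses vanish from day \<open>T\<close> on, the run can be prolonged to exactly
  one block of length \<open>blen R\<close>, to which \<open>block_ok\<close> applies.\<close>

theorem played_regret:
  fixes \<theta> \<Delta> :: real
  assumes l_le: "\<And>t e. l t e \<le> S" and i: "i < n" and m: "n \<le> 2 ^ m" and \<theta>: "0 \<le> \<theta>" "\<theta> \<le> 1"
    and zero: "\<And>t e. T \<le> t \<Longrightarrow> l t e = 0" and T: "T \<le> blen R"
  obtains U where "U \<in> sets coins"
    and "measure coins U \<le> R * T * (1 - 1 / (2 * n)) ^ N + exp (\<theta>\<^sup>2 * T - \<theta> * \<Delta>)"
    and "\<And>\<omega>. \<omega> \<notin> U \<Longrightarrow> (\<Sum>t<T. real (l t (played (draw m \<omega>) l t)) / S) \<le> (\<Sum>t<T. real (l t i) / S) +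
      width R / S + T * (real R / S + (1 + real R * M) / 2 ^ m) + \<Delta>"
proof -
  interpret prob_space coins by (rule prob_space_coins)
  obtain U where U: "U \<in> events" "prob U \<le> R * T * (1 - 1 / (2 * n)) ^ N"
    "\<And>\<omega>. \<omega> \<notin> U \<Longrightarrow> block_ok i l R (draw m \<omega>) 0 (width R)"
    by (rule prob_block_ok[of l i T, OF l_le i m]) (erule zero, rule that)
  define E where "E = {\<omega>. \<Delta> < (\<Sum>t<T. real (l t (played (draw m \<omega>) l t)) / S -
      ((out (draw m \<omega>) l R t + real R) / S + (1 + real R * M) / 2 ^ m))}"
  note E = prob_played_deviation[of l \<theta> \<Delta> T, OF l_le \<theta>, folded E_def]
  show thesis
  proof (rule that)
    show "U \<union> E \<in> events" using U E by blast
    show "prob (U \<union> E) \<le> R * T * (1 - 1 / (2 * n)) ^ N + exp (\<theta>\<^sup>2 * T - \<theta> * \<Delta>)"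
      using measure_Un_le[OF U(1) E(1)] U(2) E(2) by linarith
    fix \<omega> assume \<omega>: "\<omega> \<notin> U \<union> E"
    have "(\<Sum>t<T. out (draw m \<omega>) l R t) \<le> (\<Sum>t<blen R. out (draw m \<omega>) l R t)"
      using T by (intro sum_mono2) auto
    also have "\<dots> \<le> (\<Sum>t<blen R. l t i) + width R"
      using U(3)[of \<omega>] \<omega> by (simp add: block_ok_def)
    also have "(\<Sum>t<blen R. l t i) = (\<Sum>t<T. l t i)"
      using T zero by (intro sum.mono_neutral_right) auto
    finally have "real (\<Sum>t<T. out (draw m \<omega>) l R t) \<le> real ((\<Sum>t<T. l t i) + width R)"
      by (simp only: of_nat_le_iff)
    then have "(\<Sum>t<T. real (out (draw m \<omega>) l R t)) / S \<le> ((\<Sum>t<T. real (l t i)) + width R) / S"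
      by (intro divide_right_mono) auto
    moreover have "(\<Sum>t<T. real (l t (played (draw m \<omega>) l t)) / S) \<le>
        (\<Sum>t<T. (out (draw m \<omega>) l R t + real R) / S + (1 + real R * M) / 2 ^ m) + \<Delta>"
      using \<omega> by (simp add: E_def sum_subtractf)
    ultimately show "(\<Sum>t<T. real (l t (played (draw m \<omega>) l t)) / S) \<le> (\<Sum>t<T. real (l t i) / S) +
      width R / S + T * (real R / S + (1 + real R * M) / 2 ^ m) + \<Delta>"
      by (simp add: sum.distrib sum_divide_distrib[symmetric] add_divide_distrib distrib_left)
  qed
qed

end

section \<open>Measurability and independence of the environment\<close>

lemma measurable_day:
  assumes "t < T"
  shows "(\<lambda>z. fst (fst z) t) \<in> env_space P n T \<Otimes>\<^sub>M N \<rightarrow>\<^sub>M (\<Pi>\<^sub>M i\<in>{..<n}. P)"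
    and "(\<lambda>z. snd (fst z) t) \<in> env_space P n T \<Otimes>\<^sub>M N \<rightarrow>\<^sub>M (\<Pi>\<^sub>M i\<in>{..<n}. loss_space)"
proof -
  have t: "t \<in> {..<T}" using assms by simp
  show "(\<lambda>z. fst (fst z) t) \<in> env_space P n T \<Otimes>\<^sub>M N \<rightarrow>\<^sub>M (\<Pi>\<^sub>M i\<in>{..<n}. P)"
    unfolding env_space_def
    by (rule measurable_compose[OF measurable_compose[OF measurable_fst measurable_fst]
          measurable_component_singleton[OF t]])
  show "(\<lambda>z. snd (fst z) t) \<in> env_space P n T \<Otimes>\<^sub>M N \<rightarrow>\<^sub>M (\<Pi>\<^sub>M i\<in>{..<n}. loss_space)"
    unfolding env_space_def
    by (rule measurable_compose[OF measurable_compose[OF measurable_fst measurable_snd]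
          measurable_component_singleton[OF t]])
qed

lemma measurable_environment:
  assumes "t < T" "J \<subseteq> {..<n}"
  shows "(\<lambda>((p, l), \<omega>). restrict (p t) J) \<in> env_space P n T \<Otimes>\<^sub>M coins \<rightarrow>\<^sub>M (\<Pi>\<^sub>M i\<in>J. P)"
    and "(\<lambda>((p, l), \<omega>). restrict (l t) J) \<in> env_space P n T \<Otimes>\<^sub>M coins \<rightarrow>\<^sub>M (\<Pi>\<^sub>M i\<in>J. loss_space)"
proof -
  show "(\<lambda>((p, l), \<omega>). restrict (p t) J) \<in> env_space P n T \<Otimes>\<^sub>M coins \<rightarrow>\<^sub>M (\<Pi>\<^sub>M i\<in>J. P)"
    using measurable_compose[OF measurable_day(1)[OF assms(1)] measurable_restrict_subset[OF assms(2)]]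
    by (simp add: case_prod_unfold)
  show "(\<lambda>((p, l), \<omega>). restrict (l t) J) \<in> env_space P n T \<Otimes>\<^sub>M coins \<rightarrow>\<^sub>M (\<Pi>\<^sub>M i\<in>J. loss_space)"
    using measurable_compose[OF measurable_day(2)[OF assms(1)] measurable_restrict_subset[OF assms(2)]]
    by (simp add: case_prod_unfold)
qed

lemma measurable_loss:
  assumes "t < T" "i < n"
  shows "(\<lambda>((p, l), \<omega>). l t i) \<in> borel_measurable (env_space P n T \<Otimes>\<^sub>M coins)"
proof -
  have i: "i \<in> {..<n}" using assms(2) by simp
  have "(\<lambda>z. snd (fst z) t i) \<in> env_space P n T \<Otimes>\<^sub>M coins \<rightarrow>\<^sub>M loss_space"
    by (rule measurable_compose[OF measurable_day(2)[OF assms(1)] measurable_component_singleton[OF i]])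
  then show ?thesis
    unfolding loss_space_def measurable_restrict_space2_iff by (simp add: case_prod_unfold)
qed

lemma env_space_loss:
  assumes "(p, l) \<in> space (env_space P n T)" "t < T" "e < n"
  shows "l t e \<in> {0..1}"
  using assms
  by (auto simp: env_space_def loss_space_def space_pair_measure space_PiM space_restrict_space PiE_def Pi_def)

lemma obeys_query_modelD:
  assumes "obeys_query_model P n T A" "(p, l) \<in> space (env_space P n T)" "t < T"
  shows "observed (memory_at A \<omega> p l t) \<subseteq> {..<n}"
    and "followed A \<omega> p l t \<in> observed (memory_at A \<omega> p l t)"
  using assms unfolding obeys_query_model_def by blast+

text \<open>Memories form a countable type, so it suffices to treat each memory \<open>m\<close>
  separately; then the query set is a fixed set and \<open>measurable_alg\<close> applies.\<close>

lemma measurable_memory_at: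
  assumes alg: "measurable_alg P A" and query: "obeys_query_model P n T A" and "t \<le> T"
  shows "(\<lambda>((p, l), \<omega>). memory_at A \<omega> p l t) \<in> env_space P n T \<Otimes>\<^sub>M coins \<rightarrow>\<^sub>M count_space UNIV"
  using assms(3)
proof (induction t)
  case 0
  have "(\<lambda>z. start A (snd z)) \<in> env_space P n T \<Otimes>\<^sub>M coins \<rightarrow>\<^sub>M count_space UNIV"
    using alg unfolding measurable_alg_def by (intro measurable_compose[OF measurable_snd]) auto
  then show ?case by (simp add: case_prod_unfold)
next
  case (Suc t)
  then have IH: "(\<lambda>((p, l), \<omega>). memory_at A \<omega> p l t) \<in> env_space P n T \<Otimes>\<^sub>M coins \<rightarrow>\<^sub>M count_space UNIV" by simp
  \<comment> \<open>Restricting the environment is measurable only for query sets within the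
    experts. The guard makes every \<open>f m\<close> measurable, and by the query model it is
    satisfied along actual runs.\<close>
  define f where "f m = (\<lambda>((p, l), \<omega>). if observed m \<subseteq> {..<n}
      then update A \<omega> m (restrict (p t) (observed m)) (restrict (l t) (observed m)) else m)" for m
  have "f m \<in> env_space P n T \<Otimes>\<^sub>M coins \<rightarrow>\<^sub>M count_space UNIV" for m
  proof (cases "observed m \<subseteq> {..<n}")
    case True
    have "t < T" using Suc.prems by simp
    note env = measurable_environment[OF this True]
    have upd: "(\<lambda>(\<omega>, q, r). update A \<omega> m q r)
        \<in> coins \<Otimes>\<^sub>M (\<Pi>\<^sub>M i\<in>observed m. P) \<Otimes>\<^sub>M (\<Pi>\<^sub>M i\<in>observed m. loss_space) \<rightarrow>\<^sub>M count_space UNIV"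
      using alg unfolding measurable_alg_def by blast
    have "(\<lambda>z. (snd z, (\<lambda>((p, l), \<omega>). restrict (p t) (observed m)) z, (\<lambda>((p, l), \<omega>). restrict (l t) (observed m)) z))
        \<in> env_space P n T \<Otimes>\<^sub>M coins \<rightarrow>\<^sub>M coins \<Otimes>\<^sub>M (\<Pi>\<^sub>M i\<in>observed m. P) \<Otimes>\<^sub>M (\<Pi>\<^sub>M i\<in>observed m. loss_space)"
      by (intro measurable_Pair measurable_snd env)
    from measurable_compose[OF this upd] show ?thesis
      using True by (simp add: f_def case_prod_unfold)
  qed (simp add: f_def case_prod_unfold)
  from measurable_compose_countable[OF this IH]
  have "(\<lambda>z. f ((\<lambda>((p, l), \<omega>). memory_at A \<omega> p l t) z) z) \<in> env_space P n T \<Otimes>\<^sub>M coins \<rightarrow>\<^sub>M count_space UNIV" .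
  moreover have "f ((\<lambda>((p, l), \<omega>). memory_at A \<omega> p l t) z) z = (\<lambda>((p, l), \<omega>). memory_at A \<omega> p l (Suc t)) z"
    if "z \<in> space (env_space P n T \<Otimes>\<^sub>M coins)" for z
  proof -
    obtain p l \<omega> where z: "z = ((p, l), \<omega>)" by (metis surj_pair)
    then have "(p, l) \<in> space (env_space P n T)" using that by (simp add: space_pair_measure)
    then have "observed (memory_at A \<omega> p l t) \<subseteq> {..<n}"
      using obeys_query_modelD(1)[OF query] Suc.prems by simp
    then show ?thesis by (simp add: z f_def Let_def)
  qed
  ultimately show ?case by (subst measurable_cong[symmetric]) auto
qed

lemma measurable_followed_loss:
  assumes alg: "measurable_alg P A" and query: "obeys_query_model P n T A" and t: "t < T"
  shows "(\<lambda>((p, l), \<omega>). l t (followed A \<omega> p l t)) \<in> borel_measurable (env_space P n T \<Otimes>\<^sub>M coins)"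
proof -
  have mem: "(\<lambda>((p, l), \<omega>). memory_at A \<omega> p l t) \<in> env_space P n T \<Otimes>\<^sub>M coins \<rightarrow>\<^sub>M count_space UNIV"
    using t by (intro measurable_memory_at[OF alg query]) simp
  have obs: "observed (memory_at A \<omega> p l t) \<subseteq> {..<n}" "followed A \<omega> p l t \<in> observed (memory_at A \<omega> p l t)"
    if "((p, l), \<omega>) \<in> space (env_space P n T \<Otimes>\<^sub>M coins)" for p l \<omega>
    using obeys_query_modelD[OF query _ t] that by (simp_all add: space_pair_measure)
  define f where "f m = (\<lambda>((p, l :: nat \<Rightarrow> nat \<Rightarrow> real), \<omega>). if observed m \<subseteq> {..<n}
      then follow A \<omega> m (restrict (p t) (observed m)) else 0)" for m
  have "f m \<in> env_space P n T \<Otimes>\<^sub>M coins \<rightarrow>\<^sub>M count_space UNIV" for m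
  proof (cases "observed m \<subseteq> {..<n}")
    case True
    have fol: "(\<lambda>(\<omega>, q). follow A \<omega> m q) \<in> coins \<Otimes>\<^sub>M (\<Pi>\<^sub>M i\<in>observed m. P) \<rightarrow>\<^sub>M count_space UNIV"
      using alg unfolding measurable_alg_def by blast
    have "(\<lambda>z. (snd z, (\<lambda>((p, l), \<omega>). restrict (p t) (observed m)) z))
        \<in> env_space P n T \<Otimes>\<^sub>M coins \<rightarrow>\<^sub>M coins \<Otimes>\<^sub>M (\<Pi>\<^sub>M i\<in>observed m. P)"
      by (intro measurable_Pair measurable_snd measurable_environment(1)[OF t True])
    from measurable_compose[OF this fol] show ?thesis
      using True by (simp add: f_def case_prod_unfold)
  qed (simp add: f_def case_prod_unfold)
  from measurable_compose_countable[OF this mem]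
  have "(\<lambda>z. f ((\<lambda>((p, l), \<omega>). memory_at A \<omega> p l t) z) z) \<in> env_space P n T \<Otimes>\<^sub>M coins \<rightarrow>\<^sub>M count_space UNIV" .
  moreover have "f ((\<lambda>((p, l), \<omega>). memory_at A \<omega> p l t) z) z = (\<lambda>((p, l), \<omega>). followed A \<omega> p l t) z"
    if "z \<in> space (env_space P n T \<Otimes>\<^sub>M coins)" for z
    using obs(1) that by (auto simp: f_def followed_def Let_def split: prod.splits)
  ultimately have fol: "(\<lambda>((p, l), \<omega>). followed A \<omega> p l t) \<in> env_space P n T \<Otimes>\<^sub>M coins \<rightarrow>\<^sub>M count_space UNIV"
    by (subst measurable_cong[symmetric]) auto
  have "(\<lambda>((p, l), \<omega>). if i < n then l t i else 0) \<in> borel_measurable (env_space P n T \<Otimes>\<^sub>M coins)" for i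
    using measurable_loss[OF t, of i n P] by (cases "i < n") (simp_all add: case_prod_unfold)
  from measurable_compose_countable[OF this fol]
  have "(\<lambda>z. (\<lambda>((p, l), \<omega>). if (\<lambda>((p, l), \<omega>). followed A \<omega> p l t) z < n
      then l t ((\<lambda>((p, l), \<omega>). followed A \<omega> p l t) z) else 0) z) \<in> borel_measurable (env_space P n T \<Otimes>\<^sub>M coins)" .
  moreover have "(\<lambda>((p, l), \<omega>). if (\<lambda>((p, l), \<omega>). followed A \<omega> p l t) z < n
      then l t ((\<lambda>((p, l), \<omega>). followed A \<omega> p l t) z) else 0) z = (\<lambda>((p, l), \<omega>). l t (followed A \<omega> p l t)) z"
    if "z \<in> space (env_space P n T \<Otimes>\<^sub>M coins)" for z
    using obs that by (fastforce split: prod.splits)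
  ultimately show ?thesis by (subst measurable_cong[symmetric]) auto
qed

lemma regret_le_iff:
  assumes "0 < n"
  shows "regret n T A \<omega> p l \<le> c \<longleftrightarrow> (\<forall>i<n. (\<Sum>t<T. l t (followed A \<omega> p l t)) - c \<le> (\<Sum>t<T. l t i))"
proof -
  have "regret n T A \<omega> p l \<le> c \<longleftrightarrow> (\<Sum>t<T. l t (followed A \<omega> p l t)) - c \<le> (MIN i\<in>{..<n}. \<Sum>t<T. l t i)"
    unfolding regret_def by linarith
  also have "\<dots> \<longleftrightarrow> (\<forall>i<n. (\<Sum>t<T. l t (followed A \<omega> p l t)) - c \<le> (\<Sum>t<T. l t i))"
    using assms by (subst Min_ge_iff) auto
  finally show ?thesis .
qed

lemma sets_regret_le:
  assumes alg: "measurable_alg P A" and query: "obeys_query_model P n T A" and n: "0 < n"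
  shows "{((p, l), \<omega>) \<in> space (env_space P n T \<Otimes>\<^sub>M coins). regret n T A \<omega> p l \<le> c}
    \<in> sets (env_space P n T \<Otimes>\<^sub>M coins)"
proof -
  let ?M = "env_space P n T \<Otimes>\<^sub>M coins"
  have "(\<lambda>z. \<Sum>t<T. (\<lambda>((p, l), \<omega>). l t (followed A \<omega> p l t)) z) \<in> borel_measurable ?M"
    by (intro borel_measurable_sum measurable_followed_loss[OF alg query]) simp
  then have 1: "(\<lambda>z. (\<Sum>t<T. (\<lambda>((p, l), \<omega>). l t (followed A \<omega> p l t)) z) - c) \<in> borel_measurable ?M" by simp
  have 2: "(\<lambda>z. \<Sum>t<T. (\<lambda>((p, l), \<omega>). l t i) z) \<in> borel_measurable ?M" if "i < n" for i
    using that by (intro borel_measurable_sum measurable_loss) simp_all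
  have "{z \<in> space ?M. \<forall>i\<in>{..<n}. (\<Sum>t<T. (\<lambda>((p, l), \<omega>). l t (followed A \<omega> p l t)) z) - c
      \<le> (\<Sum>t<T. (\<lambda>((p, l), \<omega>). l t i) z)} \<in> sets ?M"
    using 1 2 by (intro sets.sets_Collect_finite_All borel_measurable_le) auto
  also have "{z \<in> space ?M. \<forall>i\<in>{..<n}. (\<Sum>t<T. (\<lambda>((p, l), \<omega>). l t (followed A \<omega> p l t)) z) - c
      \<le> (\<Sum>t<T. (\<lambda>((p, l), \<omega>). l t i) z)} = {((p, l), \<omega>) \<in> space ?M. regret n T A \<omega> p l \<le> c}"
    by (auto simp: regret_le_iff[OF n])
  finally show ?thesis .
qed

text \<open>Fubini: an oblivious adversary is independent of the coins, so a bound for every fixed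
  environment passes to any distribution of environments.\<close>

lemma prob_regret_ge:
  assumes alg: "measurable_alg P A" and query: "obeys_query_model P n T A" and n: "0 < n"
    and D: "oblivious_adversary P n T D" and \<epsilon>: "0 \<le> \<epsilon>"
    and fixed: "\<And>p l. (p, l) \<in> space (env_space P n T) \<Longrightarrow>
      \<exists>U\<in>sets coins. measure coins U \<le> \<epsilon> \<and> (\<forall>\<omega>. \<omega> \<notin> U \<longrightarrow> regret n T A \<omega> p l \<le> c)"
  shows "\<P>(((p, l), \<omega>) in D \<Otimes>\<^sub>M coins. regret n T A \<omega> p l \<le> c) \<ge> 1 - \<epsilon>"
proof -
  interpret D: prob_space D using D by (simp add: oblivious_adversary_def)
  interpret C: prob_space coins by (rule prob_space_coins)
  interpret pair_prob_space D coins ..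
  have sets_D: "sets D = sets (env_space P n T)" using D by (simp add: oblivious_adversary_def)
  then have sets: "sets (D \<Otimes>\<^sub>M coins) = sets (env_space P n T \<Otimes>\<^sub>M coins)" by (rule sets_pair_measure_cong) simp
  then have space: "space (D \<Otimes>\<^sub>M coins) = space (env_space P n T \<Otimes>\<^sub>M coins)" by (rule sets_eq_imp_space_eq)
  let ?E = "{((p, l), \<omega>) \<in> space (D \<Otimes>\<^sub>M coins). regret n T A \<omega> p l \<le> c}"
  let ?N = "space (D \<Otimes>\<^sub>M coins) - ?E"
  have E: "?E \<in> sets (D \<Otimes>\<^sub>M coins)" using sets_regret_le[OF alg query n] by (simp only: sets space)
  then have N: "?N \<in> sets (D \<Otimes>\<^sub>M coins)" by (rule sets.compl_sets)
  have slice: "emeasure coins (Pair x -` ?N) \<le> \<epsilon>" if "x \<in> space D" for x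
  proof -
    obtain p l where x: "x = (p, l)" by (cases x)
    have "x \<in> space (env_space P n T)" using that sets_eq_imp_space_eq[OF sets_D] by simp
    then obtain U where U: "U \<in> sets coins" "measure coins U \<le> \<epsilon>" "\<And>\<omega>. \<omega> \<notin> U \<Longrightarrow> regret n T A \<omega> p l \<le> c"
      using fixed x by blast
    have "Pair x -` ?N \<subseteq> U"
    proof
      fix \<omega> assume "\<omega> \<in> Pair x -` ?N"
      then have "\<not> regret n T A \<omega> p l \<le> c" by (simp add: x)
      then show "\<omega> \<in> U" using U(3) by blast
    qed
    then have "emeasure coins (Pair x -` ?N) \<le> emeasure coins U" using U(1) by (rule emeasure_mono)
    also have "\<dots> \<le> \<epsilon>" using U(2) by (simp add: C.emeasure_eq_measure ennreal_leI)
    finally show ?thesis .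
  qed
  have "emeasure (D \<Otimes>\<^sub>M coins) ?N = (\<integral>\<^sup>+x. emeasure coins (Pair x -` ?N) \<partial>D)"
    by (rule C.emeasure_pair_measure_alt[OF N])
  also have "\<dots> \<le> (\<integral>\<^sup>+x. \<epsilon> \<partial>D)" by (intro nn_integral_mono slice)
  also have "\<dots> = \<epsilon>" by (simp add: D.emeasure_space_1)
  finally have "prob ?N \<le> \<epsilon>" using \<epsilon> by (simp add: emeasure_eq_measure)
  moreover have "prob ?N = 1 - prob ?E" using prob_compl[OF E] .
  ultimately have "1 - \<epsilon> \<le> prob ?E" by linarith
  then show ?thesis by (simp only: case_prod_unfold)
qed

section \<open>The algorithm\<close>

definition quantize :: "nat \<Rightarrow> (nat \<Rightarrow> real) \<Rightarrow> nat \<Rightarrow> nat" where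
  "quantize S r e = nat \<lfloor>S * r e\<rfloor>"

definition serialize_pool :: "entry list \<Rightarrow> nat list" where
  "serialize_pool P = concat (map (\<lambda>(e, s, z, g). [e, s, z, g]) P)"

text \<open>The leading length makes the code self-delimiting, hence the concatenation over levels
  injective.\<close>

definition serialize_level :: "level \<Rightarrow> nat list" where
  "serialize_level = (\<lambda>(c, P). length P # c # serialize_pool P)"

definition pool_experts :: "level list \<Rightarrow> nat list" where
  "pool_experts lvs = concat (map (\<lambda>(c, P). map fst P) lvs)"

text \<open>Expert 0 is always queried: it is the bottom of the hierarchy and the default value of
  \<open>pick\<close>. The query list repeats data of the second list, so an entry takes five words
  in all.\<close>

definition encode :: "nat \<times> level list \<Rightarrow> memory" where
  "encode = (\<lambda>(t, lvs). (0 # pool_experts lvs, t # concat (map serialize_level lvs)))"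

definition decode :: "memory \<Rightarrow> nat \<times> level list" where
  "decode = inv encode"

lemma serialize_pool_inject:
  "length P = length P' \<Longrightarrow> serialize_pool P @ ws = serialize_pool P' @ ws' \<longleftrightarrow> P = P' \<and> ws = ws'"
  by (induction P P' rule: list_induct2) (auto simp: serialize_pool_def)

lemma serialize_inject:
  "concat (map serialize_level lvs) = concat (map serialize_level lvs') \<Longrightarrow> lvs = lvs'"
proof (induction lvs arbitrary: lvs')
  case Nil
  then show ?case by (cases lvs') (auto simp: serialize_level_def)
next
  case (Cons a lvs)
  obtain c P where a: "a = (c, P)" by (cases a)
  obtain b lvs'' where lvs': "lvs' = b # lvs''"
    using Cons.prems by (cases lvs') (auto simp: serialize_level_def a)
  obtain c' P' where b: "b = (c', P')" by (cases b)
  have eq: "length P = length P'" "c = c'"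
    "serialize_pool P @ concat (map serialize_level lvs) = serialize_pool P' @ concat (map serialize_level lvs'')"
    using Cons.prems by (auto simp: a b lvs' serialize_level_def)
  then show ?case
    using serialize_pool_inject[OF eq(1)] Cons.IH by (simp add: a b lvs')
qed

lemma decode_encode: "decode (encode s) = s"
proof -
  have "inj encode"
    by (rule injI) (auto simp: encode_def dest: serialize_inject split: prod.splits)
  then show ?thesis by (simp add: decode_def)
qed

lemma observed_encode: "observed (encode (t, lvs)) = insert 0 (\<Union>lv\<in>set lvs. fst ` set (snd lv))"
  by (simp add: observed_def encode_def pool_experts_def case_prod_unfold)

lemma length_serialize_level: "length (serialize_level lv) = 2 + 4 * length (snd lv)"
proof -
  have "length (serialize_pool P) = 4 * length P" for P
    by (induction P) (auto simp: serialize_pool_def)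
  then show ?thesis by (cases lv) (simp add: serialize_level_def)
qed

lemma length_encode_le:
  assumes "\<And>lv. lv \<in> set lvs \<Longrightarrow> length (snd lv) \<le> M"
  shows "length (memory_words (encode (t, lvs))) \<le> 2 + length lvs * (2 + 5 * M)"
proof -
  have "length (pool_experts lvs) + length (concat (map serialize_level lvs)) \<le> length lvs * (2 + 5 * M)"
    using assms
  proof (induction lvs)
    case (Cons lv lvs)
    have "length (pool_experts (lv # lvs)) = length (snd lv) + length (pool_experts lvs)"
      by (simp add: pool_experts_def case_prod_unfold)
    moreover have "length (snd lv) \<le> M" using Cons.prems by simp
    moreover have "length (pool_experts lvs) + length (concat (map serialize_level lvs)) \<le> length lvs * (2 + 5 * M)"
      using Cons.prems by (intro Cons.IH) simp
    moreover have "length (concat (map serialize_level (lv # lvs))) =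
        2 + 4 * length (snd lv) + length (concat (map serialize_level lvs))"
      by (simp add: length_serialize_level)
    moreover have "length (lv # lvs) * (2 + 5 * M) = 2 + 5 * M + length lvs * (2 + 5 * M)"
      by (simp only: list.size add_Suc_right add_0_right mult_Suc)
    ultimately show ?case by linarith
  qed (simp add: pool_experts_def)
  then show ?thesis by (simp add: memory_words_def encode_def)
qed

lemma memory_words_encode:
  assumes "w \<in> set (memory_words (encode (t, lvs)))" "t \<le> b"
    and "\<And>lv. lv \<in> set lvs \<Longrightarrow> length (snd lv) \<le> b \<and> fst lv \<le> b \<and>
      (\<forall>(e, s, z, g)\<in>set (snd lv). e \<le> b \<and> s \<le> b \<and> z \<le> b \<and> g \<le> b)"
  shows "w \<le> b"
proof -
  consider "w = 0" | "w \<in> set (pool_experts lvs)" | "w = t" | "w \<in> set (concat (map serialize_level lvs))"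
    using assms(1) by (auto simp: memory_words_def encode_def)
  then show ?thesis
  proof cases
    case 2
    then obtain lv e s z g where "lv \<in> set lvs" "(e, s, z, g) \<in> set (snd lv)" "w = e"
      by (fastforce simp: pool_experts_def)
    then show ?thesis using assms(3)[of lv] by auto
  next
    case 4
    then obtain lv where lv: "lv \<in> set lvs" "w \<in> set (serialize_level lv)" by auto
    obtain c P where cP: "lv = (c, P)" by (cases lv)
    consider "w = length P" | "w = c" | e s z g where "(e, s, z, g) \<in> set P" "w \<in> {e, s, z, g}"
      using lv(2) by (auto simp: cP serialize_level_def serialize_pool_def)
    then show ?thesis using assms(3)[OF lv(1)] by cases (auto simp: cP)
  qed (use assms(2) in auto)
qed

context pool_params
begin

definition advance :: "(nat \<Rightarrow> nat) \<Rightarrow> (nat \<Rightarrow> nat) \<Rightarrow> nat \<times> level list \<Rightarrow> nat \<times> level list" where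
  "advance l x = (\<lambda>(t, lvs). (Suc t, map (next_level t l x ((!) lvs)) [0..<R]))"

text \<open>The draws of level \<open>R\<close>, which does not exist, are used for playing.\<close>

definition alg :: "'p expert_alg" where
  "alg = \<lparr>
     start = (\<lambda>\<omega>. encode (0, map (\<lambda>r. (0, [(draw m \<omega> r 0 mod n, 0, 0, 0)])) [0..<R])),
     follow = (\<lambda>\<omega> mem q. case decode mem of (t, lvs) \<Rightarrow> pick (2 ^ m) (plays ((!) lvs) R) (draw m \<omega> R t)),
     update = (\<lambda>\<omega> mem q r. case decode mem of (t, lvs) \<Rightarrow>
       encode (advance (quantize S r) (\<lambda>r. draw m \<omega> r (Suc t)) (t, lvs)))\<rparr>"

lemma alg_simps:
  "start alg \<omega> = encode (0, map (\<lambda>r. (0, [(draw m \<omega> r 0 mod n, 0, 0, 0)])) [0..<R])"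
  "follow alg \<omega> (encode (t, lvs)) q = pick (2 ^ m) (plays ((!) lvs) R) (draw m \<omega> R t)"
  "update alg \<omega> (encode (t, lvs)) q r = encode (advance (quantize S r) (\<lambda>r. draw m \<omega> r (Suc t)) (t, lvs))"
  by (simp_all add: alg_def decode_encode)

text \<open>The full-information losses to which the analysis applies, padded by 0 outside the
  actual days and experts.\<close>

definition scaled :: "nat \<Rightarrow> (nat \<Rightarrow> nat \<Rightarrow> real) \<Rightarrow> nat \<Rightarrow> nat \<Rightarrow> nat" where
  "scaled T l t e = (if t < T \<and> e < n then quantize S (l t) e else 0)"

lemma advance_draws:
  "advance l x (t, lvs) = advance l ((!) (map x [0..<R])) (t, lvs)"
  by (simp add: advance_def next_level_def)

lemma measurable_quantize:
  assumes "set es \<subseteq> J"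
  shows "(\<lambda>r. map (quantize S r) es) \<in> (\<Pi>\<^sub>M i\<in>J. loss_space) \<rightarrow>\<^sub>M count_space UNIV"
  using assms
proof (induction es)
  case (Cons e es)
  have "e \<in> J" using Cons.prems by simp
  then have "(\<lambda>r. r e) \<in> (\<Pi>\<^sub>M i\<in>J. loss_space) \<rightarrow>\<^sub>M loss_space" by (rule measurable_component_singleton)
  then have "(\<lambda>r. r e) \<in> borel_measurable (\<Pi>\<^sub>M i\<in>J. loss_space)"
    unfolding loss_space_def measurable_restrict_space2_iff by simp
  then have "(\<lambda>r. \<lfloor>S * r e\<rfloor>) \<in> (\<Pi>\<^sub>M i\<in>J. loss_space) \<rightarrow>\<^sub>M count_space UNIV"
    by measurable
  then have 1: "(\<lambda>r. quantize S r e) \<in> (\<Pi>\<^sub>M i\<in>J. loss_space) \<rightarrow>\<^sub>M count_space UNIV"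
    unfolding quantize_def by (rule measurable_compose) simp
  have "(\<lambda>r. (quantize S r e, map (quantize S r) es)) \<in> (\<Pi>\<^sub>M i\<in>J. loss_space) \<rightarrow>\<^sub>M
      count_space UNIV \<Otimes>\<^sub>M count_space UNIV"
    using Cons by (intro measurable_Pair 1) auto
  moreover have "(\<lambda>p :: nat \<times> nat list. fst p # snd p) \<in> count_space UNIV \<Otimes>\<^sub>M count_space UNIV \<rightarrow>\<^sub>M count_space UNIV"
    by (simp add: pair_measure_countable)
  ultimately have "(\<lambda>r. fst (quantize S r e, map (quantize S r) es) # snd (quantize S r e, map (quantize S r) es))
      \<in> (\<Pi>\<^sub>M i\<in>J. loss_space) \<rightarrow>\<^sub>M count_space UNIV"
    by (rule measurable_compose)
  then show ?case by simp
qed simp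

lemma measurable_alg: "measurable_alg P alg"
  unfolding measurable_alg_def
proof (intro conjI allI)
  have "(\<lambda>\<omega>. encode (0, map (\<lambda>v. (0, [(v mod n, 0, 0, 0)])) (draws m \<omega> (map (\<lambda>r. (r, 0)) [0..<R]))))
      \<in> coins \<rightarrow>\<^sub>M count_space UNIV"
    by (rule measurable_compose[OF measurable_draws,
          where g = "\<lambda>vs. encode (0, map (\<lambda>v. (0, [(v mod n, 0, 0, 0)])) vs)"]) simp
  then show "start alg \<in> coins \<rightarrow>\<^sub>M count_space UNIV" by (simp add: alg_def comp_def)
next
  fix mem
  obtain t lvs where mem: "decode mem = (t, lvs)" by (cases "decode mem")
  have "(\<lambda>z. pick (2 ^ m) (plays ((!) lvs) R) (draw m (fst z) R t))
      \<in> coins \<Otimes>\<^sub>M (\<Pi>\<^sub>M i\<in>observed mem. P) \<rightarrow>\<^sub>M count_space UNIV"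
    by (rule measurable_compose[OF measurable_compose[OF measurable_fst measurable_draw],
          where g = "pick (2 ^ m) (plays ((!) lvs) R)"]) simp
  then show "(\<lambda>(\<omega>, q). follow alg \<omega> mem q) \<in> coins \<Otimes>\<^sub>M (\<Pi>\<^sub>M i\<in>observed mem. P) \<rightarrow>\<^sub>M count_space UNIV"
    by (simp add: alg_def mem case_prod_unfold)
  let ?M = "coins \<Otimes>\<^sub>M (\<Pi>\<^sub>M i\<in>observed mem. P) \<Otimes>\<^sub>M (\<Pi>\<^sub>M i\<in>observed mem. loss_space)"
  let ?keys = "map (\<lambda>r. (r, Suc t)) [0..<R]"
  \<comment> \<open>The update as a function of two lists, i.e. of countable data. A restricted loss
    function is \<open>undefined\<close> outside the query set, and \<open>F\<close> has to
    reproduce the quantized value there too.\<close>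
  define F where "F = (\<lambda>(xs, ys). encode (advance
    (\<lambda>e. if e \<in> observed mem then the (map_of (zip (fst mem) ys) e) else quantize S (\<lambda>_. undefined) e)
    ((!) xs) (t, lvs)))"
  have "(\<lambda>z. (draws m (fst z) ?keys, map (quantize S (snd (snd z))) (fst mem))) \<in> ?M \<rightarrow>\<^sub>M
      count_space UNIV \<Otimes>\<^sub>M count_space UNIV"
  proof (intro measurable_Pair)
    show "(\<lambda>z. draws m (fst z) ?keys) \<in> ?M \<rightarrow>\<^sub>M count_space UNIV"
      by (rule measurable_compose[OF measurable_fst measurable_draws])
    show "(\<lambda>z. map (quantize S (snd (snd z))) (fst mem)) \<in> ?M \<rightarrow>\<^sub>M count_space UNIV"
      by (rule measurable_compose[OF measurable_compose[OF measurable_snd measurable_snd]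
            measurable_quantize[of "fst mem" "observed mem"]]) (simp add: observed_def)
  qed
  moreover have "F \<in> count_space UNIV \<Otimes>\<^sub>M count_space UNIV \<rightarrow>\<^sub>M count_space UNIV"
    by (simp add: pair_measure_countable)
  ultimately have F: "(\<lambda>z. F (draws m (fst z) ?keys, map (quantize S (snd (snd z))) (fst mem))) \<in> ?M \<rightarrow>\<^sub>M count_space UNIV"
    by (rule measurable_compose)
  have eq: "F (draws m (fst z) ?keys, map (quantize S (snd (snd z))) (fst mem)) =
      (\<lambda>(\<omega>, q, r). update alg \<omega> mem q r) z" if z: "z \<in> space ?M" for z
  proof -
    obtain \<omega> q r where z': "z = (\<omega>, q, r)" by (metis surj_pair)
    have r: "r e = undefined" if "e \<notin> observed mem" for e
      using z that by (simp add: z' space_pair_measure space_PiM PiE_def extensional_def)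
    have "(\<lambda>e. if e \<in> observed mem then the (map_of (zip (fst mem) (map (quantize S r) (fst mem))) e)
        else quantize S (\<lambda>_. undefined) e) = quantize S r"
      using r by (intro ext) (auto simp: observed_def map_of_zip_map quantize_def)
    moreover have "draws m \<omega> ?keys = map (\<lambda>r. draw m \<omega> r (Suc t)) [0..<R]"
      by (simp add: comp_def)
    ultimately have "F (draws m (fst z) ?keys, map (quantize S (snd (snd z))) (fst mem)) =
        encode (advance (quantize S r) (\<lambda>r. draw m \<omega> r (Suc t)) (t, lvs))"
      by (simp only: F_def z' fst_conv snd_conv prod.case advance_draws[symmetric])
    then show ?thesis by (simp add: alg_def z' mem)
  qed
  show "(\<lambda>(\<omega>, q, r). update alg \<omega> mem q r) \<in> ?M \<rightarrow>\<^sub>M count_space UNIV"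
    by (rule iffD1[OF measurable_cong[OF eq] F])
qed

end

context pool_hierarchy
begin

lemma lev_expert: "(e, s, z, g) \<in> set (snd (lev x l t r)) \<Longrightarrow> e < n"
proof (induction t arbitrary: e s z g r)
  case 0
  then show ?case using n by auto
next
  case (Suc t)
  obtain c P where lv: "lev x l t r = (c, P)" by (cases "lev x l t r")
  have IH: "e < n" if "(e, s, z, g) \<in> set (add_losses (l t) P)" for e s z g
    using that Suc.IH[of e s _ g r] lv by (auto simp: add_losses_def)
  show ?case
    using Suc.prems n IH sweep_mem(3)
    by (fastforce simp: next_level_def level_step_def lv split: if_splits)
qed

text \<open>Needed to fit the state into words. Gains stem from subroutine losses of finished epochs
  and \<open>fst\<close> is the subroutine loss of the current one, so their sum is the quantity
  that grows by at most \<open>S\<close> per day.\<close>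

lemma lev_bounds:
  assumes l_le: "\<And>t e. l t e \<le> S"
  shows "fst (lev x l t r) \<le> S * t"
    and "(e, s, z, g) \<in> set (snd (lev x l t r)) \<Longrightarrow> s \<le> t \<and> z \<le> S * t \<and> fst (lev x l t r) + g \<le> S * t"
proof -
  have "fst (lev x l t r) \<le> S * t \<and>
    (\<forall>(e, s, z, g)\<in>set (snd (lev x l t r)). s \<le> t \<and> z \<le> S * t \<and> fst (lev x l t r) + g \<le> S * t)"
  proof (induction t)
    case (Suc t)
    obtain c P where lv: "lev x l t r = (c, P)" by (cases "lev x l t r")
    let ?a = "outs (lev x l t) (l t) r"
    have a: "?a \<le> S" using out_le[of l t x r, OF l_le] by (simp add: out_def)
    have IH: "s \<le> t \<and> z \<le> S * Suc t \<and> c + ?a + g \<le> S * Suc t" if "(e, s, z, g) \<in> set (add_losses (l t) P)" for e s z g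
    proof -
      from that obtain z' where "(e, s, z', g) \<in> set P" "z = z' + l t e" by (auto simp: add_losses_def)
      then show ?thesis using Suc a l_le[of t e] by (fastforce simp: lv)
    qed
    have new: "s \<le> t \<and> z = 0 \<and> g \<le> S * Suc t"
      if mem: "(e, s, z, g) \<in> set (sweep G V \<tau> f (c + ?a) (add_losses (l t) P))" for e s z g V \<tau> f
    proof -
      obtain z' g' where "(e, s, z', g') \<in> set (add_losses (l t) P)" "g \<le> g' + (c + ?a)"
        using sweep_mem(3)[OF mem] by blast
      then show ?thesis using IH[of e s z' g'] sweep_mem(1)[OF mem] by simp
    qed
    have c: "c + ?a \<le> S * Suc t" using Suc a by (simp add: lv)
    show ?case
    proof (cases "Suc t mod blen r = 0")
      case True
      define Q where "Q = (if Suc t mod (blen r * (G * H)) = 0 then [] else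
        sweep G (width r) (t div blen r) (c + ?a - width r) (c + ?a) (add_losses (l t) P))"
      have "lev x l (Suc t) r = (0, Q @ [(x r (Suc t) mod n, Suc t div blen r, 0, 0)])"
        using True by (simp add: next_level_def level_step_def lv Q_def)
      moreover have "s \<le> Suc t \<and> z \<le> S * Suc t \<and> g \<le> S * Suc t" if "(e, s, z, g) \<in> set Q" for e s z g
      proof -
        have "(e, s, z, g) \<in> set (sweep G (width r) (t div blen r) (c + ?a - width r) (c + ?a) (add_losses (l t) P))"
          using that by (simp add: Q_def split: if_splits)
        from new[OF this] show ?thesis by simp
      qed
      ultimately show ?thesis by (auto simp: div_le_dividend simp del: mult_Suc_right)
    next
      case False
      have "lev x l (Suc t) r = (c + ?a, add_losses (l t) P)"
        using False by (simp add: next_level_def level_step_def lv)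
      moreover have "s \<le> Suc t \<and> z \<le> S * Suc t \<and> c + ?a + g \<le> S * Suc t"
        if "(e, s, z, g) \<in> set (add_losses (l t) P)" for e s z g
        using IH[OF that] by simp
      ultimately show ?thesis using c by (auto simp del: mult_Suc_right)
    qed
  qed auto
  then show "fst (lev x l t r) \<le> S * t"
    and "(e, s, z, g) \<in> set (snd (lev x l t r)) \<Longrightarrow> s \<le> t \<and> z \<le> S * t \<and> fst (lev x l t r) + g \<le> S * t"
    by auto
qed

text \<open>The losses passed to \<open>update\<close> agree with \<open>scaled\<close> on all
  experts that any level reads, so the restricted view does not alter the run.\<close>

lemma memory_at_alg:
  assumes "t \<le> T"
  shows "memory_at alg \<omega> p l t = encode (t, map (lev (draw m \<omega>) (scaled T l) t) [0..<R])"
  using assms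
proof (induction t)
  case 0
  then show ?case by (simp add: alg_simps)
next
  case (Suc t)
  let ?lv = "lev (draw m \<omega>) (scaled T l) t"
  let ?mem = "encode (t, map ?lv [0..<R])"
  let ?l = "quantize S (restrict (l t) (observed ?mem))"
  have IH: "memory_at alg \<omega> p l t = ?mem" using Suc by simp
  have eq: "?l e = scaled T l t e" if "e \<in> observed ?mem" "e < n" for e
    using that Suc.prems by (simp add: scaled_def quantize_def)
  have "next_level t ?l (\<lambda>r. draw m \<omega> r (Suc t)) ((!) (map ?lv [0..<R])) r =
      next_level t (scaled T l t) (\<lambda>r. draw m \<omega> r (Suc t)) ?lv r" if "r < R" for r
  proof (rule next_level_cong)
    show "?l 0 = scaled T l t 0" using n by (intro eq) (simp_all add: observed_encode)
    fix r' e s z g assume r': "r' \<le> r" and e: "(e, s, z, g) \<in> set (snd (map ?lv [0..<R] ! r'))"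
    then have "(e, s, z, g) \<in> set (snd (?lv r'))" "?lv r' \<in> set (map ?lv [0..<R])" using that by auto
    then show "?l e = scaled T l t e"
      by (intro eq) (force simp: observed_encode, rule lev_expert)
  qed (use that in auto)
  then have "map (next_level t ?l (\<lambda>r. draw m \<omega> r (Suc t)) ((!) (map ?lv [0..<R]))) [0..<R] =
      map (lev (draw m \<omega>) (scaled T l) (Suc t)) [0..<R]"
    by (intro map_cong refl) (simp only: atLeast_upt[symmetric] lessThan_iff lev.simps)
  moreover have "memory_at alg \<omega> p l (Suc t) =
      update alg \<omega> ?mem (restrict (p t) (observed ?mem)) (restrict (l t) (observed ?mem))"
    by (simp only: memory_at.simps Let_def IH)
  ultimately show ?case
    by (simp only: alg_simps advance_def prod.case)
qed

lemma followed_alg: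
  assumes "t \<le> T"
  shows "followed alg \<omega> p l t = played (draw m \<omega>) (scaled T l) t"
proof -
  have "plays ((!) (map (lev (draw m \<omega>) (scaled T l) t) [0..<R])) R = plays (lev (draw m \<omega>) (scaled T l) t) R"
    by (rule plays_cong) simp
  then show ?thesis
    by (simp only: followed_def Let_def memory_at_alg[OF assms] alg_simps played_def)
qed

lemma scaled_le:
  assumes "(p, l) \<in> space (env_space P n T)"
  shows "scaled T l t e \<le> S"
proof (cases "t < T \<and> e < n")
  case True
  then have "l t e \<in> {0..1}"
    using env_space_loss[OF assms] by blast
  then have "S * l t e \<le> S" by (simp add: mult_left_le)
  then have "\<lfloor>S * l t e\<rfloor> \<le> int S" by (simp add: floor_le_iff)
  then show ?thesis using True by (simp add: scaled_def quantize_def)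
qed (auto simp: scaled_def)

lemma obeys_query_model_alg: "obeys_query_model P n T alg"
proof -
  have "observed (memory_at alg \<omega> p l t) \<subseteq> {..<n} \<and> followed alg \<omega> p l t \<in> observed (memory_at alg \<omega> p l t)"
    if "t < T" for p :: "nat \<Rightarrow> nat \<Rightarrow> 'b" and l \<omega> t
  proof
    let ?lv = "lev (draw m \<omega>) (scaled T l) t"
    have obs: "observed (memory_at alg \<omega> p l t) = insert 0 (\<Union>r<R. fst ` set (snd (?lv r)))"
      unfolding memory_at_alg[OF less_imp_le[OF that]] observed_encode by (simp add: atLeast0LessThan)
    show "observed (memory_at alg \<omega> p l t) \<subseteq> {..<n}"
      unfolding obs using n lev_expert by auto
    show "followed alg \<omega> p l t \<in> observed (memory_at alg \<omega> p l t)"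
      unfolding obs followed_alg[OF less_imp_le[OF that]] played_def
      using pick_mem[of "2 ^ m" "plays ?lv R"] by (simp only: plays_experts insert_absorb2)
  qed
  then show ?thesis unfolding obeys_query_model_def by blast
qed

lemma has_space_complexity_alg:
  fixes bound :: real
  assumes T: "2 + R * (2 + 5 * M) \<le> bound" and b: "n + M + T + S * T < 2 ^ word_bits b n T"
  shows "has_space_complexity P n T b alg bound"
proof -
  have "real (length (memory_words (memory_at alg \<omega> p l t))) \<le> bound \<and>
      (\<forall>w\<in>set (memory_words (memory_at alg \<omega> p l t)). w < 2 ^ word_bits b n T)"
    if pl: "(p, l) \<in> space (env_space P n T)" and t: "t < T" for p l \<omega> t
  proof
    let ?lvs = "map (lev (draw m \<omega>) (scaled T l) t) [0..<R]"
    have mem: "memory_at alg \<omega> p l t = encode (t, ?lvs)" using t by (simp add: memory_at_alg)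
    have len: "length (snd (lev (draw m \<omega>) (scaled T l) t r)) \<le> M" for r
      using scaled_le[OF pl] by (rule lev_length)
    have "length (memory_words (encode (t, ?lvs))) \<le> 2 + length ?lvs * (2 + 5 * M)"
      using len by (intro length_encode_le) auto
    then have "real (length (memory_words (encode (t, ?lvs)))) \<le> real (2 + R * (2 + 5 * M))"
      by (simp only: of_nat_le_iff length_map length_upt diff_zero)
    then show "real (length (memory_words (memory_at alg \<omega> p l t))) \<le> bound"
      using T unfolding mem by linarith
    have "w \<le> n + M + T + S * T" if "w \<in> set (memory_words (encode (t, ?lvs)))" for w
    proof (rule memory_words_encode[OF that])
      fix lv assume "lv \<in> set ?lvs"
      then obtain r where lv: "lv = lev (draw m \<omega>) (scaled T l) t r" by auto
      have St: "S * t \<le> S * T" using t by simp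
      have "e \<le> n + M + T + S * T \<and> s \<le> n + M + T + S * T \<and> z \<le> n + M + T + S * T \<and> g \<le> n + M + T + S * T"
        if "(e, s, z, g) \<in> set (snd lv)" for e s z g
      proof -
        have "s \<le> t \<and> z \<le> S * t \<and> fst lv + g \<le> S * t"
          unfolding lv by (rule lev_bounds(2)[of "scaled T l", OF scaled_le[OF pl] that[unfolded lv]])
        moreover have "e < n" using that unfolding lv by (rule lev_expert)
        ultimately show ?thesis using t St by (intro conjI) linarith+
      qed
      moreover have "length (snd lv) \<le> M" using len unfolding lv .
      moreover have "fst lv \<le> S * T"
        using lev_bounds(1)[of "scaled T l" "draw m \<omega>" t r, OF scaled_le[OF pl]] St unfolding lv by linarith
      ultimately show "length (snd lv) \<le> n + M + T + S * T \<and> fst lv \<le> n + M + T + S * T \<and>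
          (\<forall>(e, s, z, g)\<in>set (snd lv). e \<le> n + M + T + S * T \<and> s \<le> n + M + T + S * T \<and>
            z \<le> n + M + T + S * T \<and> g \<le> n + M + T + S * T)"
        by auto
    qed (use t in simp)
    then show "\<forall>w\<in>set (memory_words (memory_at alg \<omega> p l t)). w < 2 ^ word_bits b n T"
      unfolding mem using b by (meson le_less_trans)
  qed
  then show ?thesis unfolding has_space_complexity_def by blast
qed

theorem regret_alg:
  fixes \<theta> \<Delta> :: real
  assumes pl: "(p, l) \<in> space (env_space P n T)" and m: "n \<le> 2 ^ m" and \<theta>: "0 \<le> \<theta>" "\<theta> \<le> 1"
    and T: "T \<le> blen R"
  obtains U where "U \<in> sets coins"
    and "measure coins U \<le> R * T * (1 - 1 / (2 * n)) ^ N + exp (\<theta>\<^sup>2 * T - \<theta> * \<Delta>)"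
    and "\<And>\<omega>. \<omega> \<notin> U \<Longrightarrow> regret n T alg \<omega> p l \<le>
      width R / S + T * ((1 + real R) / S + (1 + real R * M) / 2 ^ m) + \<Delta>"
proof -
  \<comment> \<open>The environment is fixed, so the best expert is determined before any coin is
    flipped and no union bound over the experts is needed.\<close>
  have "(MIN i\<in>{..<n}. \<Sum>t<T. l t i) \<in> (\<lambda>i. \<Sum>t<T. l t i) ` {..<n}"
    using n by (intro Min_in) auto
  then obtain i where i: "i < n" "(MIN i\<in>{..<n}. \<Sum>t<T. l t i) = (\<Sum>t<T. l t i)" by blast
  obtain U where U: "U \<in> sets coins"
    "measure coins U \<le> R * T * (1 - 1 / (2 * n)) ^ N + exp (\<theta>\<^sup>2 * T - \<theta> * \<Delta>)"
    "\<And>\<omega>. \<omega> \<notin> U \<Longrightarrow> (\<Sum>t<T. real (scaled T l t (played (draw m \<omega>) (scaled T l) t)) / S) \<le>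
      (\<Sum>t<T. real (scaled T l t i) / S) + width R / S + T * (real R / S + (1 + real R * M) / 2 ^ m) + \<Delta>"
  proof (rule played_regret[where l = "scaled T l" and i = i and \<theta> = \<theta> and T = T and \<Delta> = \<Delta>])
    show "scaled T l t e \<le> S" for t e by (rule scaled_le[OF pl])
    show "scaled T l t e = 0" if "T \<le> t" for t e using that by (simp add: scaled_def)
    fix U assume "U \<in> sets coins" "measure coins U \<le> R * T * (1 - 1 / (2 * n)) ^ N + exp (\<theta>\<^sup>2 * T - \<theta> * \<Delta>)"
      "\<And>\<omega>. \<omega> \<notin> U \<Longrightarrow> (\<Sum>t<T. real (scaled T l t (played (draw m \<omega>) (scaled T l) t)) / S) \<le>
        (\<Sum>t<T. real (scaled T l t i) / S) + width R / S + T * (real R / S + (1 + real R * M) / 2 ^ m) + \<Delta>"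
    then show thesis by (rule that)
  qed (rule i(1) m \<theta> T)+
  have bounds: "real (scaled T l t e) / S \<le> l t e \<and> l t e \<le> real (scaled T l t e) / S + 1 / S"
    if "t < T" "e < n" for t e
  proof -
    have "0 \<le> l t e"
      using env_space_loss[OF pl that] by simp
    then have "0 \<le> S * l t e" by simp
    then have "real (nat \<lfloor>S * l t e\<rfloor>) \<le> S * l t e" "S * l t e \<le> real (nat \<lfloor>S * l t e\<rfloor>) + 1"
      by linarith+
    then have "real (scaled T l t e) \<le> S * l t e" "S * l t e \<le> real (scaled T l t e) + 1"
      using that by (simp_all only: scaled_def quantize_def simp_thms if_True)
    then show ?thesis using S by (simp add: field_simps)
  qed
  show thesis
  proof (rule that[OF U(1,2)])
    fix \<omega> assume \<omega>: "\<omega> \<notin> U"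
    have "(\<Sum>t<T. l t (followed alg \<omega> p l t)) \<le>
        (\<Sum>t<T. real (scaled T l t (played (draw m \<omega>) (scaled T l) t)) / S + 1 / S)"
    proof (rule sum_mono)
      fix t assume t: "t \<in> {..<T}"
      then have "followed alg \<omega> p l t < n"
        using obeys_query_modelD[OF obeys_query_model_alg pl, of t \<omega>] by blast
      then show "l t (followed alg \<omega> p l t) \<le> real (scaled T l t (played (draw m \<omega>) (scaled T l) t)) / S + 1 / S"
        using bounds[of t "followed alg \<omega> p l t"] t followed_alg[of t T \<omega> p l] by simp
    qed
    moreover have "(\<Sum>t<T. real (scaled T l t i) / S) \<le> (\<Sum>t<T. l t i)"
      using bounds i(1) by (intro sum_mono) auto
    moreover have "T * ((1 + real R) / S + (1 + real R * M) / 2 ^ m) =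
        T * (real R / S + (1 + real R * M) / 2 ^ m) + T * (1 / S)"
      by (simp add: add_divide_distrib distrib_left)
    ultimately show "regret n T alg \<omega> p l \<le>
        width R / S + T * ((1 + real R) / S + (1 + real R * M) / 2 ^ m) + \<Delta>"
      using U(3)[OF \<omega>] unfolding regret_def i(2) by (simp add: sum.distrib)
  qed
qed

end

section \<open>The choice of the parameters\<close>

lemma ln_le_of_pow:
  fixes k j :: nat
  assumes "0 < k" "k \<le> (2 :: nat) ^ j"
  shows "ln k \<le> j"
proof -
  have "real k \<le> real (2 ^ j)" using assms(2) by (simp only: of_nat_le_iff)
  then have "ln k \<le> ln (2 ^ j)" using assms(1) by (intro ln_mono) auto
  also have "\<dots> = j * ln 2" by (simp add: ln_realpow)
  also have "\<dots> \<le> j" using ln_2_less_1 by (simp add: mult_left_le)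
  finally show ?thesis .
qed

locale chosen_params =
  fixes \<delta> :: real and a c n T :: nat
  assumes \<delta>: "0 < \<delta>" "\<delta> < 1" and n1: "1 \<le> n" and T1: "1 \<le> T" and T_le: "T \<le> n ^ c"
begin

definition L :: nat where "L = nat \<lceil>log_size n T\<rceil>"
definition \<kappa> :: nat where "\<kappa> = 6 * (a + c + 2)"
definition G :: nat where "G = nat \<lceil>n powr \<delta>\<rceil>"
text \<open>Makes \<open>(1 - 1 / (2 * n)) ^ N\<close> at most
  \<open>2 ^ - ((a + c + 2) * L)\<close>, which beats the union bound with a factor
  \<open>2 * T ^ a\<close> to spare. The value of \<open>H\<close> below is exactly
  \<open>3 * N\<close>.\<close>

definition N :: nat where "N = 2 * n * ((a + c + 2) * L)"
definition H :: nat where "H = \<kappa> * L * n"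
definition M :: nat where "M = 3 * G * ((4 + \<kappa>) * L) + 1"
definition B\<^sub>0 :: nat where "B\<^sub>0 = 72 * G\<^sup>2 * ((9 + \<kappa>) * L)"
definition R :: nat where "R = (LEAST R. T \<le> B\<^sub>0 * (G * H) ^ R)"
text \<open>Since \<open>2 ^ m\<close> exceeds \<open>m\<close>, the rounding in \<open>pick\<close>
  costs at most 1 over all \<open>T\<close> days, and \<open>n \<le> 2 ^ m\<close> holds.\<close>

definition m :: nat where "m = n + T * (1 + R * M)"

lemma log_size_ge: "1 \<le> log_size n T"
proof -
  have "1 \<le> n * T" using n1 T1 by simp
  then have "2 powr 1 \<le> 2 * real n * real T" by (simp del: of_nat_mult add: of_nat_mult[symmetric])
  then show ?thesis using n1 T1 unfolding log_size_def by (subst le_log_iff) auto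
qed

lemma L_bounds: "1 \<le> L" "log_size n T \<le> L" "L \<le> 2 * log_size n T"
  using log_size_ge unfolding L_def by linarith+

lemma nT_le: "2 * n * T \<le> 2 ^ L"
proof -
  have "2 * real n * real T = 2 powr log_size n T"
    using n1 T1 by (simp add: log_size_def)
  also have "\<dots> \<le> 2 powr L" using L_bounds by (intro powr_mono) auto
  also have "\<dots> = 2 ^ L" by (simp add: powr_realpow)
  finally have "real (2 * n * T) \<le> real (2 ^ L)" by simp
  then show ?thesis by (simp only: of_nat_le_iff)
qed

lemma n_le: "n \<le> 2 ^ L" and T_le_pow: "T \<le> 2 ^ L"
proof -
  have "n \<le> 2 * n * T" "T \<le> 2 * n * T" using n1 T1 by auto
  then show "n \<le> 2 ^ L" "T \<le> 2 ^ L" using nT_le by (blast intro: order_trans)+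
qed

lemma G_bounds: "n powr \<delta> \<le> G" "G \<le> 2 * n powr \<delta>" "1 \<le> G" "G \<le> n"
proof -
  have p: "1 \<le> n powr \<delta>" using n1 \<delta> by (intro ge_one_powr_ge_zero) auto
  then show "n powr \<delta> \<le> G" "G \<le> 2 * n powr \<delta>" "1 \<le> G" unfolding G_def by linarith+
  have "n powr \<delta> \<le> n powr 1" using n1 \<delta> by (intro powr_mono) auto
  then have "n powr \<delta> \<le> n" using n1 by simp
  then show "G \<le> n" unfolding G_def by (simp add: ceiling_le_iff)
qed

lemma \<kappa>_pos: "12 \<le> \<kappa>" by (simp add: \<kappa>_def)

lemma H_ge: "n \<le> H"
  using \<kappa>_pos L_bounds(1) by (simp add: H_def)

lemma GH_le: "G * H \<le> 2 ^ (3 * L + \<kappa>)"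
proof -
  have "G \<le> 2 ^ L" using G_bounds(4) n_le by linarith
  moreover have "\<kappa> \<le> 2 ^ \<kappa>" "L \<le> 2 ^ L" by (simp_all add: less_imp_le)
  then have "H \<le> 2 ^ \<kappa> * 2 ^ L * 2 ^ L"
    unfolding H_def using n_le by (intro mult_le_mono)
  ultimately have "G * H \<le> 2 ^ L * (2 ^ \<kappa> * 2 ^ L * 2 ^ L)" by (rule mult_le_mono)
  also have "\<dots> = 2 ^ (3 * L + \<kappa>)"
    by (simp add: power_add[symmetric] numeral_3_eq_3 add.commute add.left_commute)
  finally show ?thesis .
qed

lemma GH_pos: "0 < G * H"
  using G_bounds(3) H_ge n1 by simp

lemma M_ge: "3 * G * harm (G * H) + 1 \<le> real M"
proof -
  have "harm (G * H) \<le> 1 + ln (real (G * H))" using GH_pos by (rule harm_le_ln)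
  also have "ln (real (G * H)) \<le> 3 * L + \<kappa>" by (rule ln_le_of_pow[OF GH_pos GH_le])
  also have "1 + real (3 * L + \<kappa>) \<le> real ((4 + \<kappa>) * L)"
  proof -
    have "\<kappa> \<le> \<kappa> * L" using L_bounds(1) by simp
    then have "1 + (3 * L + \<kappa>) \<le> (4 + \<kappa>) * L" using L_bounds(1) unfolding add_mult_distrib by linarith
    then show ?thesis by (metis of_nat_1 of_nat_add of_nat_le_iff)
  qed
  finally have "3 * G * harm (G * H) \<le> 3 * G * real ((4 + \<kappa>) * L)" by (intro mult_left_mono) auto
  then show ?thesis by (simp add: M_def)
qed

lemma M_le_pow: "M + 1 \<le> 2 ^ ((9 + \<kappa>) * L)"
proof -
  have "G \<le> 2 ^ L" "L \<le> 2 ^ L" using G_bounds(4) n_le by (linarith, simp add: less_imp_le)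
  then have "3 * G * ((4 + \<kappa>) * L) \<le> 2 ^ 2 * 2 ^ L * (2 ^ (4 + \<kappa>) * 2 ^ L)"
    by (intro mult_le_mono) (simp_all add: less_imp_le)
  also have "\<dots> = 2 ^ (2 + L + (4 + \<kappa> + L))" by (simp only: power_add)
  also have "2 + L + (4 + \<kappa> + L) = 2 * L + \<kappa> + 6" by simp
  finally have "M \<le> 2 ^ (2 * L + \<kappa> + 6) + 1" by (simp add: M_def)
  moreover have "2 ^ 1 \<le> (2 :: nat) ^ (2 * L + \<kappa> + 6)" by (rule power_increasing) simp_all
  ultimately have "M + 1 \<le> 2 * 2 ^ (2 * L + \<kappa> + 6)" by simp
  also have "\<dots> = 2 ^ Suc (2 * L + \<kappa> + 6)" by (simp only: power_Suc)
  also have "\<dots> \<le> 2 ^ ((9 + \<kappa>) * L)"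
  proof (rule power_increasing)
    have "\<kappa> \<le> \<kappa> * L" using L_bounds(1) by simp
    then show "Suc (2 * L + \<kappa> + 6) \<le> (9 + \<kappa>) * L" using L_bounds(1) unfolding add_mult_distrib by linarith
  qed simp
  finally show ?thesis .
qed

lemma B\<^sub>0_pos: "1 \<le> B\<^sub>0"
  using G_bounds(3) L_bounds(1) by (simp add: B\<^sub>0_def Suc_le_eq)

text \<open>As \<open>G * H\<close> is at least \<open>n\<close>, at most \<open>c\<close> levels
  are needed for \<open>T \<le> n ^ c\<close>.\<close>

lemma reach: "T \<le> B\<^sub>0 * (G * H) ^ c"
proof -
  have "n * 1 \<le> H * G" using H_ge G_bounds(3) by (rule mult_le_mono)
  then have "n ^ c \<le> (G * H) ^ c" by (intro power_mono) (simp_all add: mult.commute)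
  also have "\<dots> \<le> B\<^sub>0 * (G * H) ^ c" using B\<^sub>0_pos by simp
  finally show ?thesis using T_le by linarith
qed

lemma R_reach: "T \<le> B\<^sub>0 * (G * H) ^ R" and R_le: "R \<le> c"
  unfolding R_def using reach by (rule LeastI, rule Least_le)

lemma R_least: "R = Suc r \<Longrightarrow> B\<^sub>0 * (G * H) ^ r < T"
  using not_less_Least[of r "\<lambda>R. T \<le> B\<^sub>0 * (G * H) ^ R"] by (simp add: R_def)

text \<open>The resolution \<open>S\<close> is \<open>T\<close>: each rounding costs at most
  \<open>1 / T\<close> per day, hence at most 1 in total.\<close>

sublocale pool_hierarchy n T G H B\<^sub>0 R m M N
proof
  show "72 * real G ^ 2 * ln (real (M + 1)) \<le> real B\<^sub>0"
  proof -
    have "ln (real (M + 1)) \<le> (9 + \<kappa>) * L" by (rule ln_le_of_pow[OF _ M_le_pow]) simp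
    then have "72 * real G ^ 2 * ln (real (M + 1)) \<le> 72 * real G ^ 2 * real ((9 + \<kappa>) * L)"
      by (intro mult_left_mono) auto
    then show ?thesis by (simp add: B\<^sub>0_def)
  qed
  show "3 * N \<le> H" by (simp add: N_def H_def \<kappa>_def algebra_simps)
  show "G \<le> H" using G_bounds(4) H_ge by linarith
qed (use n1 T1 G_bounds(3) B\<^sub>0_pos M_ge in auto)

lemma miss_le: "R * T * (1 - 1 / (2 * n)) ^ N \<le> 1 / (2 * real T ^ a)"
proof -
  let ?D = "(a + c + 2) * L"
  have "(1 - 1 / (2 * n)) ^ N \<le> exp (- (1 / (2 * n))) ^ N"
    using exp_ge_add_one_self[of "- (1 / (2 * real n))"] n1 by (intro power_mono) auto
  also have "\<dots> = exp (- real ?D)"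
    using n1 by (simp add: exp_of_nat_mult[symmetric] N_def)
  also have "\<dots> = 1 / exp 1 ^ ?D" by (simp only: exp_minus exp_of_nat_mult[symmetric] mult_1_right inverse_eq_divide)
  also have "\<dots> \<le> 1 / 2 ^ ?D"
    using exp_ge_add_one_self[of 1] by (intro divide_left_mono power_mono) auto
  finally have "R * T * (1 - 1 / (2 * n)) ^ N \<le> R * T * (1 / 2 ^ ?D)" by (intro mult_left_mono) auto
  moreover have "2 * T ^ a * (R * T) \<le> 2 ^ ?D"
  proof -
    have "R \<le> 2 ^ c" using R_le less_exp[of c] by linarith
    moreover have "T ^ a \<le> (2 ^ L) ^ a" using T_le_pow by (rule power_mono) simp
    ultimately have "2 * T ^ a * (R * T) \<le> 2 ^ 1 * (2 ^ L) ^ a * (2 ^ c * 2 ^ L)"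
      using T_le_pow by (intro mult_le_mono) auto
    also have "\<dots> = 2 ^ (1 + L * a + (c + L))" by (simp only: power_add power_mult)
    also have "\<dots> \<le> 2 ^ ?D"
    proof (rule power_increasing)
      have "c \<le> c * L" using L_bounds(1) by simp
      then show "1 + L * a + (c + L) \<le> (a + c + 2) * L"
        using L_bounds(1) unfolding add_mult_distrib mult.commute[of L] by linarith
    qed simp
    finally show ?thesis .
  qed
  then have "real (2 * T ^ a * (R * T)) \<le> real (2 ^ ?D)" by (simp only: of_nat_le_iff)
  then have "R * T * (1 / 2 ^ ?D) \<le> 1 / (2 * real T ^ a)" using T1 by (simp add: field_simps)
  ultimately show ?thesis by linarith
qed

text \<open>With this \<theta> the quadratic term is exactly 1, which the summand 1 in \<Delta>
  cancels.\<close>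

lemma deviation_eq:
  defines "\<theta> \<equiv> 1 / sqrt T" and "\<Delta> \<equiv> sqrt T * (1 + ln (2 * real T ^ a))"
  shows "exp (\<theta>\<^sup>2 * T - \<theta> * \<Delta>) = 1 / (2 * real T ^ a)"
proof -
  have "\<theta>\<^sup>2 * T - \<theta> * \<Delta> = - ln (2 * real T ^ a)"
    using T1 by (simp add: \<theta>_def \<Delta>_def power_divide)
  then show ?thesis using T1 by (simp add: exp_minus inverse_eq_divide)
qed

lemma n_powr_le: "n powr \<delta> \<le> n"
  using n1 \<delta> powr_mono[of \<delta> 1 n] by simp

lemma B\<^sub>0_le: "B\<^sub>0 \<le> 288 * ((9 + \<kappa>) * L) * (n powr \<delta>)\<^sup>2"
proof -
  have "(real G)\<^sup>2 \<le> (2 * n powr \<delta>)\<^sup>2" using G_bounds(2) by (intro power_mono) auto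
  then have "72 * (real G)\<^sup>2 * ((9 + \<kappa>) * L) \<le> 72 * (2 * n powr \<delta>)\<^sup>2 * ((9 + \<kappa>) * L)"
    by (intro mult_right_mono) auto
  also have "\<dots> = 288 * real ((9 + \<kappa>) * L) * (n powr \<delta>)\<^sup>2"
    by (simp only: power_mult_distrib) simp
  finally show ?thesis by (simp only: B\<^sub>0_def of_nat_mult of_nat_power of_nat_numeral)
qed

text \<open>Minimality of \<open>R = Suc r\<close> gives
  \<open>B\<^sub>0 * (n powr (1 + \<delta>)) ^ r \<le> T\<close>. Raised to the power
  \<open>1 / (1 + \<delta>)\<close>, this bounds \<open>n ^ r\<close> times a power of
  \<open>B\<^sub>0\<close>. One factor \<open>n\<close> is left from the top level, and the
  remaining power of \<open>B\<^sub>0\<close> accounts for the other.\<close>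

lemma width_le: "B\<^sub>0 * H ^ R \<le> (\<kappa> * L) ^ c * (288 * ((9 + \<kappa>) * L)) * ((real n)\<^sup>2 * real T powr (1 / (1 + \<delta>)))"
proof -
  define e where "e = 1 / (1 + \<delta>)"
  have e: "1 / 2 \<le> e" "0 \<le> e" using \<delta> by (auto simp: e_def field_simps)
  let ?Q = "288 * real ((9 + \<kappa>) * L)"
  have "1 * 1 \<le> \<kappa> * L" using \<kappa>_pos L_bounds(1) by (intro mult_le_mono) auto
  then have \<kappa>L: "1 \<le> real (\<kappa> * L)" by (metis mult_1 of_nat_1 of_nat_le_iff)
  then have pow: "1 \<le> real (\<kappa> * L) ^ r" for r by (rule one_le_power)
  have "1 * 1 \<le> (9 + \<kappa>) * L" using L_bounds(1) by (intro mult_le_mono) auto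
  then have "1 \<le> real ((9 + \<kappa>) * L)" by (metis mult_1 of_nat_1 of_nat_le_iff)
  then have Q: "1 \<le> ?Q" by linarith
  have Te: "1 \<le> T powr e" using T1 e by (intro ge_one_powr_ge_zero) auto
  have nd: "(n powr \<delta>)\<^sup>2 \<le> (real n)\<^sup>2" using n_powr_le by (intro power_mono) auto
  show ?thesis
  proof (cases R)
    case 0
    have "real (B\<^sub>0 * H ^ R) \<le> ?Q * (n powr \<delta>)\<^sup>2" using B\<^sub>0_le 0 by simp
    also have "\<dots> \<le> ?Q * (real n)\<^sup>2" using nd by (intro mult_left_mono) auto
    also have "\<dots> \<le> real (\<kappa> * L) ^ c * (?Q * (real n)\<^sup>2)"
      using mult_right_mono[OF pow[of c], of "?Q * (real n)\<^sup>2"] by simp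
    also have "\<dots> \<le> real (\<kappa> * L) ^ c * (?Q * (real n)\<^sup>2) * T powr e"
      using mult_left_mono[OF Te, of "real (\<kappa> * L) ^ c * (?Q * (real n)\<^sup>2)"] by simp
    finally show ?thesis by (simp add: e_def mult.assoc)
  next
    case (Suc r)
    have B: "0 < real B\<^sub>0" using B\<^sub>0_pos by simp
    have "real B\<^sub>0 * (n powr (1 + \<delta>)) ^ r \<le> T"
    proof -
      have "n powr (1 + \<delta>) = n powr \<delta> * n" using n1 by (simp add: powr_add)
      also have "\<dots> \<le> G * H" using G_bounds(1) H_ge by (simp add: mult_mono)
      finally have "(n powr (1 + \<delta>)) ^ r \<le> real (G * H) ^ r" by (intro power_mono) auto
      then have "real B\<^sub>0 * (n powr (1 + \<delta>)) ^ r \<le> B\<^sub>0 * real (G * H) ^ r" by (intro mult_left_mono) auto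
      also have "\<dots> = real (B\<^sub>0 * (G * H) ^ r)" by simp
      also have "\<dots> \<le> T" using R_least[OF Suc] by (simp only: of_nat_le_iff)
      finally show ?thesis .
    qed
    then have "(real B\<^sub>0 * (n powr (1 + \<delta>)) ^ r) powr e \<le> T powr e"
      using e by (intro powr_mono2) auto
    also have "(real B\<^sub>0 * (n powr (1 + \<delta>)) ^ r) powr e = B\<^sub>0 powr e * real n ^ r"
    proof -
      have "(n powr (1 + \<delta>)) ^ r = n powr ((1 + \<delta>) * r)"
        using n1 by (simp add: powr_power mult.commute)
      moreover have "(n powr ((1 + \<delta>) * r)) powr e = real n ^ r"
        using n1 \<delta> by (simp add: powr_powr e_def powr_realpow)
      ultimately show ?thesis by (simp add: powr_mult)
    qed
    finally have nr: "B\<^sub>0 powr e * real n ^ r \<le> T powr e" .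
    \<comment> \<open>Here \<delta> < 1 is used: the exponent \<open>1 - e\<close> is at most 1/2,
      and the root of \<open>B\<^sub>0\<close> is of order \<open>n powr \<delta>\<close> up to
      logarithms.\<close>
    have "B\<^sub>0 powr (1 - e) \<le> B\<^sub>0 powr (1 / 2)" using e B\<^sub>0_pos by (intro powr_mono) auto
    also have "\<dots> = sqrt B\<^sub>0" by (simp add: powr_half_sqrt)
    also have "\<dots> \<le> sqrt ((?Q * n powr \<delta>)\<^sup>2)"
    proof (rule real_sqrt_le_mono)
      have "real B\<^sub>0 \<le> ?Q * (n powr \<delta>)\<^sup>2" using B\<^sub>0_le by simp
      also have "\<dots> \<le> ?Q\<^sup>2 * (n powr \<delta>)\<^sup>2"
        by (intro mult_right_mono self_le_power Q) simp_all
      finally show "real B\<^sub>0 \<le> (?Q * n powr \<delta>)\<^sup>2" by (simp add: power_mult_distrib)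
    qed
    also have "\<dots> \<le> ?Q * n" using n_powr_le by (simp add: mult_left_mono)
    finally have B_le: "B\<^sub>0 powr (1 - e) \<le> ?Q * n" .
    have "real (B\<^sub>0 * H ^ R) = real (\<kappa> * L) ^ R * (B\<^sub>0 * real n ^ r * n)"
      by (simp add: Suc H_def power_mult_distrib)
    also have "real B\<^sub>0 = B\<^sub>0 powr (1 - e) * B\<^sub>0 powr e"
      using B by (simp add: powr_add[symmetric])
    also have "real (\<kappa> * L) ^ R * (B\<^sub>0 powr (1 - e) * B\<^sub>0 powr e * real n ^ r * n) =
        real (\<kappa> * L) ^ R * (B\<^sub>0 powr (1 - e) * (B\<^sub>0 powr e * real n ^ r) * n)" by (simp add: mult.assoc)
    also have "\<dots> \<le> real (\<kappa> * L) ^ c * (?Q * n * (T powr e) * n)"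
      using \<kappa>L R_le nr B_le by (intro mult_mono power_increasing) auto
    finally show ?thesis by (simp add: e_def power2_eq_square mult_ac)
  qed
qed

definition log_exponent :: nat where "log_exponent = c + 1"
text \<open>The sum of the constants from \<open>error_le\<close> and \<open>space_le\<close>; the
  power of 2 converts \<open>L\<close> into \<open>log_size\<close>, which is at least half of
  it.\<close>

definition const :: real where
  "const = (288 * (9 + \<kappa>) * \<kappa> ^ c + a + c + 4 + 2 + 2 * c + 35 * c * (4 + \<kappa>)) * 2 ^ (c + 1)"

lemma polylog_ge:
  assumes "0 \<le> q" "q * 2 ^ (c + 1) \<le> const"
  shows "q * real L ^ (c + 1) \<le> polylog const log_exponent n T"
proof -
  have "real L ^ (c + 1) \<le> (2 * log_size n T) ^ (c + 1)" using L_bounds by (intro power_mono) auto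
  then have "q * real L ^ (c + 1) \<le> q * (2 ^ (c + 1) * log_size n T ^ (c + 1))"
    using assms(1) unfolding power_mult_distrib by (intro mult_left_mono) auto
  also have "\<dots> = (q * 2 ^ (c + 1)) * log_size n T ^ (c + 1)" by simp
  also have "\<dots> \<le> const * log_size n T ^ (c + 1)"
    using assms(2) log_size_ge by (intro mult_right_mono) auto
  finally show ?thesis by (simp add: polylog_def log_exponent_def)
qed

lemma L_le_pow: "real L \<le> real L ^ (c + 1)"
  using L_bounds(1) power_increasing[of 1 "c + 1" "real L"] by simp

lemma space_le: "2 + R * (2 + 5 * M) \<le> polylog const log_exponent n T * real n powr \<delta>"
proof -
  have nd: "1 \<le> n powr \<delta>" using n1 \<delta> by (intro ge_one_powr_ge_zero) auto
  have "1 \<le> L * n powr \<delta>" using mult_mono[of 1 L 1 "n powr \<delta>"] nd L_bounds(1) by simp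
  note X = this
  have "3 * real G * ((4 + \<kappa>) * L) \<le> 3 * (2 * n powr \<delta>) * ((4 + \<kappa>) * L)"
    using G_bounds(2) by (intro mult_right_mono) auto
  then have "M \<le> 6 * (4 + \<kappa>) * (L * n powr \<delta>) + 1" by (simp add: M_def algebra_simps)
  also have "\<dots> \<le> 6 * (4 + \<kappa>) * (L * n powr \<delta>) + (4 + \<kappa>) * (L * n powr \<delta>)"
    using mult_mono[of 1 "real (4 + \<kappa>)" 1 "L * n powr \<delta>"] X by simp
  finally have "real M \<le> 7 * (4 + \<kappa>) * (L * n powr \<delta>)" by (simp add: algebra_simps)
  then have "2 + c * (2 + 5 * real M) \<le> 2 * (L * n powr \<delta>) + c * (2 * (L * n powr \<delta>) + 5 * (7 * (4 + \<kappa>) * (L * n powr \<delta>)))"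
    using X by (intro add_mono mult_left_mono) auto
  also have "\<dots> = ((2 + 2 * c + 35 * c * (4 + \<kappa>)) * real L) * n powr \<delta>" by (simp add: algebra_simps)
  also have "\<dots> \<le> ((2 + 2 * c + 35 * c * (4 + \<kappa>)) * real L ^ (c + 1)) * n powr \<delta>"
    by (intro mult_right_mono mult_left_mono L_le_pow) simp_all
  also have "\<dots> \<le> polylog const log_exponent n T * n powr \<delta>"
    by (intro mult_right_mono polylog_ge) (auto simp: const_def)
  finally have "2 + c * (2 + 5 * real M) \<le> polylog const log_exponent n T * n powr \<delta>" .
  moreover have "real R * (2 + 5 * real M) \<le> c * (2 + 5 * real M)"
    using R_le by (intro mult_right_mono) auto
  moreover have "real (2 + R * (2 + 5 * M)) = 2 + real R * (2 + 5 * real M)" by (simp add: distrib_left)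
  ultimately show ?thesis by linarith
qed

lemma word_ok: "n + M + T + T * T < 2 ^ word_bits (12 + \<kappa>) n T"
proof -
  let ?p = "2 ^ ((9 + \<kappa>) * L) :: nat"
  have le: "2 ^ (2 * L) \<le> ?p" "2 ^ L \<le> (2 :: nat) ^ (2 * L)"
    by (intro power_increasing; simp)+
  have "T * T \<le> 2 ^ L * 2 ^ L" using T_le_pow by (intro mult_le_mono)
  then have "T * T \<le> 2 ^ (2 * L)" by (simp add: power_add[symmetric] mult_2)
  then have "n + M + T + T * T < ?p + ?p + ?p + ?p"
    using n_le T_le_pow le M_le_pow by linarith
  also have "\<dots> = 2 ^ ((9 + \<kappa>) * L + 2)" by (simp add: power_add)
  also have "\<dots> \<le> 2 ^ ((12 + \<kappa>) * L)"
    using L_bounds(1) by (intro power_increasing) (simp_all add: add_mult_distrib)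
  also have "\<dots> = 2 ^ word_bits (12 + \<kappa>) n T" by (simp add: word_bits_def L_def)
  finally show ?thesis .
qed

lemma error_le:
  "width R / T + T * ((1 + real R) / T + (1 + real R * M) / 2 ^ m) + sqrt T * (1 + ln (2 * real T ^ a))
    \<le> polylog const log_exponent n T * ((real n)\<^sup>2 * real T powr (1 / (1 + \<delta>)))"
proof -
  let ?Y = "(real n)\<^sup>2 * real T powr (1 / (1 + \<delta>))"
  have Te: "1 \<le> T powr (1 / (1 + \<delta>))" using T1 \<delta> by (intro ge_one_powr_ge_zero) auto
  have n2: "1 \<le> (real n)\<^sup>2" using n1 by (intro one_le_power) simp
  have Y: "1 \<le> ?Y" using mult_mono[OF n2 Te] by simp
  have L1: "1 \<le> real L" using L_bounds(1) by simp
  then have LY: "1 \<le> L * ?Y" using mult_mono[OF L1 Y] by simp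
  have "width R / T = B\<^sub>0 * H ^ R" using T1 by (simp add: width_def)
  also have "\<dots> \<le> (\<kappa> * L) ^ c * (288 * ((9 + \<kappa>) * L)) * ?Y" by (rule width_le)
  also have "\<dots> = (288 * (9 + \<kappa>) * \<kappa> ^ c) * real L ^ (c + 1) * ?Y"
    by (simp add: power_mult_distrib)
  finally have 1: "width R / T \<le> (288 * (9 + \<kappa>) * \<kappa> ^ c) * real L ^ (c + 1) * ?Y" .
  have "T * ((1 + real R) / T + (1 + real R * M) / 2 ^ m) \<le> c + 2"
  proof -
    have "T * (1 + R * M) \<le> m" by (simp add: m_def)
    also have "m < 2 ^ m" by (rule less_exp)
    finally have "real (T * (1 + R * M)) \<le> real (2 ^ m)" by (simp only: of_nat_le_iff less_imp_le)
    then have "T * ((1 + real R * M) / 2 ^ m) \<le> 1" by (simp add: field_simps)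
    moreover have "T * ((1 + real R) / T) = 1 + R" using T1 by simp
    moreover have "real R \<le> c" using R_le by simp
    ultimately show ?thesis unfolding distrib_left by linarith
  qed
  also have "\<dots> \<le> (c + 2) * (L * ?Y)" using LY by (simp add: mult_le_cancel_left1)
  finally have 2: "T * ((1 + real R) / T + (1 + real R * M) / 2 ^ m) \<le> (c + 2) * (L * ?Y)" .
  have 3: "sqrt T * (1 + ln (2 * real T ^ a)) \<le> (a + 2) * (L * ?Y)"
  proof -
    have "sqrt T = T powr (1 / 2)" using T1 by (simp add: powr_half_sqrt)
    also have "\<dots> \<le> T powr (1 / (1 + \<delta>))" using T1 \<delta> by (intro powr_mono) (auto simp: field_simps)
    also have "\<dots> \<le> ?Y" using n2 by (simp add: mult_le_cancel_right1)
    finally have s: "sqrt T \<le> ?Y" .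
    have "2 * T ^ a \<le> 2 ^ (1 + L * a)"
      using T_le_pow by (simp add: power_mult power_mono)
    then have "ln (real (2 * T ^ a)) \<le> 1 + L * a"
      using T1 by (intro ln_le_of_pow) auto
    then have "1 + ln (2 * real T ^ a) \<le> (a + 2) * L"
      using L1 by (simp add: algebra_simps)
    then have "sqrt T * (1 + ln (2 * real T ^ a)) \<le> sqrt T * ((a + 2) * L)" by (intro mult_left_mono) auto
    also have "\<dots> \<le> ?Y * ((a + 2) * L)" using s by (intro mult_right_mono) auto
    finally show ?thesis by (simp only: mult.commute mult.left_commute of_nat_mult)
  qed
  have "L * ?Y \<le> real L ^ (c + 1) * ?Y" using L_le_pow Y by (intro mult_right_mono) auto
  then have "(a + c + 4) * (L * ?Y) \<le> (a + c + 4) * (real L ^ (c + 1) * ?Y)" by (intro mult_left_mono) auto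
  then have "width R / T + T * ((1 + real R) / T + (1 + real R * M) / 2 ^ m) + sqrt T * (1 + ln (2 * real T ^ a))
      \<le> (288 * (9 + \<kappa>) * \<kappa> ^ c) * real L ^ (c + 1) * ?Y + (a + c + 4) * (real L ^ (c + 1) * ?Y)"
    using 1 2 3 by (simp add: algebra_simps)
  also have "\<dots> = ((288 * (9 + \<kappa>) * \<kappa> ^ c + a + c + 4) * real L ^ (c + 1)) * ?Y"
    by (simp add: algebra_simps)
  also have "\<dots> \<le> polylog const log_exponent n T * ?Y"
    by (intro mult_right_mono polylog_ge) (auto simp: const_def)
  finally show ?thesis .
qed

lemma alg_regret:
  assumes "oblivious_adversary P n T D"
  shows "\<P>(((p, l), \<omega>) in D \<Otimes>\<^sub>M coins.
      regret n T alg \<omega> p l \<le> polylog const log_exponent n T * ((real n)\<^sup>2 * real T powr (1 / (1 + \<delta>))))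
    \<ge> 1 - 1 / real T ^ a"
proof (rule prob_regret_ge[OF measurable_alg obeys_query_model_alg _ assms])
  fix p :: "nat \<Rightarrow> nat \<Rightarrow> 'a" and l
  assume pl: "(p, l) \<in> space (env_space P n T)"
  let ?\<theta> = "1 / sqrt T" and ?\<Delta> = "sqrt T * (1 + ln (2 * real T ^ a))"
  have "n \<le> m" by (simp add: m_def)
  also have "m < 2 ^ m" by (rule less_exp)
  finally have m: "n \<le> 2 ^ m" by simp
  have \<theta>: "0 \<le> ?\<theta>" "?\<theta> \<le> 1" using T1 by (auto simp: divide_le_eq)
  have T: "T \<le> blen R" using R_reach by (simp add: blen_def)
  obtain U where U: "U \<in> sets coins"
    "measure coins U \<le> R * T * (1 - 1 / (2 * n)) ^ N + exp (?\<theta>\<^sup>2 * T - ?\<theta> * ?\<Delta>)"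
    "\<And>\<omega>. \<omega> \<notin> U \<Longrightarrow> regret n T alg \<omega> p l \<le>
      width R / T + T * ((1 + real R) / T + (1 + real R * M) / 2 ^ m) + ?\<Delta>"
    by (rule regret_alg[OF pl m \<theta> T, of ?\<Delta>]) (rule that)
  have "measure coins U \<le> 1 / real T ^ a"
    using U(2) miss_le deviation_eq by simp
  moreover have "regret n T alg \<omega> p l \<le> polylog const log_exponent n T * ((real n)\<^sup>2 * real T powr (1 / (1 + \<delta>)))"
    if "\<omega> \<notin> U" for \<omega>
    using U(3)[OF that] error_le by linarith
  ultimately show "\<exists>U\<in>sets coins. measure coins U \<le> 1 / real T ^ a \<and> (\<forall>\<omega>. \<omega> \<notin> U \<longrightarrow>
      regret n T alg \<omega> p l \<le> polylog const log_exponent n T * ((real n)\<^sup>2 * real T powr (1 / (1 + \<delta>))))"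
    using U(1) by blast
qed (use n1 in auto)

end

theorem theorem1p1:
  fixes \<delta> :: real and P :: "'p measure" and c a :: nat
  assumes "0 < \<delta>" and "\<delta> < 1"
  shows "\<exists>(A :: nat \<Rightarrow> nat \<Rightarrow> 'p expert_alg) (b :: nat) (C :: real) (k :: nat).
    \<forall>n T. n \<ge> 1 \<and> T \<ge> 1 \<and> T \<le> n ^ c \<longrightarrow>
      measurable_alg P (A n T) \<and>
      obeys_query_model P n T (A n T) \<and>
      has_space_complexity P n T b (A n T) (polylog C k n T * real n powr \<delta>) \<and>
      (\<forall>D. oblivious_adversary P n T D \<longrightarrow>
        \<P>(((p, l), \<omega>) in D \<Otimes>\<^sub>M coins.
            regret n T (A n T) \<omega> p l
              \<le> polylog C k n T * ((real n)\<^sup>2 * real T powr (1 / (1 + \<delta>))))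
          \<ge> 1 - 1 / real T ^ a)"
proof -
  \<comment> \<open>These constants depend on \<open>a\<close> and \<open>c\<close> alone, so they
    can be fixed before \<open>n\<close> and \<open>T\<close>.\<close>
  define b where "b = 12 + chosen_params.\<kappa> a c"
  define C where "C = chosen_params.const a c"
  define k where "k = chosen_params.log_exponent c"
  define good where "good n T A \<longleftrightarrow> measurable_alg P A \<and> obeys_query_model P n T A \<and>
      has_space_complexity P n T b A (polylog C k n T * real n powr \<delta>) \<and>
      (\<forall>D. oblivious_adversary P n T D \<longrightarrow>
        \<P>(((p, l), \<omega>) in D \<Otimes>\<^sub>M coins.
            regret n T A \<omega> p l \<le> polylog C k n T * ((real n)\<^sup>2 * real T powr (1 / (1 + \<delta>))))
          \<ge> 1 - 1 / real T ^ a)" for n T and A :: "'p expert_alg"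
  have "\<exists>A. good n T A" if "n \<ge> 1 \<and> T \<ge> 1 \<and> T \<le> n ^ c" for n T
  proof -
    interpret chosen_params \<delta> a c n T
      using assms that by unfold_locales auto
    have "good n T alg"
      unfolding good_def b_def C_def k_def
      using measurable_alg obeys_query_model_alg has_space_complexity_alg[OF space_le word_ok] alg_regret
      by blast
    then show ?thesis ..
  qed
  then have "\<forall>n T. n \<ge> 1 \<and> T \<ge> 1 \<and> T \<le> n ^ c \<longrightarrow> good n T (SOME A. good n T A)"
    by (blast intro: someI_ex)
  then show ?thesis
    unfolding good_def by (intro exI)
qed

end
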